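(* Consider the two-firm development game with general profit functions described in the context, where $\bar\lambda=\sup_{D>0}\lambda(D)\le(1-g)\alpha$. Let $A_0\in\mathbb R$. Permanent joint pacing from $A_{10}=A_{20}=X_0=A_0$ (the path $A_{1t}=A_{2t}=X_t=A_0+gt$ for all $t\ge0$) is a subgame-perfect equilibrium (SPE) outcome if and only if, for each firm $i$ and each $x\ge A_0$, $$P_i(x)\ge R_i(x,x,x).$$ When this holds, a grim trigger implements pacing: the profile in which both firms develop at speed $g$ while the history follows the prescribed pacing path and at speed $1$ forever after any departure is an SPE with permanent joint pacing as an SPE outcome.
   Context: **Primitives.** $g\in(0,1)$, a discount rate $r>0$, a constant $\alpha>0$, and a hazard function $\lambda:\mathbb R\to[0,\infty)$ with $\lambda(D)=0$ for $D\le0$ and $\lambda(D)=\lambda_0+\phi(D)$ for $D>0$, where $\lambda_0\ge0$ and $\phi:[0,\infty)\to\mathbb R$ is continuous, nondecreasing, concave, twice continuously differentiable on $(0,\infty)$, with $\phi(0)=0$; assume $\bar\lambda:=\sup_{D>0}\lambda(D)$ is finite and $\bar\lambda\le(1-g)\alpha$. Firm $i$'s flow profit $\pi_i(A_i,A_j)$ is a positive continuously differentiable function on $\mathbb R^2$ with, at every capability pair, $\frac{\partial\log\pi_i(A_i,A_j)}{\partial A_i}\ge\alpha$ and $\frac{\partial\pi_i(A_i,A_j)}{\partial A_j}\le0$. For a state $S=(A_1,A_2,X)$ with $D=\max\{A_1,A_2\}-X$ and for $x\in\mathbb R$ let $$R_i(S)=\int_0^\infty e^{-rs-\int_0^s\lambda(D+(1-g)t)dt}\frac{\pi_i(A_i+s,A_j+s)}{\pi_i(A_i,A_j)}ds,\qquad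 P_i(x)=\int_0^\infty e^{-rs}\frac{\pi_i(x+gs,x+gs)}{\pi_i(x,x)}ds;$$ assume $R_i(S)<\infty$ for every state $S$ and $P_i(x)<\infty$ for every $x\in\mathbb R$, $i=1,2$. **Game.** Two firms $i\in\{1,2\}$ ($j$ denotes the other firm). A state is $S=(A_1,A_2,X)\in\mathbb R^3$; $D=\max\{A_1,A_2\}-X$. A feasible (pre-disaster) history $h_t=(S_s)_{0\le s\le t}$ is an absolutely continuous state path, from an arbitrary initial state, with $\dot A_{1s},\dot A_{2s}\in[0,1]$ and $\dot X_s=g$ for a.e. $s$. A pure strategy $\sigma_i$ prescribes a speed $\sigma_i(h_t)\in[0,1]$ after every feasible history; formally it is a map $[0,\infty)\times\Omega\to[0,1]$, $\Omega$ being the set of pairs (infinite feasible state path, disaster time $\tau_D\in[0,\infty]$), progressively measurable with respect to $\mathcal F_t=\sigma(S_{s},\mathbf 1\{\tau_D\le s\}:s\le t)$. For histories put $d(h_t,\tilde h_{t'})=|t-t'|+\sup_{s\ge0}\|h_t(s\wedge t)-\tilde h_{t'}(s\wedge t')\|$ (Euclidean norm), where $h_t(s)$ is the state of $h_t$ at date $s$. For a profile $\sigma=(\sigma_1,\sigma_2)$, $$K[\sigma](h_t)=\bigcap_{\varepsilon>0}\overline{\mathrm{co}}\{\sigma(\tilde h_{t'}):\tilde h_{t'}\text{ feasible},\ d(h_t,\tilde h_{t'})<\varepsilon\}\subseteq[0,1]^2.$$ $\mathcal P(\sigma;h_t)$ is the set of absolutely continuous extensions of $h_t$ to $[0,\infty)$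 with $(\dot A_{1s},\dot A_{2s})\in K[\sigma](h_s)$ and $\dot X_s=g$ for a.e. $s>t$ ($h_s$ = full history along the path); these are the admissible continuations. The payoff of firm $i$ is $$V_i(\sigma,h_t)=\sup_{\mathcal P(\sigma;h_t)}\int_t^\infty e^{-r(s-t)-\int_t^s\lambda(D_u)du}\,\pi_i(A_{is},A_{js})\,ds\in(0,\infty].$$ A pure profile $\sigma$ is an SPE if for every feasible history $h_t$, each $i$ and every strategy $\sigma_i'$, $V_i((\sigma_i',\sigma_j),h_t)\le V_i(\sigma,h_t)$. An SPE outcome is an admissible continuation under an SPE that attains both firms' assigned payoffs on that same path. *)

theory Defs
  imports "HOL-Analysis.Analysis"
begin

datatype firm = Firm1 | Firm2

fun rival :: "firm \<Rightarrow> firm" where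
  "rival Firm1 = Firm2"
| "rival Firm2 = Firm1"

text \<open>A state is a triple (A1, A2, X). The library norm on this product type is the
  Euclidean norm of the three coordinates.\<close>

type_synonym state = "real \<times> real \<times> real"
type_synonym path = "real \<Rightarrow> state"

fun cap :: "firm \<Rightarrow> state \<Rightarrow> real" where
  "cap Firm1 (A1, A2, X) = A1"
| "cap Firm2 (A1, A2, X) = A2"

fun gap :: "state \<Rightarrow> real" where
  "gap (A1, A2, X) = max A1 A2 - X"

definition abs_continuous_on :: "real \<Rightarrow> real \<Rightarrow> path \<Rightarrow> bool" where
  "abs_continuous_on a b h \<longleftrightarrow>
    (\<forall>\<epsilon>>0. \<exists>\<delta>>0. \<forall>(n::nat) l u.
       (\<forall>k<n. a \<le> l k \<and> l k \<le> u k \<and> u k \<le> b) \<and>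
       (\<forall>j<n. \<forall>k<n. j \<noteq> k \<longrightarrow> {l j<..<u j} \<inter> {l k<..<u k} = {}) \<and>
       (\<Sum>k<n. u k - l k) < \<delta>
       \<longrightarrow> (\<Sum>k<n. norm (h (u k) - h (l k))) < \<epsilon>)"

text \<open>A history of length t is a pair (t, h), of which only the restriction of h to [0, t]
  carries information: every notion below is insensitive to the values of h elsewhere.
  Likewise only the restriction of an infinite path to the nonnegative reals matters.\<close>

type_synonym history = "real \<times> path"

definition feasible_history :: "real \<Rightarrow> history \<Rightarrow> bool" where
  "feasible_history g = (\<lambda>(t, h). 0 \<le> t \<and> abs_continuous_on 0 t h \<and>
    (AE s in lborel. s \<in> {0<..<t} \<longrightarrow>
      (\<exists>v1\<in>{0..1}. \<exists>v2\<in>{0..1}. (h has_vector_derivative (v1, v2, g)) (at s))))"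

definition feasible_path :: "real \<Rightarrow> path \<Rightarrow> bool" where
  "feasible_path g p \<longleftrightarrow> (\<forall>T\<ge>0. feasible_history g (T, p))"

definition hist_dist :: "history \<Rightarrow> history \<Rightarrow> real" where
  "hist_dist = (\<lambda>(t, h) (t', h').
    \<bar>t - t'\<bar> + (SUP s\<in>{0..}. norm (h (min s t) - h' (min s t'))))"

text \<open>Elements of \<open>\<Omega>\<close>: an infinite feasible path and a disaster time in [0, \<open>\<infinity>\<close>].\<close>

type_synonym outcome = "path \<times> ennreal"

definition Omega :: "real \<Rightarrow> outcome set" where
  "Omega g = {\<omega>. feasible_path g (fst \<omega>)}"

definition Filt :: "real \<Rightarrow> real \<Rightarrow> outcome measure" where
  "Filt g t = sigma (Omega g)
    ({{\<omega> \<in> Omega g. fst \<omega> s \<in> B} | s B. s \<in> {0..t} \<and> B \<in> sets borel} \<union>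
     {{\<omega> \<in> Omega g. snd \<omega> \<le> ennreal s} | s. s \<in> {0..t}})"

type_synonym strategy = "real \<Rightarrow> outcome \<Rightarrow> real"
type_synonym profile = "firm \<Rightarrow> strategy"

definition progressively_measurable :: "real \<Rightarrow> strategy \<Rightarrow> bool" where
  "progressively_measurable g \<sigma> \<longleftrightarrow>
    (\<forall>T\<ge>0. (\<lambda>(s, \<omega>). \<sigma> s \<omega>) \<in> borel_measurable (restrict_space borel {0..T} \<Otimes>\<^sub>M Filt g T))"

definition strategies :: "real \<Rightarrow> strategy set" where
  "strategies g = {\<sigma>. (\<forall>t\<ge>0. \<forall>\<omega>\<in>Omega g. \<sigma> t \<omega> \<in> {0..1}) \<and> progressively_measurable g \<sigma>}"

text \<open>The speed prescribed after a pre-disaster history (t, h). A progressively measurable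
  strategy takes the same value at date t on all pairs (p, \<open>\<tau>\<close>) for which p extends h and
  \<open>\<tau> > t\<close>; the pair used here continues h with zero speeds and has no disaster.\<close>

definition extend :: "real \<Rightarrow> history \<Rightarrow> path" where
  "extend g = (\<lambda>(t, h) s. if s \<le> t then h s else h t + (s - t) *\<^sub>R (0, 0, g))"

definition prescribed :: "real \<Rightarrow> strategy \<Rightarrow> history \<Rightarrow> real" where
  "prescribed g \<sigma> H = \<sigma> (fst H) (extend g H, \<infinity>)"

definition speeds :: "real \<Rightarrow> profile \<Rightarrow> history \<Rightarrow> real \<times> real" where
  "speeds g \<sigma> H = (prescribed g (\<sigma> Firm1) H, prescribed g (\<sigma> Firm2) H)"

definition K :: "real \<Rightarrow> profile \<Rightarrow> history \<Rightarrow> (real \<times> real) set" where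
  "K g \<sigma> H = (\<Inter>\<epsilon>\<in>{0<..}.
    closure (convex hull (speeds g \<sigma> ` {H'. feasible_history g H' \<and> hist_dist H H' < \<epsilon>})))"

definition admissible :: "real \<Rightarrow> profile \<Rightarrow> history \<Rightarrow> path set" where
  "admissible g \<sigma> = (\<lambda>(t, h). {q.
    (\<forall>s\<in>{0..t}. q s = h s) \<and>
    (\<forall>T\<ge>0. abs_continuous_on 0 T q) \<and>
    (AE s in lborel. s > t \<longrightarrow>
      (\<exists>v1 v2. (q has_vector_derivative (v1, v2, g)) (at s) \<and> (v1, v2) \<in> K g \<sigma> (s, q)))})"

type_synonym profit = "firm \<Rightarrow> real \<Rightarrow> real \<Rightarrow> real"

text \<open>The arguments of \<open>\<pi> i\<close> are firm i's own capability and its rival's capability, in this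
  order.\<close>

definition path_payoff ::
  "real \<Rightarrow> (real \<Rightarrow> real) \<Rightarrow> profit \<Rightarrow> firm \<Rightarrow> real \<Rightarrow> path \<Rightarrow> ennreal" where
  "path_payoff r lam \<pi> i t q =
    (\<integral>\<^sup>+s\<in>{t..}. ennreal (exp (- r * (s - t) - (LINT u:{t..s}|lborel. lam (gap (q u))))
        * \<pi> i (cap i (q s)) (cap (rival i) (q s))) \<partial>lborel)"

definition V ::
  "real \<Rightarrow> real \<Rightarrow> (real \<Rightarrow> real) \<Rightarrow> profit \<Rightarrow> firm \<Rightarrow> profile \<Rightarrow> history \<Rightarrow> ennreal" where
  "V g r lam \<pi> i \<sigma> H = (SUP q\<in>admissible g \<sigma> H. path_payoff r lam \<pi> i (fst H) q)"

definition SPE :: "real \<Rightarrow> real \<Rightarrow> (real \<Rightarrow> real) \<Rightarrow> profit \<Rightarrow> profile \<Rightarrow> bool" where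
  "SPE g r lam \<pi> \<sigma> \<longleftrightarrow>
    (\<forall>i. \<sigma> i \<in> strategies g) \<and>
    (\<forall>H. feasible_history g H \<longrightarrow>
      (\<forall>i. \<forall>\<sigma>'\<in>strategies g. V g r lam \<pi> i (\<sigma>(i := \<sigma>')) H \<le> V g r lam \<pi> i \<sigma> H))"

definition SPE_outcome_under ::
  "real \<Rightarrow> real \<Rightarrow> (real \<Rightarrow> real) \<Rightarrow> profit \<Rightarrow> profile \<Rightarrow> history \<Rightarrow> path \<Rightarrow> bool" where
  "SPE_outcome_under g r lam \<pi> \<sigma> H q \<longleftrightarrow>
    SPE g r lam \<pi> \<sigma> \<and> q \<in> admissible g \<sigma> H \<and>
    (\<forall>i. path_payoff r lam \<pi> i (fst H) q = V g r lam \<pi> i \<sigma> H)"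

definition SPE_outcome ::
  "real \<Rightarrow> real \<Rightarrow> (real \<Rightarrow> real) \<Rightarrow> profit \<Rightarrow> history \<Rightarrow> path \<Rightarrow> bool" where
  "SPE_outcome g r lam \<pi> H q \<longleftrightarrow> (\<exists>\<sigma>. SPE_outcome_under g r lam \<pi> \<sigma> H q)"

definition initial :: "real \<Rightarrow> history" where
  "initial A0 = (0, \<lambda>_. (A0, A0, A0))"

definition pacing :: "real \<Rightarrow> real \<Rightarrow> path" where
  "pacing g A0 t = (A0 + g * t, A0 + g * t, A0 + g * t)"

text \<open>Histories starting from any state other than (A0, A0, A0) count as departures; after a
  disaster, where payoffs no longer depend on speeds, the same rule is kept.\<close>

definition grim_trigger :: "real \<Rightarrow> real \<Rightarrow> profile" where
  "grim_trigger g A0 i t \<omega> = (if \<forall>s\<in>{0..t}. fst \<omega> s = pacing g A0 s then g else 1)"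

definition R_race ::
  "real \<Rightarrow> real \<Rightarrow> (real \<Rightarrow> real) \<Rightarrow> profit \<Rightarrow> firm \<Rightarrow> state \<Rightarrow> ennreal" where
  "R_race g r lam \<pi> i S =
    (\<integral>\<^sup>+s\<in>{0..}. ennreal
      (exp (- r * s - (LINT t:{0..s}|lborel. lam (gap S + (1 - g) * t)))
        * (\<pi> i (cap i S + s) (cap (rival i) S + s) / \<pi> i (cap i S) (cap (rival i) S))) \<partial>lborel)"

definition P_pace :: "real \<Rightarrow> real \<Rightarrow> profit \<Rightarrow> firm \<Rightarrow> real \<Rightarrow> ennreal" where
  "P_pace g r \<pi> i x =
    (\<integral>\<^sup>+s\<in>{0..}. ennreal
      (exp (- r * s) * (\<pi> i (x + g * s) (x + g * s) / \<pi> i x x)) \<partial>lborel)"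

end

theory Submission
  imports Defs "HOL-Complex_Analysis.Great_Picard"
begin

text \<open>Off the pacing path the grim trigger makes the rival race. Against a racing rival, delaying by
  \<open>\<beta>\<close> costs a factor \<open>exp (\<alpha> \<beta>)\<close> of flow profit, while it saves at most \<open>\<alpha> \<beta>\<close> of
  cumulated hazard, because the racing gap grows at rate \<open>1 - g\<close> and the hazard is at most
  \<open>(1 - g) \<alpha>\<close>. So racing is a best reply at every date simultaneously, and a deviation that
  leaves the pacing path at capability \<open>x\<close> is worth at most a race from \<open>(x, x, x)\<close>, which
  \<open>P x \<ge> R (x, x, x)\<close> makes unprofitable. Conversely, in any equilibrium supporting pacing a firm may
  start racing at capability \<open>x\<close>; a slower rival can only help it, so it secures \<open>R (x, x, x)\<close>.

  The converse needs an admissible path against an arbitrary rival strategy. It is a limit of Euler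
  polygons; its velocities exist almost everywhere since monotone Lipschitz functions are
  differentiable almost everywhere.\<close>

subsection \<open>Absolutely continuous paths\<close>

text \<open>Payoffs are suprema over all paths with velocities in \<open>K\<close>. Every pacing
  history is a limit of departed ones, so on the path \<open>K\<close> contains (1, 1) besides (g,
  g), and the trigger itself admits paths that leave pacing at any date. Sufficiency therefore
  bounds each admissible path separately and reads the exit date off that path. Off the path this
  freedom is gone for a firm that uses the trigger: having departed is an open condition in
  \<open>hist_dist\<close>, so its speed in \<open>K\<close> is exactly 1. In the converse, the
  outcome property speaks of payoffs at the initial history only, while the deviation starts later.
  The payoff collected in between has to be cancelled, and finiteness of \<open>P_pace\<close>
  permits this. Feasibility is given by derivatives almost everywhere, which do not pass to limits
  of polygons. The proof works with the equivalent bounds on increments, \<open>moves\<close>, and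
  returns to derivatives only where \<open>K\<close> requires velocities.\<close>

lemma abs_continuous_onD:
  assumes "abs_continuous_on a b h" "0 < e"
  obtains d where "0 < d"
    "\<And>D. \<lbrakk>finite D; \<And>I. I \<in> D \<Longrightarrow> a \<le> fst I \<and> fst I \<le> snd I \<and> snd I \<le> b;
       \<And>I J. \<lbrakk>I \<in> D; J \<in> D; I \<noteq> J\<rbrakk> \<Longrightarrow> {fst I<..<snd I} \<inter> {fst J<..<snd J} = {};
       (\<Sum>I\<in>D. snd I - fst I) < d\<rbrakk> \<Longrightarrow> (\<Sum>I\<in>D. norm (h (snd I) - h (fst I))) < e"
proof -
  obtain d where d: "0 < d" and
    H: "\<forall>(n::nat) l u. (\<forall>k<n. a \<le> l k \<and> l k \<le> u k \<and> u k \<le> b) \<and>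
       (\<forall>j<n. \<forall>k<n. j \<noteq> k \<longrightarrow> {l j<..<u j} \<inter> {l k<..<u k} = {}) \<and>
       (\<Sum>k<n. u k - l k) < d \<longrightarrow> (\<Sum>k<n. norm (h (u k) - h (l k))) < e"
    using assms(1)[unfolded abs_continuous_on_def, rule_format, OF assms(2)] by (elim exE conjE)
  show thesis
  proof (rule that[OF d])
    fix D :: "(real \<times> real) set"
    assume D: "finite D" "\<And>I. I \<in> D \<Longrightarrow> a \<le> fst I \<and> fst I \<le> snd I \<and> snd I \<le> b"
      "\<And>I J. \<lbrakk>I \<in> D; J \<in> D; I \<noteq> J\<rbrakk> \<Longrightarrow> {fst I<..<snd I} \<inter> {fst J<..<snd J} = {}"
      "(\<Sum>I\<in>D. snd I - fst I) < d"
    \<comment> \<open>The definition numbers its intervals, whereas a tagged division supplies an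
      unordered finite set.\<close>
    obtain \<iota> where "bij_betw \<iota> {0..<card D} D"
      using ex_bij_betw_nat_finite[OF D(1)] by blast
    then have b: "bij_betw \<iota> {..<card D} D"
      by (simp add: atLeast0LessThan)
    have s: "(\<Sum>k<card D. F (\<iota> k)) = sum F D" for F :: "real \<times> real \<Rightarrow> real"
      by (rule sum.reindex_bij_betw[OF b])
    have mem: "\<iota> k \<in> D" if "k < card D" for k
      using b that by (auto simp: bij_betw_def)
    have inj: "\<iota> j \<noteq> \<iota> k" if "j < card D" "k < card D" "j \<noteq> k" for j k
      using b that by (auto simp: bij_betw_def inj_on_def)
    show "(\<Sum>I\<in>D. norm (h (snd I) - h (fst I))) < e"
      unfolding s[of "\<lambda>I. norm (h (snd I) - h (fst I))", symmetric]
      by (rule H[rule_format], intro conjI allI impI)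
        (simp add: D mem, simp add: D mem, simp add: D mem, use D(3) mem inj in blast, simp_all add: D mem s[of "\<lambda>I. snd I - fst I"])
  qed
qed

lemma abs_continuous_on_subset:
  assumes "abs_continuous_on a b h" "a \<le> a'" "b' \<le> b"
  shows "abs_continuous_on a' b' h"
  unfolding abs_continuous_on_def
proof (intro allI impI)
  fix e :: real assume e: "0 < e"
  obtain d where d: "d > 0" and
    H: "\<forall>(n::nat) l u. (\<forall>k<n. a \<le> l k \<and> l k \<le> u k \<and> u k \<le> b) \<and>
       (\<forall>j<n. \<forall>k<n. j \<noteq> k \<longrightarrow> {l j<..<u j} \<inter> {l k<..<u k} = {}) \<and>
       (\<Sum>k<n. u k - l k) < d \<longrightarrow> (\<Sum>k<n. norm (h (u k) - h (l k))) < e"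
    using assms(1)[unfolded abs_continuous_on_def, rule_format, OF e] by (elim exE conjE)
  show "\<exists>\<delta>>0. \<forall>(n::nat) l u. (\<forall>k<n. a' \<le> l k \<and> l k \<le> u k \<and> u k \<le> b') \<and>
       (\<forall>j<n. \<forall>k<n. j \<noteq> k \<longrightarrow> {l j<..<u j} \<inter> {l k<..<u k} = {}) \<and>
       (\<Sum>k<n. u k - l k) < \<delta> \<longrightarrow> (\<Sum>k<n. norm (h (u k) - h (l k))) < e"
  proof (intro exI[of _ d] conjI allI impI d)
    fix n :: nat and l u :: "nat \<Rightarrow> real"
    assume *: "(\<forall>k<n. a' \<le> l k \<and> l k \<le> u k \<and> u k \<le> b') \<and>
       (\<forall>j<n. \<forall>k<n. j \<noteq> k \<longrightarrow> {l j<..<u j} \<inter> {l k<..<u k} = {}) \<and>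
       (\<Sum>k<n. u k - l k) < d"
    then have "\<forall>k<n. a \<le> l k \<and> l k \<le> u k \<and> u k \<le> b"
      using assms(2,3) by fastforce
    with * show "(\<Sum>k<n. norm (h (u k) - h (l k))) < e" by (intro H[rule_format]) blast
  qed
qed

text \<open>The tags at which the derivative is missing sit in intervals of small total length, on which
  absolute continuity controls the increments; this replaces the fundamental theorem of calculus.\<close>

lemma abs_continuous_on_increment_ge:
  assumes ac: "abs_continuous_on a b h" and ab: "a \<le> b"
    and der: "AE s in lborel. s \<in> {a<..<b} \<longrightarrow>
      (\<exists>D. (h has_vector_derivative D) (at s) \<and> c \<le> w \<bullet> D)"
  shows "c * (b - a) \<le> w \<bullet> (h b - h a)"
proof -
  define f where "f s = w \<bullet> h s - c * s" for s
  have main: "f b - f a \<ge> - e * (norm w + \<bar>c\<bar> + (b - a))" if e: "0 < e" for e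
  proof -
    obtain d where d: "0 < d" and
      small: "\<And>D. \<lbrakk>finite D; \<And>I. I \<in> D \<Longrightarrow> a \<le> fst I \<and> fst I \<le> snd I \<and> snd I \<le> b;
         \<And>I J. \<lbrakk>I \<in> D; J \<in> D; I \<noteq> J\<rbrakk> \<Longrightarrow> {fst I<..<snd I} \<inter> {fst J<..<snd J} = {};
         (\<Sum>I\<in>D. snd I - fst I) < d\<rbrakk> \<Longrightarrow> (\<Sum>I\<in>D. norm (h (snd I) - h (fst I))) < e"
      using abs_continuous_onD[OF ac e] by blast
    obtain N0 where N0: "{s \<in> space lborel. \<not> (s \<in> {a<..<b} \<longrightarrow>
        (\<exists>D. (h has_vector_derivative D) (at s) \<and> c \<le> w \<bullet> D))} \<subseteq> N0"
      "emeasure lborel N0 = 0" "N0 \<in> sets lborel"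
      using der by (rule AE_E)
    \<comment> \<open>The hypothesis covers the open interval only, so both endpoints are treated as
      bad tags.\<close>
    define N where "N = N0 \<union> {a, b}"
    have N: "N \<in> sets borel" "emeasure lborel N = 0"
    proof -
      show "N \<in> sets borel" using N0 by (auto simp: N_def)
      have "{a, b} \<in> null_sets lborel" by (rule finite_imp_null_set_lborel) auto
      moreover have "N0 \<in> null_sets lborel" using N0 by (simp add: null_sets_def)
      ultimately show "emeasure lborel N = 0"
        using null_sets.Un null_setsD1 unfolding N_def by blast
    qed
    \<comment> \<open>Below \<open>d\<close>, absolute continuity controls the increments of
      \<open>h\<close>; below \<open>e\<close>, the drift term \<open>c * s\<close> is small as
      well.\<close>
    define m where "m = min d e"
    have m: "m > 0" "m \<le> d" "m \<le> e" using d e by (auto simp: m_def)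
    obtain U where U: "open U" "N \<subseteq> U" "emeasure lborel (U - N) < ennreal m"
      using outer_regular_lborel[OF N(1) m(1)] by blast
    have Um: "emeasure lborel U < ennreal m"
    proof -
      have "emeasure lborel U \<le> emeasure lborel N + emeasure lborel (U - N)"
        using U N by (metis Diff_partition borel_open emeasure_subadditive sets.Diff sets_lborel)
      then show ?thesis using U N by simp
    qed
    \<comment> \<open>Straddle estimate: the tag splits the interval in two, so the derivative at
      the tag alone bounds the increment between the endpoints.\<close>
    have "\<exists>d>0. \<forall>u v. u \<le> x \<longrightarrow> x \<le> v \<longrightarrow> {u..v} \<subseteq> ball x d \<longrightarrow> f v - f u \<ge> - e * (v - u)"
      if x: "x \<in> {a..b}" "x \<notin> N" for x
    proof -
      have "x \<in> {a<..<b}" using x by (auto simp: N_def)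
      moreover have "x \<notin> N0" using x by (auto simp: N_def)
      ultimately obtain D where D: "(h has_vector_derivative D) (at x)" "c \<le> w \<bullet> D"
        using N0(1) by (simp add: subset_iff) blast
      have "(f has_vector_derivative (w \<bullet> D - c)) (at x)"
        unfolding f_def using D(1)
        by (auto intro!: derivative_eq_intros bounded_linear.has_vector_derivative[OF bounded_linear_inner_right])
      then have "(f has_derivative (\<lambda>y. y *\<^sub>R (w \<bullet> D - c))) (at x)"
        by (simp add: has_vector_derivative_def)
      then obtain d where d: "d > 0" and
        dd: "\<And>y. norm (y - x) < d \<Longrightarrow> norm (f y - f x - (y - x) *\<^sub>R (w \<bullet> D - c)) \<le> e * norm (y - x)"
        using e unfolding has_derivative_at_alt by meson
      show ?thesis
      proof (intro exI[of _ d] conjI d allI impI)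
        fix u v assume uv: "u \<le> x" "x \<le> v" "{u..v} \<subseteq> ball x d"
        have "u \<in> {u..v}" "v \<in> {u..v}" using uv by auto
        then have "u \<in> ball x d" "v \<in> ball x d" using uv(3) by blast+
        then have "\<bar>u - x\<bar> < d" "\<bar>v - x\<bar> < d" by (auto simp: dist_real_def)
        then have 1: "\<bar>f u - f x - (u - x) * (w \<bullet> D - c)\<bar> \<le> e * \<bar>u - x\<bar>"
          and 2: "\<bar>f v - f x - (v - x) * (w \<bullet> D - c)\<bar> \<le> e * \<bar>v - x\<bar>"
          using dd[of u] dd[of v] by auto
        have 3: "(v - u) * (w \<bullet> D - c) \<ge> 0" using uv D by auto
        have "e * \<bar>u - x\<bar> + e * \<bar>v - x\<bar> = e * (v - u)" using uv by (auto simp: algebra_simps)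
        moreover have "(v - x) * (w \<bullet> D - c) - (u - x) * (w \<bullet> D - c) = (v - u) * (w \<bullet> D - c)"
          by (simp add: algebra_simps)
        ultimately show "f v - f u \<ge> - e * (v - u)" using 1 2 3 by simp
      qed
    qed
    then obtain \<rho> where \<rho>: "\<And>x. x \<in> {a..b} \<Longrightarrow> x \<notin> N \<Longrightarrow> 0 < \<rho> x \<and>
        (\<forall>u v. u \<le> x \<longrightarrow> x \<le> v \<longrightarrow> {u..v} \<subseteq> ball x (\<rho> x) \<longrightarrow> f v - f u \<ge> - e * (v - u))"
      by metis
    \<comment> \<open>Good tags get the radius of the straddle estimate. Bad tags get
      \<open>U\<close>, so their intervals all lie in a set of measure below
      \<open>m\<close>.\<close>
    define \<gamma> where "\<gamma> x = (if x \<in> N then U else if x \<in> {a..b} then ball x (\<rho> x) else UNIV)" for x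
    have "gauge \<gamma>"
      using U \<rho> by (auto simp: gauge_def \<gamma>_def)
    then obtain p where p: "p tagged_division_of {a..b}" and fine: "\<gamma> fine p"
      using fine_division_exists_real by blast
    define B where "B = {z \<in> p. fst z \<in> N}"
    have pf: "finite p" using p by (simp add: tagged_division_of_finite)
    have Bf: "finite B" and Bp: "B \<subseteq> p" using pf by (auto simp: B_def)
    have pK: "\<exists>l u. snd z = {l..u} \<and> l \<le> u \<and> a \<le> l \<and> u \<le> b \<and> l \<le> fst z \<and> fst z \<le> u \<and> fst z \<in> {a..b} \<and>
       Inf (snd z) = l \<and> Sup (snd z) = u"
      if "z \<in> p" for z
    proof -
      obtain x K where z: "z = (x, K)" by (cases z)
      have "(x, K) \<in> p" using that z by simp
      from tagged_division_ofD(2-4)[OF p this] obtain l u where "K = {l..u}" "x \<in> K" "K \<subseteq> {a..b}"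
        by (metis box_real(2))
      then show ?thesis using z by (intro exI[of _ l] exI[of _ u]) auto
    qed
    define \<iota> where "\<iota> z = (Inf (snd z), Sup (snd z))" for z :: "real \<times> real set"
    have disj: "{fst (\<iota> z)<..<snd (\<iota> z)} \<inter> {fst (\<iota> y)<..<snd (\<iota> y)} = {}"
      if "z \<in> p" "y \<in> p" "z \<noteq> y" for z y
    proof -
      have "interior (snd z) \<inter> interior (snd y) = {}"
        using tagged_division_ofD(5)[OF p, of "fst z" "snd z" "fst y" "snd y"] that by auto
      moreover have "interior (snd z) = {fst (\<iota> z)<..<snd (\<iota> z)}" if "z \<in> p" for z
        using pK[OF that] by (metis \<iota>_def fst_conv interior_atLeastAtMost_real snd_conv)
      ultimately show ?thesis using that by blast
    qed
    \<comment> \<open>Passing to endpoint pairs can identify two pieces only if both are the same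
      single point, and such a piece contributes zero.\<close>
    have reindex: "sum F (\<iota> ` B) = (\<Sum>z\<in>B. F (\<iota> z))" if "\<And>x. F (x, x) = 0" for F :: "real \<times> real \<Rightarrow> real"
    proof (subst sum.reindex_nontrivial[OF Bf])
      fix z y assume zy: "z \<in> B" "y \<in> B" "z \<noteq> y" "\<iota> z = \<iota> y"
      then have "{fst (\<iota> z)<..<snd (\<iota> z)} = {}" using disj[of z y] Bp by auto
      moreover have "fst (\<iota> z) \<le> snd (\<iota> z)" using pK[of z] zy Bp by (auto simp: \<iota>_def)
      ultimately have "fst (\<iota> z) = snd (\<iota> z)" by auto
      then show "F (\<iota> z) = 0" using that by (metis prod.collapse)
    qed (simp add: o_def)
    have le: "a \<le> fst I \<and> fst I \<le> snd I \<and> snd I \<le> b" if "I \<in> \<iota> ` B" for I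
    proof -
      obtain z where "z \<in> p" "I = \<iota> z" using \<open>I \<in> \<iota> ` B\<close> Bp by blast
      then show ?thesis using pK[of z] by (auto simp: \<iota>_def)
    qed
    have disj': "{fst I<..<snd I} \<inter> {fst J<..<snd J} = {}" if "I \<in> \<iota> ` B" "J \<in> \<iota> ` B" "I \<noteq> J" for I J
      using that disj Bp by blast
    have len: "(\<Sum>I\<in>\<iota> ` B. snd I - fst I) < m"
    proof -
      have "ennreal (\<Sum>I\<in>\<iota> ` B. snd I - fst I) = (\<Sum>I\<in>\<iota> ` B. emeasure lborel {fst I<..<snd I})"
        using le by (subst sum_ennreal[symmetric]) (auto intro!: sum.cong)
      also have "\<dots> = emeasure lborel (\<Union>I\<in>\<iota> ` B. {fst I<..<snd I})"
        using Bf disj' by (intro sum_emeasure) (auto simp: disjoint_family_on_def)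
      also have "\<dots> \<le> emeasure lborel U"
      proof (intro emeasure_mono UN_least)
        fix I assume "I \<in> \<iota> ` B"
        then obtain z where z: "z \<in> B" "I = \<iota> z" by auto
        then have "snd z \<subseteq> \<gamma> (fst z)" using fine Bp by (cases z) (auto simp: fine_def)
        then have "snd z \<subseteq> U" using z by (auto simp: B_def \<gamma>_def)
        moreover have "{fst I<..<snd I} \<subseteq> snd z"
          using pK[of z] z Bp by (metis \<iota>_def fst_conv greaterThanLessThan_subseteq_atLeastAtMost_iff order_refl snd_conv subsetD)
        ultimately show "{fst I<..<snd I} \<subseteq> U" by blast
      qed (use U in auto)
      also note Um
      finally show ?thesis using le by (subst (asm) ennreal_less_iff) (auto intro!: sum_nonneg)
    qed
    have len': "(\<Sum>z\<in>B. Sup (snd z) - Inf (snd z)) < m"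
      using len reindex[of "\<lambda>I. snd I - fst I"] by (simp add: \<iota>_def)
    have bad0: "(\<Sum>I\<in>\<iota> ` B. norm (h (snd I) - h (fst I))) < e"
      by (rule small) (use Bf le disj' len m in auto)
    have bad1: "(\<Sum>z\<in>B. norm (h (Sup (snd z)) - h (Inf (snd z)))) < e"
      using bad0 reindex[of "\<lambda>I. norm (h (snd I) - h (fst I))"] by (simp add: \<iota>_def)
    define \<Delta> where "\<Delta> z = f (Sup (snd z)) - f (Inf (snd z))" for z :: "real \<times> real set"
    have "f b - f a = (\<Sum>z\<in>p. \<Delta> z)"
      using additive_tagged_division_1[OF ab p, of f] by (simp add: \<Delta>_def case_prod_beta')
    also have "\<dots> = (\<Sum>z\<in>B. \<Delta> z) + (\<Sum>z\<in>p - B. \<Delta> z)"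
      using pf Bp by (metis add.commute sum.subset_diff)
    also have "\<dots> \<ge> - (e * (norm w + \<bar>c\<bar>)) + - (e * (b - a))"
    proof (rule add_mono)
      have "- (\<Sum>z\<in>B. norm w * norm (h (Sup (snd z)) - h (Inf (snd z))) + \<bar>c\<bar> * (Sup (snd z) - Inf (snd z)))
          \<le> (\<Sum>z\<in>B. \<Delta> z)"
        unfolding sum_negf[symmetric]
      proof (rule sum_mono)
        fix z assume "z \<in> B"
        then have le: "Inf (snd z) \<le> Sup (snd z)" using pK[of z] Bp by auto
        have "\<bar>w \<bullet> (h (Sup (snd z)) - h (Inf (snd z)))\<bar> \<le> norm w * norm (h (Sup (snd z)) - h (Inf (snd z)))"
          by (rule Cauchy_Schwarz_ineq2)
        moreover have "c * (Sup (snd z) - Inf (snd z)) \<le> \<bar>c\<bar> * (Sup (snd z) - Inf (snd z))"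
          using le by (intro mult_right_mono) auto
        ultimately show "- (norm w * norm (h (Sup (snd z)) - h (Inf (snd z))) + \<bar>c\<bar> * (Sup (snd z) - Inf (snd z))) \<le> \<Delta> z"
          by (simp add: \<Delta>_def f_def inner_diff_right algebra_simps)
      qed
      moreover have "norm w * (\<Sum>z\<in>B. norm (h (Sup (snd z)) - h (Inf (snd z)))) \<le> norm w * e"
        using bad1 by (intro mult_left_mono) auto
      moreover have "\<bar>c\<bar> * (\<Sum>z\<in>B. Sup (snd z) - Inf (snd z)) \<le> \<bar>c\<bar> * e"
        using len' m by (intro mult_left_mono) auto
      ultimately show "- (e * (norm w + \<bar>c\<bar>)) \<le> (\<Sum>z\<in>B. \<Delta> z)"
        unfolding sum.distrib sum_distrib_left[symmetric] distrib_left mult.commute[of e] by linarith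
    next
      have tot: "(\<Sum>z\<in>p. Sup (snd z) - Inf (snd z)) = b - a"
        using additive_tagged_division_1[OF ab p, of "\<lambda>x. x"] by (simp add: case_prod_beta')
      have "(\<Sum>z\<in>p - B. Sup (snd z) - Inf (snd z)) \<le> b - a"
        unfolding tot[symmetric] using pf pK by (intro sum_mono2) force+
      then have "- (e * (b - a)) \<le> - (e * (\<Sum>z\<in>p - B. Sup (snd z) - Inf (snd z)))"
        using e by simp
      also have "\<dots> = (\<Sum>z\<in>p - B. - e * (Sup (snd z) - Inf (snd z)))"
        by (simp add: sum_distrib_left sum_negf)
      also have "\<dots> \<le> (\<Sum>z\<in>p - B. \<Delta> z)"
      proof (rule sum_mono)
        fix z assume z: "z \<in> p - B"
        then obtain l u where lu: "snd z = {l..u}" "l \<le> fst z" "fst z \<le> u" "fst z \<in> {a..b}"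
           "Inf (snd z) = l" "Sup (snd z) = u" using pK by blast
        have "fst z \<notin> N" using z by (auto simp: B_def)
        moreover have "snd z \<subseteq> \<gamma> (fst z)" using fine z by (cases z) (auto simp: fine_def)
        ultimately have "{l..u} \<subseteq> ball (fst z) (\<rho> (fst z))" using lu by (auto simp: \<gamma>_def)
        then show "- e * (Sup (snd z) - Inf (snd z)) \<le> \<Delta> z"
          using \<rho>[of "fst z"] lu \<open>fst z \<notin> N\<close> by (simp add: \<Delta>_def)
      qed
      finally show "- (e * (b - a)) \<le> (\<Sum>z\<in>p - B. \<Delta> z)" .
    qed
    finally show ?thesis by (simp add: algebra_simps)
  qed
  define M where "M = norm w + \<bar>c\<bar> + (b - a)"
  have "f b - f a \<ge> 0"
  proof (rule field_le_epsilon)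
    fix e :: real assume e: "0 < e"
    have M: "M \<ge> 0" using ab by (simp add: M_def)
    \<comment> \<open>The added 1 avoids a division by zero when \<open>M\<close> vanishes.\<close>
    have "e / (M + 1) * M \<le> e" using M e by (simp add: field_simps)
    moreover have "f b - f a \<ge> - (e / (M + 1)) * M"
      using main[of "e / (M + 1)"] M e by (simp add: M_def)
    ultimately show "0 \<le> f b - f a + e" by simp
  qed
  then show ?thesis by (simp add: f_def inner_diff_right algebra_simps)
qed

subsection \<open>Almost everywhere differentiability of monotone Lipschitz functions\<close>

text \<open>The two Stieltjes measures add up to interval length, and this determines Lebesgue
  measure. It is applied to \<open>F\<close> and \<open>x - F(x)\<close>: slow growth of one is fast
  growth of the other, so a single covering argument handles both.\<close>

lemma interval_measure_add:
  assumes "mono F" "continuous_on UNIV F" "mono G" "continuous_on UNIV G" "A \<in> sets borel"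
    and sum: "\<And>x. F x + G x = x"
  shows "emeasure (interval_measure F) A + emeasure (interval_measure G) A = emeasure lborel A"
proof -
  define \<mu> where "\<mu> B = emeasure (interval_measure F) B + emeasure (interval_measure G) B" for B
  define M where "M = measure_of UNIV (sets borel) \<mu>"
  have em: "emeasure M B = \<mu> B" if "B \<in> sets borel" for B
    unfolding M_def
  proof (rule emeasure_measure_of_sigma)
    show "sigma_algebra UNIV (sets (borel :: real measure))"
      using sets.sigma_algebra_axioms[of "borel :: real measure"] by simp
    show "positive (sets borel) \<mu>" by (simp add: positive_def \<mu>_def)
    show "countably_additive (sets borel) \<mu>"
    proof (rule countably_additiveI)
      fix B :: "nat \<Rightarrow> real set"
      assume B: "range B \<subseteq> sets borel" "disjoint_family B"
      show "(\<Sum>i. \<mu> (B i)) = \<mu> (\<Union> (range B))"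
        unfolding \<mu>_def using B
        by (simp add: suminf_add[symmetric] suminf_emeasure)
    qed
  qed (use that in auto)
  have incr: "F a \<le> F b" "G a \<le> G b" if "a \<le> b" for a b
    using assms that by (auto dest: monoD)
  have cont: "isCont F x" "isCont G x" for x
    using assms by (auto simp: continuous_on_eq_continuous_at)
  have rc: "continuous (at_right x) F" "continuous (at_right x) G" for x
    using cont by (auto intro: continuous_at_imp_continuous_at_within)
  have Ioo: "\<mu> {a<..<b} = ennreal (b - a)" if ab: "a \<le> b" for a b
  proof -
    have pt: "\<mu> {b} = 0" for b
      using emeasure_interval_measure_Icc[of b b F] emeasure_interval_measure_Icc[of b b G] incr assms
      unfolding \<mu>_def by simp
    have Ioc: "\<mu> {a<..b} = ennreal (b - a)"
      unfolding \<mu>_def using ab incr rc sum[of a] sum[of b]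
      by (subst (1 2) emeasure_interval_measure_Ioc) (auto simp: ennreal_plus[symmetric] algebra_simps simp del: ennreal_plus)
    show ?thesis
    proof (cases "a = b")
      case False
      then have "{a<..b} = {a<..<b} \<union> {b}" using ab by auto
      then have "emeasure M {a<..b} = emeasure M {a<..<b} + emeasure M {b}"
        by (simp add: plus_emeasure M_def)
      then show ?thesis using pt Ioc by (simp add: em)
    qed (simp add: \<mu>_def)
  qed
  have "lborel = M"
  proof (rule lborel_eqI)
    show "sets M = sets borel"
      using sets.sigma_sets_eq[of "borel :: real measure"] by (simp add: M_def)
    show "emeasure M (box l u) = (\<Prod>b\<in>Basis. (u - l) \<bullet> b)" if "\<And>b. b \<in> Basis \<Longrightarrow> l \<bullet> b \<le> u \<bullet> b" for l u
      using Ioo[of l u] that by (simp add: em box_real)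
  qed
  then show ?thesis using em[OF assms(5)] by (simp add: \<mu>_def)
qed

text \<open>The Vitali covering step: disjoint intervals on which \<open>F\<close> grows fast fill up \<open>E\<close>.\<close>

lemma emeasure_le_interval_measure:
  assumes F: "mono F" "continuous_on UNIV F" and q: "0 \<le> q" and G: "open G" "E \<subseteq> G" "E \<in> sets borel"
    and cov: "\<And>x d. \<lbrakk>x \<in> E; 0 < d\<rbrakk> \<Longrightarrow> \<exists>u v. u < v \<and> x \<in> {u..v} \<and> v - u < d \<and> q * (v - u) \<le> F v - F u"
  shows "ennreal q * emeasure lborel E \<le> emeasure (interval_measure F) G"
proof -
  \<comment> \<open>Confining the intervals to \<open>G\<close> is what later bounds their total
    mass by the mass of \<open>G\<close>.\<close>
  define I where "I = {(u, v). u < v \<and> {u..v} \<subseteq> G \<and> q * (v - u) \<le> F v - F u}"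
  define c where "c = (\<lambda>(u, v). (u + v) / 2 :: real)"
  define \<rho> where "\<rho> = (\<lambda>(u, v). (v - u) / 2 :: real)"
  have cb: "cball (c z) (\<rho> z) = {fst z..snd z}" for z
    by (simp add: c_def \<rho>_def cball_eq_atLeastAtMost case_prod_beta field_simps)
  have ex: "\<exists>z\<in>I. x \<in> cball (c z) (\<rho> z) \<and> \<rho> z < d" if x: "x \<in> E" and d: "0 < d" for x d
  proof -
    obtain e where e: "e > 0" "ball x e \<subseteq> G" using G x by (meson open_contains_ball subsetD)
    obtain u v where uv: "u < v" "x \<in> {u..v}" "v - u < min d e" "q * (v - u) \<le> F v - F u"
      using cov[OF x, of "min d e"] d e by auto
    have "{u..v} \<subseteq> ball x e" using uv by (auto simp: dist_real_def)
    then have "(u, v) \<in> I" using uv e by (auto simp: I_def)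
    moreover have "\<rho> (u, v) < d" using uv by (simp add: \<rho>_def)
    ultimately show ?thesis using uv cb by (intro bexI[of _ "(u, v)"]) auto
  qed
  obtain C where C: "countable C" "C \<subseteq> I" "pairwise (\<lambda>i j. disjnt (cball (c i) (\<rho> i)) (cball (c j) (\<rho> j))) C"
    "negligible (E - (\<Union>i\<in>C. cball (c i) (\<rho> i)))"
  proof (rule Vitali_covering_theorem_cballs[of I \<rho> E c])
    show "0 < \<rho> z" if "z \<in> I" for z using that by (auto simp: I_def \<rho>_def)
    show "\<exists>z. z \<in> I \<and> x \<in> cball (c z) (\<rho> z) \<and> \<rho> z < d" if "x \<in> E" "0 < d" for x d
      using ex[OF that] by blast
  qed
  let ?A = "\<lambda>z. {fst z..snd z}"
  have dj: "disjoint_family_on ?A C"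
    using C(3) unfolding cb by (auto simp: disjoint_family_on_def pairwise_def disjnt_def)
  have inc: "F u \<le> F v" if "u \<le> v" for u v using F that by (auto dest: monoD)
  have meas: "(\<Union>z\<in>C. ?A z) \<in> sets lborel"
    using C(1) by (intro sets.countable_UN') auto
  have null: "emeasure lborel (E - (\<Union>z\<in>C. ?A z)) = 0"
  proof -
    have "E - (\<Union>z\<in>C. ?A z) \<in> sets lborel" using meas G(3) by auto
    then show ?thesis
      using C(4) unfolding cb negligible_iff_null_sets by (simp add: null_sets_completion_iff null_setsD1)
  qed
  have "emeasure lborel E \<le> emeasure lborel ((\<Union>z\<in>C. ?A z) \<union> (E - (\<Union>z\<in>C. ?A z)))"
    using meas G(3) by (intro emeasure_mono) auto
  also have "\<dots> \<le> emeasure lborel (\<Union>z\<in>C. ?A z) + emeasure lborel (E - (\<Union>z\<in>C. ?A z))"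
    using meas G(3) by (intro emeasure_subadditive) auto
  finally have "emeasure lborel E \<le> emeasure lborel (\<Union>z\<in>C. ?A z)"
    by (simp add: null)
  then have le: "emeasure lborel E \<le> (\<integral>\<^sup>+z. emeasure lborel (?A z) \<partial>count_space C)"
    by (subst (asm) emeasure_UN_countable[OF _ C(1) dj]) simp_all
  then have "ennreal q * emeasure lborel E \<le> ennreal q * (\<integral>\<^sup>+z. emeasure lborel (?A z) \<partial>count_space C)"
    by (rule mult_left_mono) simp
  also have "\<dots> = (\<integral>\<^sup>+z. ennreal q * emeasure lborel (?A z) \<partial>count_space C)"
    by (rule nn_integral_cmult[symmetric]) simp
  also have "\<dots> \<le> (\<integral>\<^sup>+z. emeasure (interval_measure F) (?A z) \<partial>count_space C)"
  proof (rule nn_integral_mono)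
    fix z assume "z \<in> space (count_space C)"
    then have z: "fst z < snd z" "q * (snd z - fst z) \<le> F (snd z) - F (fst z)"
      using C(2) by (auto simp: I_def)
    have "emeasure (interval_measure F) (?A z) = ennreal (F (snd z) - F (fst z))"
      by (rule emeasure_interval_measure_Icc) (use z inc F(2) in auto)
    then show "ennreal q * emeasure lborel (?A z) \<le> emeasure (interval_measure F) (?A z)"
      using z q by (simp add: ennreal_mult'[symmetric] ennreal_leI)
  qed
  also have "\<dots> = emeasure (interval_measure F) (\<Union>z\<in>C. ?A z)"
    by (rule emeasure_UN_countable[OF _ C(1) dj, symmetric]) simp
  also have "\<dots> \<le> emeasure (interval_measure F) G"
  proof (intro emeasure_mono UN_least)
    show "?A z \<subseteq> G" if "z \<in> C" for z
      using C(2) that by (cases z) (auto simp: I_def)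
  qed (use G(1) in auto)
  finally show ?thesis .
qed

text \<open>Let \<open>S\<close> be a bounded part of the set where short intervals around a point
  have quotients above \<open>q\<close> and others have quotients below \<open>p < q\<close>.
  Covering \<open>S\<close> inside an open \<open>G\<close> gives mass at least q|S| for
  \<open>F\<close> and at least (1 - p)|S| for \<open>x - F(x)\<close>. Together they are at most
  |G|, which exceeds |S| by arbitrarily little; hence (q - p)|S| \<le> 0.\<close>

lemma AE_differentiable_of_increments:
  fixes F :: "real \<Rightarrow> real"
  assumes F: "\<And>u v. u \<le> v \<Longrightarrow> 0 \<le> F v - F u \<and> F v - F u \<le> v - u"
  shows "AE x in lborel. \<exists>D. (F has_vector_derivative D) (at x)"
proof -
  \<comment> \<open>Quotients over open intervals around the point, rather than from the point, make
    these sets open, so \<open>E p q\<close> is Borel without further work.\<close>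
  define A where "A q n = (\<Union>(u, v)\<in>{(u, v). v - u < 1 / Suc n \<and> q * (v - u) < F v - F u}. {u<..<v})" for q and n :: nat
  define B where "B p n = (\<Union>(u, v)\<in>{(u, v). v - u < 1 / Suc n \<and> F v - F u < p * (v - u)}. {u<..<v})" for p and n :: nat
  define E where "E p q = (\<Inter>n. A q n \<inter> B p n)" for p q
  have op: "open (A q n)" "open (B p n)" for p q n
    unfolding A_def B_def by (auto intro!: open_UN)
  then have E_borel: "E p q \<in> sets borel" for p q
    unfolding E_def by (intro sets.countable_INT) auto
  have cont: "continuous_on UNIV F"
  proof (rule lipschitz_on_continuous_on[where L=1], rule lipschitz_onI)
    show "dist (F x) (F y) \<le> 1 * dist x y" for x y
      using F[of x y] F[of y x] by (cases "x \<le> y") (auto simp: dist_real_def)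
  qed simp
  define H where "H x = x - F x" for x
  have H: "mono H" "continuous_on UNIV H"
  proof -
    show "mono H"
    proof (rule monoI)
      show "H u \<le> H v" if "u \<le> v" for u v using F[OF that] by (simp add: H_def)
    qed
    show "continuous_on UNIV H" unfolding H_def by (intro continuous_intros cont)
  qed
  have Fm: "mono F"
  proof (rule monoI)
    show "F u \<le> F v" if "u \<le> v" for u v using F[OF that] by simp
  qed
  have null: "emeasure lborel (E p q) = 0" if pq: "p < q" for p q
  proof (cases "E p q = {}")
    case False
    then obtain x where x: "x \<in> E p q" by auto
    then have "x \<in> A q 0" "x \<in> B p 0" by (auto simp: E_def)
    then obtain u v u' v' where 1: "u < x" "x < v" "q * (v - u) < F v - F u"
      "u' < x" "x < v'" "F v' - F u' < p * (v' - u')"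
      unfolding A_def B_def by auto
    then have le: "u \<le> v" "u' \<le> v'" by linarith+
    have "0 < p * (v' - u')" using conjunct1[OF F[OF le(2)]] 1 by linarith
    then have "0 < p" using le by (simp add: zero_less_mult_iff)
    moreover have "q * (v - u) < v - u"
      using 1(3) conjunct2[OF F[OF le(1)]] by (rule less_le_trans)
    then have "0 < (1 - q) * (v - u)" by (simp add: algebra_simps)
    then have "q < 1" using le by (simp add: zero_less_mult_iff)
    \<comment> \<open>Quotients of \<open>F\<close> lie between 0 and 1, so a point of
      \<open>E p q\<close> forces these signs. They make both weights \<open>q\<close> and
      \<open>1 - p\<close> nonnegative in the covering step.\<close>
    ultimately have p: "0 < p" "q < 1" by simp_all
    \<comment> \<open>A bounded window keeps the measure finite, so that it can be subtracted as a
      real number.\<close>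
    have "emeasure lborel (E p q \<inter> {-real N<..<real N}) = 0" for N :: nat
    proof -
      define S where "S = E p q \<inter> {-real N<..<real N}"
      have S: "S \<in> sets borel" using E_borel by (auto simp: S_def)
      have fin: "emeasure lborel S \<noteq> \<infinity>"
      proof -
        have "emeasure lborel S \<le> emeasure lborel {-real N<..<real N}"
          by (intro emeasure_mono) (auto simp: S_def)
        then show ?thesis by (auto simp: top_unique)
      qed
      define s where "s = measure lborel S"
      have s: "emeasure lborel S = ennreal s" "0 \<le> s"
        using fin by (auto simp: s_def emeasure_eq_ennreal_measure)
      have "(q - p) * s \<le> 0"
      proof (rule field_le_epsilon)
        fix e :: real assume e: "0 < e"
        obtain G where G: "open G" "S \<subseteq> G" "emeasure lborel (G - S) < ennreal e"
          using outer_regular_lborel[OF S e] by blast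
        have small: "\<exists>n. 1 / real (Suc n) < d" if "0 < d" for d
          using that by (metis nat_approx_posE)
        have "ennreal q * emeasure lborel S \<le> emeasure (interval_measure F) G"
        proof (rule emeasure_le_interval_measure[OF Fm cont _ G(1,2) S])
          fix x d :: real assume x: "x \<in> S" and d: "0 < d"
          obtain n where n: "1 / real (Suc n) < d" using small[OF d] by blast
          have "x \<in> A q n" using x by (auto simp: S_def E_def)
          then obtain u v where "v - u < 1 / Suc n" "q * (v - u) < F v - F u" "u < x" "x < v"
            unfolding A_def by auto
          then show "\<exists>u v. u < v \<and> x \<in> {u..v} \<and> v - u < d \<and> q * (v - u) \<le> F v - F u"
            using n by (intro exI[of _ u] exI[of _ v]) auto
        qed (use p pq in auto)
        moreover have "ennreal (1 - p) * emeasure lborel S \<le> emeasure (interval_measure H) G"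
        proof (rule emeasure_le_interval_measure[OF H _ G(1,2) S])
          fix x d :: real assume x: "x \<in> S" and d: "0 < d"
          obtain n where n: "1 / real (Suc n) < d" using small[OF d] by blast
          have "x \<in> B p n" using x by (auto simp: S_def E_def)
          then obtain u v where "v - u < 1 / Suc n" "F v - F u < p * (v - u)" "u < x" "x < v"
            unfolding B_def by auto
          then show "\<exists>u v. u < v \<and> x \<in> {u..v} \<and> v - u < d \<and> (1 - p) * (v - u) \<le> H v - H u"
            using n by (intro exI[of _ u] exI[of _ v]) (auto simp: H_def algebra_simps)
        qed (use p pq in auto)
        ultimately have "ennreal q * emeasure lborel S + ennreal (1 - p) * emeasure lborel S
            \<le> emeasure (interval_measure F) G + emeasure (interval_measure H) G"
          by (rule add_mono)
        also have "\<dots> = emeasure lborel G"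
          using G(1) by (intro interval_measure_add Fm cont H) (auto simp: H_def)
        also have "\<dots> \<le> emeasure lborel S + emeasure lborel (G - S)"
        proof -
          have "emeasure lborel (S \<union> (G - S)) \<le> emeasure lborel S + emeasure lborel (G - S)"
            using S G by (intro emeasure_subadditive) auto
          then show ?thesis using G(2) by (simp add: Un_absorb1)
        qed
        also have "\<dots> \<le> ennreal s + ennreal e"
          using G(3) s by (intro add_mono) auto
        finally have "ennreal (q * s + (1 - p) * s) \<le> ennreal (s + e)"
          using p pq s e by (simp add: ennreal_mult ennreal_plus)
        then show "(q - p) * s \<le> 0 + e"
          using s e by (subst (asm) ennreal_le_iff) (auto simp: algebra_simps)
      qed
      then have "s = 0" using pq s by (simp add: mult_le_0_iff)
      then show ?thesis using s by (simp add: S_def)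
    qed
    then have "emeasure lborel (\<Union>N. E p q \<inter> {-real N<..<real N}) = 0"
      using E_borel by (intro emeasure_UN_eq_0) auto
    moreover have "(\<Union>N. E p q \<inter> {-real N<..<real N}) = E p q"
    proof -
      have "\<exists>N::nat. -real N < x \<and> x < real N" for x :: real
        using reals_Archimedean2[of "\<bar>x\<bar>"] by (metis abs_less_iff minus_less_iff)
      then show ?thesis by auto
    qed
    ultimately show ?thesis by simp
  qed simp
  have der: "\<exists>D. (F has_vector_derivative D) (at x)" if x: "\<And>p q. p \<in> \<rat> \<Longrightarrow> q \<in> \<rat> \<Longrightarrow> p < q \<Longrightarrow> x \<notin> E p q" for x
  proof -
    have upA: "F v - F u \<le> q * (v - u)" if nA: "x \<notin> A q n" and uv: "u \<le> x" "x \<le> v" "v - u < 1 / Suc n" for q n u v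
    proof (rule ccontr)
      assume "\<not> F v - F u \<le> q * (v - u)"
      then have gt: "F v - F u - q * (v - u) > 0" by simp
      \<comment> \<open>Widening by \<eta> on each side puts \<open>x\<close> strictly inside. The
        first bound keeps the interval short enough. The second keeps the excess positive:
        \<open>F\<close> does not decrease, and the right side grows by at most 2|q|\<eta>, with
        \<eta> to spare by the added 1.\<close>
      define \<eta> where "\<eta> = min ((1 / Suc n - (v - u)) / 3) ((F v - F u - q * (v - u)) / (2 * \<bar>q\<bar> + 1))"
      have \<eta>: "\<eta> > 0" using gt uv by (auto simp: \<eta>_def)
      have "\<eta> * (2 * \<bar>q\<bar> + 1) \<le> F v - F u - q * (v - u)"
        using gt by (auto simp: \<eta>_def min_le_iff_disj pos_le_divide_eq[symmetric])
      moreover have "q * (2 * \<eta>) \<le> \<eta> * (2 * \<bar>q\<bar>)" using \<eta> by (auto simp: abs_if algebra_simps mult_less_0_iff)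
      moreover have "F (v + \<eta>) - F (u - \<eta>) \<ge> F v - F u"
        using F[of v "v + \<eta>"] F[of "u - \<eta>" u] \<eta> by auto
      moreover have "\<eta> * (2 * \<bar>q\<bar> + 1) = \<eta> * (2 * \<bar>q\<bar>) + \<eta>"
        "q * ((v + \<eta>) - (u - \<eta>)) = q * (v - u) + q * (2 * \<eta>)"
        by (simp_all add: algebra_simps)
      ultimately have "q * ((v + \<eta>) - (u - \<eta>)) < F (v + \<eta>) - F (u - \<eta>)"
        using \<eta> by linarith
      moreover have "(v + \<eta>) - (u - \<eta>) < 1 / Suc n"
      proof -
        have "\<eta> \<le> (1 / Suc n - (v - u)) / 3" unfolding \<eta>_def by (rule min.cobounded1)
        then have "3 * \<eta> \<le> k - (v - u)" if "k = 1 / real (Suc n)" for k using that by simp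
        then have "v + \<eta> - (u - \<eta>) < k" if "k = 1 / real (Suc n)" for k
          using that uv \<eta> by fastforce
        then show ?thesis by blast
      qed
      ultimately have "x \<in> A q n" using uv \<eta> unfolding A_def
        by (intro UN_I[of "(u - \<eta>, v + \<eta>)"]) auto
      then show False using nA by simp
    qed
    have lowB: "p * (v - u) \<le> F v - F u" if nB: "x \<notin> B p n" and uv: "u \<le> x" "x \<le> v" "v - u < 1 / Suc n" for p n u v
    proof (rule ccontr)
      assume "\<not> p * (v - u) \<le> F v - F u"
      then have gt: "p * (v - u) - (F v - F u) > 0" by simp
      then have "p * (v - u) > 0" using F[of u v] uv by auto
      then have p: "p > 0" using uv by (simp add: zero_less_mult_iff)
      \<comment> \<open>Here the widening may add up to 2\<eta> to the increment of
        \<open>F\<close>, by the Lipschitz bound; a third of the deficit leaves room for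
        that.\<close>
      define \<eta> where "\<eta> = min ((1 / Suc n - (v - u)) / 3) ((p * (v - u) - (F v - F u)) / 3)"
      have \<eta>: "\<eta> > 0" using gt uv by (auto simp: \<eta>_def)
      have 1: "\<eta> \<le> (1 / Suc n - (v - u)) / 3" and 2: "\<eta> \<le> (p * (v - u) - (F v - F u)) / 3"
        unfolding \<eta>_def by (rule min.cobounded1, rule min.cobounded2)
      have "F (v + \<eta>) - F (u - \<eta>) \<le> F v - F u + 2 * \<eta>"
        using F[of v "v + \<eta>"] F[of "u - \<eta>" u] \<eta> by auto
      moreover have "0 \<le> p * (2 * \<eta>)" using p \<eta> by simp
      ultimately have "F (v + \<eta>) - F (u - \<eta>) < p * ((v + \<eta>) - (u - \<eta>))"
        using \<eta> 2 by (simp add: algebra_simps)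
      moreover have "(v + \<eta>) - (u - \<eta>) < 1 / Suc n"
      proof -
        have "3 * \<eta> \<le> k - (v - u)" if "k = 1 / real (Suc n)" for k using that 1 by simp
        then have "v + \<eta> - (u - \<eta>) < k" if "k = 1 / real (Suc n)" for k
          using that uv \<eta> by fastforce
        then show ?thesis by blast
      qed
      ultimately have "x \<in> B p n" using uv \<eta> unfolding B_def
        by (intro UN_I[of "(u - \<eta>, v + \<eta>)"]) auto
      then show False using nB by simp
    qed
    \<comment> \<open>\<open>U\<close> is the upper derivative over straddling intervals, bounding
      quotients from above up to any margin. For rationals p' < q' just below \<open>U\<close>, the
      point lies in every \<open>A q' n\<close>. Being outside \<open>E p' q'\<close>, it must miss
      some \<open>B p' n\<close>, and this bounds the quotients from below by p'.\<close>
    define Q where "Q = {q. \<exists>n. x \<notin> A q n}"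
    define U where "U = Inf Q"
    have "x \<notin> A 1 0"
    proof
      assume "x \<in> A 1 0"
      then obtain u v where "1 * (v - u) < F v - F u" "u < x" "x < v" unfolding A_def by auto
      then show False using F[of u v] by simp
    qed
    then have Q1: "1 \<in> Q" by (auto simp: Q_def)
    have Q0: "0 \<le> q" if q: "q \<in> Q" for q
    proof -
      obtain n where n: "x \<notin> A q n" using q by (auto simp: Q_def)
      define w :: real where "w = 1 / Suc n / 2"
      have w: "0 < w" "w < 1 / Suc n" by (simp_all add: w_def field_simps)
      have "0 \<le> q * w" using upA[OF n, of x "x + w"] F[of x "x + w"] w by simp
      then show ?thesis using w by (simp add: zero_le_mult_iff)
    qed
    have bdd: "bdd_below Q" using Q0 by (rule bdd_belowI)
    have "(F has_field_derivative U) (at x)"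
      unfolding has_field_derivative_iff
    proof (rule tendstoI)
      fix e :: real assume e: "0 < e"
      have "Inf Q < U + e / 2" using e by (simp add: U_def)
      then obtain q where "q \<in> Q" "q < U + e / 2" using Q1 cInf_lessD[of Q] by blast
      then obtain n1 where n1: "x \<notin> A q n1" and q: "q < U + e / 2" by (auto simp: Q_def)
      obtain p' where p': "p' \<in> \<rat>" "U - e / 2 < p'" "p' < U" using Rats_dense_in_real[of "U - e / 2" U] e by auto
      obtain q' where q': "q' \<in> \<rat>" "p' < q'" "q' < U" using Rats_dense_in_real[of p' U] p' by auto
      have "q' \<notin> Q" using q' bdd by (auto simp: U_def dest: cInf_lower)
      then have "x \<in> A q' n" for n by (auto simp: Q_def)
      then obtain n2 where n2: "x \<notin> B p' n2" using x[OF p'(1) q'(1,2)] by (auto simp: E_def)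
      define d where "d = min (1 / Suc n1) (1 / Suc n2)"
      have "dist ((F y - F x) / (y - x)) U < e" if y: "y \<noteq> x" "dist y x < d" for y
      proof -
        define u where "u = min x y"
        define v where "v = max x y"
        have uv: "u \<le> x" "x \<le> v" "u < v" "v - u < 1 / Suc n1" "v - u < 1 / Suc n2"
          using y by (auto simp: u_def v_def d_def dist_real_def)
        have eq: "(F y - F x) / (y - x) = (F v - F u) / (v - u)"
          using y by (cases "x < y") (auto simp: u_def v_def min_def max_def field_simps)
        have "(F v - F u) / (v - u) \<le> q"
          using upA[OF n1 uv(1,2,4)] uv by (simp add: pos_divide_le_eq)
        moreover have "p' \<le> (F v - F u) / (v - u)"
          using lowB[OF n2 uv(1,2,5)] uv by (simp add: pos_le_divide_eq)
        ultimately show ?thesis unfolding eq using q p' by (auto simp: dist_real_def)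
      qed
      then show "\<forall>\<^sub>F y in at x. dist ((F y - F x) / (y - x)) U < e"
        unfolding eventually_at by (intro exI[of _ d]) (auto simp: d_def)
    qed
    then show ?thesis by (auto simp: has_real_derivative_iff_has_vector_derivative)
  qed
  define N where "N = (\<Union>(p, q)\<in>{(p, q). p \<in> \<rat> \<and> q \<in> \<rat> \<and> p < q}. E p q)"
  have "N \<in> null_sets lborel"
    unfolding N_def
  proof (rule null_sets_UN')
    have "{(p, q). p \<in> \<rat> \<and> q \<in> \<rat> \<and> p < q} \<subseteq> \<rat> \<times> (\<rat> :: real set)" by auto
    then show "countable {(p :: real, q). p \<in> \<rat> \<and> q \<in> \<rat> \<and> p < q}"
      by (rule countable_subset) (auto intro: countable_rat)
    fix z :: "real \<times> real" assume "z \<in> {(p, q). p \<in> \<rat> \<and> q \<in> \<rat> \<and> p < q}"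
    then show "(case z of (p, q) \<Rightarrow> E p q) \<in> null_sets lborel"
      using null E_borel by (auto simp: null_sets_def)
  qed
  then show ?thesis
  proof (rule AE_I')
    show "{x \<in> space lborel. \<not> (\<exists>D. (F has_vector_derivative D) (at x))} \<subseteq> N"
    proof
      fix x assume "x \<in> {x \<in> space lborel. \<not> (\<exists>D. (F has_vector_derivative D) (at x))}"
      then obtain p q where "p \<in> \<rat>" "q \<in> \<rat>" "p < q" "x \<in> E p q" using der[of x] by blast
      then show "x \<in> N" unfolding N_def by blast
    qed
  qed
qed

subsection \<open>Feasible histories as Lipschitz paths\<close>

text \<open>Feasibility in integrated form. Being a closed condition on pairs of dates, it survives
  pointwise limits and concatenation and ignores null sets of dates.\<close>

definition moves :: "real \<Rightarrow> real \<Rightarrow> path \<Rightarrow> bool" where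
  "moves g T h \<longleftrightarrow> (\<forall>u v. 0 \<le> u \<longrightarrow> u \<le> v \<longrightarrow> v \<le> T \<longrightarrow>
     fst (h v) - fst (h u) \<in> {0..v - u} \<and> fst (snd (h v)) - fst (snd (h u)) \<in> {0..v - u} \<and>
     snd (snd (h v)) - snd (snd (h u)) = g * (v - u))"

lemma movesD:
  assumes "moves g T h" "0 \<le> u" "u \<le> v" "v \<le> T"
  shows "0 \<le> fst (h v) - fst (h u)" "fst (h v) - fst (h u) \<le> v - u"
    "0 \<le> fst (snd (h v)) - fst (snd (h u))" "fst (snd (h v)) - fst (snd (h u)) \<le> v - u"
    "snd (snd (h v)) - snd (snd (h u)) = g * (v - u)"
  using assms unfolding moves_def by auto

lemma moves_subset: "moves g T h \<Longrightarrow> S \<le> T \<Longrightarrow> moves g S h"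
  unfolding moves_def by (meson order_trans)

lemma moves_cong: "(\<And>s. 0 \<le> s \<Longrightarrow> s \<le> T \<Longrightarrow> h s = h' s) \<Longrightarrow> moves g T h \<longleftrightarrow> moves g T h'"
  unfolding moves_def by (smt (verit))

lemma moves_join:
  assumes "moves g t h" "0 \<le> t"
    and "\<And>u v. t \<le> u \<Longrightarrow> u \<le> v \<Longrightarrow> v \<le> T \<Longrightarrow>
     fst (h v) - fst (h u) \<in> {0..v - u} \<and> fst (snd (h v)) - fst (snd (h u)) \<in> {0..v - u} \<and>
     snd (snd (h v)) - snd (snd (h u)) = g * (v - u)"
  shows "moves g T h"
  unfolding moves_def
proof (intro allI impI)
  fix u v :: real assume uv: "0 \<le> u" "u \<le> v" "v \<le> T"
  consider "v \<le> t" | "t \<le> u" | "u \<le> t" "t \<le> v" by linarith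
  then show "fst (h v) - fst (h u) \<in> {0..v - u} \<and> fst (snd (h v)) - fst (snd (h u)) \<in> {0..v - u} \<and>
     snd (snd (h v)) - snd (snd (h u)) = g * (v - u)"
  proof cases
    case 1
    then show ?thesis using assms(1) uv unfolding moves_def by blast
  next
    case 2
    then show ?thesis using assms(3) uv by blast
  next
    case 3
    then show ?thesis using assms(3)[of t v] movesD[OF assms(1), of u t] uv by (auto simp: algebra_simps)
  qed
qed

lemma norm_triple_le: "norm (a :: real, b :: real, c :: real) \<le> \<bar>a\<bar> + \<bar>b\<bar> + \<bar>c\<bar>"
  using norm_Pair_le[of a "(b, c)"] norm_Pair_le[of b c] by simp

text \<open>The constant 3 counts one unit of speed for each of the three coordinates; nothing below
  depends on its being sharp.\<close>

lemma moves_norm_le: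
  assumes "moves g T h" "0 \<le> g" "g \<le> 1" "0 \<le> u" "u \<le> v" "v \<le> T"
  shows "norm (h v - h u) \<le> 3 * (v - u)"
proof -
  have "h v - h u = (fst (h v) - fst (h u), fst (snd (h v)) - fst (snd (h u)), snd (snd (h v)) - snd (snd (h u)))"
    by (simp add: prod_eq_iff)
  then have "norm (h v - h u) \<le> \<bar>fst (h v) - fst (h u)\<bar> + \<bar>fst (snd (h v)) - fst (snd (h u))\<bar> + \<bar>g * (v - u)\<bar>"
    using norm_triple_le movesD(5)[OF assms(1,4,5,6)] by metis
  moreover have "\<bar>g * (v - u)\<bar> \<le> v - u"
    using assms by (simp add: abs_mult mult_left_le_one_le)
  moreover have "\<bar>fst (h v) - fst (h u)\<bar> \<le> v - u" "\<bar>fst (snd (h v)) - fst (snd (h u))\<bar> \<le> v - u"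
    using movesD[OF assms(1,4,5,6)] by auto
  ultimately have "norm (h v - h u) \<le> (v - u) + (v - u) + (v - u)" by (meson add_mono order_trans)
  then show ?thesis by simp
qed

lemma moves_abs_continuous_on:
  assumes "moves g T h" "0 \<le> g" "g \<le> 1"
  shows "abs_continuous_on 0 T h"
  unfolding abs_continuous_on_def
proof (intro allI impI)
  fix e :: real assume e: "0 < e"
  show "\<exists>\<delta>>0. \<forall>(n::nat) l u. (\<forall>k<n. 0 \<le> l k \<and> l k \<le> u k \<and> u k \<le> T) \<and>
       (\<forall>j<n. \<forall>k<n. j \<noteq> k \<longrightarrow> {l j<..<u j} \<inter> {l k<..<u k} = {}) \<and>
       (\<Sum>k<n. u k - l k) < \<delta> \<longrightarrow> (\<Sum>k<n. norm (h (u k) - h (l k))) < e"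
  proof (intro exI[of _ "e / 3"] conjI allI impI)
    fix n :: nat and l u :: "nat \<Rightarrow> real"
    assume *: "(\<forall>k<n. 0 \<le> l k \<and> l k \<le> u k \<and> u k \<le> T) \<and>
       (\<forall>j<n. \<forall>k<n. j \<noteq> k \<longrightarrow> {l j<..<u j} \<inter> {l k<..<u k} = {}) \<and>
       (\<Sum>k<n. u k - l k) < e / 3"
    then have "(\<Sum>k<n. norm (h (u k) - h (l k))) \<le> (\<Sum>k<n. 3 * (u k - l k))"
      by (intro sum_mono moves_norm_le[OF assms]) auto
    also have "\<dots> = 3 * (\<Sum>k<n. u k - l k)" by (rule sum_distrib_left[symmetric])
    also have "\<dots> < e" using * by simp
    finally show "(\<Sum>k<n. norm (h (u k) - h (l k))) < e" .
  qed (use e in simp)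
qed

lemma increments_derivative_bounds:
  fixes F :: "real \<Rightarrow> real"
  assumes F: "\<And>u v. u \<le> v \<Longrightarrow> 0 \<le> F v - F u \<and> F v - F u \<le> v - u"
    and D: "(F has_vector_derivative D) (at x)"
  shows "D \<in> {0..1}"
proof -
  have "((\<lambda>y. (F y - F x) / (y - x)) \<longlongrightarrow> D) (at x)"
    using D unfolding has_real_derivative_iff_has_vector_derivative[symmetric] has_field_derivative_iff .
  moreover have "\<forall>\<^sub>F y in at x. (F y - F x) / (y - x) \<in> {0..1}"
    unfolding eventually_at
  proof (intro exI[of _ 1] conjI ballI impI)
    fix y assume "y \<noteq> x \<and> dist y x < 1"
    then show "(F y - F x) / (y - x) \<in> {0..1}"
      using F[of x y] F[of y x] by (cases "x < y") (auto simp: field_simps)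
  qed simp
  ultimately show ?thesis
    by (intro Lim_in_closed_set[of "{0..1}" "\<lambda>y. (F y - F x) / (y - x)" "at x" D]) auto
qed

lemma moves_AE_derivative:
  assumes h: "moves g T h"
  shows "AE s in lborel. s \<in> {0<..<T} \<longrightarrow>
      (\<exists>v1\<in>{0..1}. \<exists>v2\<in>{0..1}. (h has_vector_derivative (v1, v2, g)) (at s))"
proof (cases "0 \<le> T")
  case T: True
  \<comment> \<open>Freezing the path outside the horizon yields coordinates with the same increment
    bounds on the whole line.\<close>
  define c where "c x = max 0 (min x T)" for x
  have c: "0 \<le> c x" "c x \<le> T" for x using T by (auto simp: c_def)
  have cm: "c u \<le> c v \<and> c v - c u \<le> v - u" if "u \<le> v" for u v using that by (auto simp: c_def)
  define F1 where "F1 x = fst (h (c x))" for x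
  define F2 where "F2 x = fst (snd (h (c x)))" for x
  have F1: "0 \<le> F1 v - F1 u \<and> F1 v - F1 u \<le> v - u" if uv: "u \<le> v" for u v
    using movesD(1,2)[OF h, of "c u" "c v"] c cm[OF uv] by (auto simp: F1_def)
  have F2: "0 \<le> F2 v - F2 u \<and> F2 v - F2 u \<le> v - u" if uv: "u \<le> v" for u v
    using movesD(3,4)[OF h, of "c u" "c v"] c cm[OF uv] by (auto simp: F2_def)
  have "AE x in lborel. \<exists>D. (F1 has_vector_derivative D) (at x)"
    by (rule AE_differentiable_of_increments) (rule F1)
  moreover have "AE x in lborel. \<exists>D. (F2 has_vector_derivative D) (at x)"
    by (rule AE_differentiable_of_increments) (rule F2)
  ultimately show ?thesis
  proof eventually_elim
    case (elim s)
    show ?case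
    proof
      assume s: "s \<in> {0<..<T}"
      obtain D1 D2 where D: "(F1 has_vector_derivative D1) (at s)" "(F2 has_vector_derivative D2) (at s)"
        using elim by blast
      have "((\<lambda>y. snd (snd (h 0)) + g * y) has_vector_derivative g) (at s)"
        by (auto intro!: derivative_eq_intros)
      with D have "((\<lambda>y. (F1 y, F2 y, snd (snd (h 0)) + g * y)) has_vector_derivative (D1, D2, g)) (at s)"
        by (auto intro!: has_vector_derivative_Pair)
      then have "(h has_vector_derivative (D1, D2, g)) (at s)"
      proof (rule has_vector_derivative_transform_within_open[OF _ _ s])
        show "(F1 y, F2 y, snd (snd (h 0)) + g * y) = h y" if "y \<in> {0<..<T}" for y
          using movesD(5)[OF h, of 0 y] that by (simp add: F1_def F2_def c_def prod_eq_iff)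
      qed simp
      moreover have "D1 \<in> {0..1}"
        by (rule increments_derivative_bounds[OF _ D(1)]) (rule F1)
      moreover have "D2 \<in> {0..1}"
        by (rule increments_derivative_bounds[OF _ D(2)]) (rule F2)
      ultimately show "\<exists>v1\<in>{0..1}. \<exists>v2\<in>{0..1}. (h has_vector_derivative (v1, v2, g)) (at s)"
        by blast
    qed
  qed
qed simp

text \<open>From derivatives to increments, the mean value bound for absolutely continuous paths is
  applied to plus and minus each coordinate. The way back differentiates monotone Lipschitz
  coordinates.\<close>

lemma feasible_history_iff:
  assumes g: "0 \<le> g" "g \<le> 1"
  shows "feasible_history g (t, h) \<longleftrightarrow> 0 \<le> t \<and> moves g t h"
proof
  assume "0 \<le> t \<and> moves g t h"
  then show "feasible_history g (t, h)"
    unfolding feasible_history_def case_prod_conv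
    using moves_abs_continuous_on[OF _ g] moves_AE_derivative by blast
next
  assume *: "feasible_history g (t, h)"
  then have t: "0 \<le> t" and ac: "abs_continuous_on 0 t h" and
    der: "AE s in lborel. s \<in> {0<..<t} \<longrightarrow>
      (\<exists>v1\<in>{0..1}. \<exists>v2\<in>{0..1}. (h has_vector_derivative (v1, v2, g)) (at s))"
    by (auto simp: feasible_history_def)
  have "moves g t h"
    unfolding moves_def
  proof (intro allI impI)
    fix u v assume uv: "0 \<le> u" "u \<le> v" "v \<le> t"
    have "c * (v - u) \<le> w \<bullet> (h v - h u)"
      if cw: "\<And>v1 v2. v1 \<in> {0..1} \<Longrightarrow> v2 \<in> {0..1} \<Longrightarrow> c \<le> w \<bullet> (v1, v2, g)" for c w
    proof (rule abs_continuous_on_increment_ge[OF abs_continuous_on_subset[OF ac uv(1,3)] uv(2)])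
      show "AE s in lborel. s \<in> {u<..<v} \<longrightarrow> (\<exists>D. (h has_vector_derivative D) (at s) \<and> c \<le> w \<bullet> D)"
        using der by eventually_elim (use uv cw in fastforce)
    qed
    note L = this
    show "fst (h v) - fst (h u) \<in> {0..v - u} \<and> fst (snd (h v)) - fst (snd (h u)) \<in> {0..v - u} \<and>
     snd (snd (h v)) - snd (snd (h u)) = g * (v - u)"
      using L[of 0 "(1, 0, 0)"] L[of "-1" "(-1, 0, 0)"] L[of 0 "(0, 1, 0)"] L[of "-1" "(0, -1, 0)"]
        L[of g "(0, 0, 1)"] L[of "-g" "(0, 0, -1)"]
      by (simp add: inner_prod_def)
  qed
  with t show "0 \<le> t \<and> moves g t h" by simp
qed

subsection \<open>Histories and the correspondence of speeds\<close>

lemma hist_dist_leI: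
  assumes "\<And>u. 0 \<le> u \<Longrightarrow> norm (h (min u t) - h' (min u t')) \<le> c"
  shows "hist_dist (t, h) (t', h') \<le> \<bar>t - t'\<bar> + c"
  unfolding hist_dist_def using assms by (auto intro!: cSUP_least)

lemma hist_dist_self: "hist_dist H H = 0"
  by (cases H) (simp add: hist_dist_def)

text \<open>A real supremum bounds its members only if the family is bounded above. Here boundedness
  comes from the Lipschitz bound on both histories, which stop moving at \<open>t\<close> and
  \<open>t'\<close>.\<close>

lemma hist_dist_lessD:
  assumes h: "moves g t h" "moves g t' h'" "0 \<le> t" "0 \<le> t'" and g: "0 \<le> g" "g \<le> 1"
    and less: "hist_dist (t, h) (t', h') < e"
  shows "\<bar>t - t'\<bar> < e" "\<And>u. 0 \<le> u \<Longrightarrow> norm (h (min u t) - h' (min u t')) < e"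
proof -
  let ?f = "\<lambda>u. norm (h (min u t) - h' (min u t'))"
  have bound: "?f u \<le> 3 * t + norm (h 0 - h' 0) + 3 * t'" if u: "0 \<le> u" for u
  proof -
    have "norm (h (min u t) - h 0) \<le> 3 * t"
      using moves_norm_le[OF h(1) g, of 0 "min u t"] h u by auto
    moreover have "norm (h' (min u t') - h' 0) \<le> 3 * t'"
      using moves_norm_le[OF h(2) g, of 0 "min u t'"] h u by auto
    moreover have "norm (h (min u t) - h' (min u t'))
      \<le> norm (h (min u t) - h 0) + norm (h 0 - h' 0) + norm (h' (min u t') - h' 0)"
      using norm_triangle_ineq[of "h (min u t) - h 0" "h 0 - h' 0"]
        norm_triangle_ineq4[of "h (min u t) - h' 0" "h' (min u t') - h' 0"] by simp
    ultimately show ?thesis by linarith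
  qed
  then have bdd: "bdd_above (?f ` {0..})" by (intro bdd_aboveI2) auto
  have up: "?f u \<le> (SUP s\<in>{0..}. ?f s)" if "0 \<le> u" for u
    using that bdd by (intro cSUP_upper) auto
  have eq: "hist_dist (t, h) (t', h') = \<bar>t - t'\<bar> + (SUP s\<in>{0..}. ?f s)"
    by (simp add: hist_dist_def)
  have "0 \<le> (SUP s\<in>{0..}. ?f s)" using up[of 0] norm_ge_zero order_trans by blast
  then show "\<bar>t - t'\<bar> < e" using less eq by linarith
  show "?f u < e" if "0 \<le> u" for u using up[OF that] less eq by linarith
qed

lemma extend_cong: "(\<And>s. s \<le> t \<Longrightarrow> h s = h' s) \<Longrightarrow> extend g (t, h) = extend g (t, h')"
  by (auto simp: extend_def)

lemma speeds_cong: "(\<And>s. s \<le> t \<Longrightarrow> h s = h' s) \<Longrightarrow> speeds g \<sigma> (t, h) = speeds g \<sigma> (t, h')"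
  by (simp add: speeds_def prescribed_def extend_cong[of t h h'])

text \<open>Unlike in \<open>speeds_cong\<close>, nothing is required at negative dates: the history
  enters \<open>K\<close> only through \<open>hist_dist\<close>, which inspects nonnegative
  dates.\<close>

lemma K_cong:
  assumes "0 \<le> t" "\<And>s. 0 \<le> s \<Longrightarrow> s \<le> t \<Longrightarrow> h s = h' s"
  shows "K g \<sigma> (t, h) = K g \<sigma> (t, h')"
proof -
  have "hist_dist (t, h) H = hist_dist (t, h') H" for H
    using assms by (cases H) (auto simp: hist_dist_def intro!: SUP_cong)
  then show ?thesis by (simp add: K_def)
qed

lemma speeds_in_K:
  assumes "feasible_history g H"
  shows "speeds g \<sigma> H \<in> K g \<sigma> H"
  unfolding K_def
proof
  fix e :: real assume "e \<in> {0<..}"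
  then show "speeds g \<sigma> H \<in> closure (convex hull speeds g \<sigma> ` {H'. feasible_history g H' \<and> hist_dist H H' < e})"
    using assms by (intro subsetD[OF closure_subset] subsetD[OF hull_subset]) (auto simp: hist_dist_self)
qed

lemma K_subset:
  assumes "0 < e" "closed C" "convex C"
    and "\<And>H'. feasible_history g H' \<Longrightarrow> hist_dist H H' < e \<Longrightarrow> speeds g \<sigma> H' \<in> C"
  shows "K g \<sigma> H \<subseteq> C"
proof -
  have "convex hull speeds g \<sigma> ` {H'. feasible_history g H' \<and> hist_dist H H' < e} \<subseteq> C"
    using assms by (intro hull_minimal) auto
  then have "closure (convex hull speeds g \<sigma> ` {H'. feasible_history g H' \<and> hist_dist H H' < e}) \<subseteq> C"
    using assms(2) by (rule closure_minimal)
  then show ?thesis unfolding K_def using assms(1) by blast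
qed

lemma moves_extend:
  assumes "0 \<le> t" "moves g t h"
  shows "moves g T (extend g (t, h))"
proof (rule moves_join[OF _ assms(1)])
  show "moves g t (extend g (t, h))"
    using assms by (subst moves_cong[of _ _ h]) (auto simp: extend_def)
qed (use assms in \<open>auto simp: extend_def algebra_simps\<close>)

lemma speeds_mem:
  assumes g: "0 \<le> g" "g \<le> 1" and \<sigma>: "\<And>i. \<sigma> i \<in> strategies g" and H: "feasible_history g H"
  shows "speeds g \<sigma> H \<in> {0..1} \<times> {0..1}"
proof -
  obtain t h where th: "H = (t, h)" by (cases H)
  then have t: "0 \<le> t" "moves g t h" using H feasible_history_iff[OF g] by auto
  then have "(extend g H, \<infinity>) \<in> Omega g"
    unfolding Omega_def feasible_path_def th using moves_extend by (simp add: feasible_history_iff[OF g])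
  then show ?thesis
    using \<sigma> t th unfolding speeds_def prescribed_def strategies_def by auto
qed

lemma K_subset_unit_square:
  assumes g: "0 \<le> g" "g \<le> 1" and \<sigma>: "\<And>i. \<sigma> i \<in> strategies g"
  shows "K g \<sigma> H \<subseteq> {0..1} \<times> {0..1}"
  using speeds_mem[OF g \<sigma>] by (intro K_subset[of 1]) (auto intro!: closed_Times convex_Times)

text \<open>Up to \<open>t\<close> feasibility is inherited from \<open>h\<close>; afterwards the
  velocities lie in \<open>K\<close>, hence in the unit square. The single date \<open>t\<close>
  between the two regimes is null.\<close>

lemma admissibleD:
  assumes g: "0 \<le> g" "g \<le> 1" and \<sigma>: "\<And>i. \<sigma> i \<in> strategies g"
    and H: "feasible_history g (t, h)" and q: "q \<in> admissible g \<sigma> (t, h)"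
  shows "moves g T q"
    and "\<And>s. 0 \<le> s \<Longrightarrow> s \<le> t \<Longrightarrow> q s = h s"
    and "AE s in lborel. s > t \<longrightarrow>
      (\<exists>v1 v2. (q has_vector_derivative (v1, v2, g)) (at s) \<and> (v1, v2) \<in> K g \<sigma> (s, q))"
proof -
  have t: "0 \<le> t" "moves g t h" using H feasible_history_iff[OF g] by auto
  show eq: "\<And>s. 0 \<le> s \<Longrightarrow> s \<le> t \<Longrightarrow> q s = h s"
    and der: "AE s in lborel. s > t \<longrightarrow>
      (\<exists>v1 v2. (q has_vector_derivative (v1, v2, g)) (at s) \<and> (v1, v2) \<in> K g \<sigma> (s, q))"
    using q by (auto simp: admissible_def)
  have ac: "abs_continuous_on 0 T q" if "0 \<le> T" for T
    using q that by (auto simp: admissible_def)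
  have "moves g t q" using t eq moves_cong by blast
  have all: "moves g T q" if T: "0 \<le> T" for T
  proof -
    have "AE s in lborel. s \<in> {0<..<T} \<longrightarrow>
      (\<exists>v1\<in>{0..1}. \<exists>v2\<in>{0..1}. (q has_vector_derivative (v1, v2, g)) (at s))"
      using der moves_AE_derivative[OF \<open>moves g t q\<close>] AE_lborel_singleton[of t]
    proof eventually_elim
      case (elim s)
      then show ?case
        using subsetD[OF K_subset_unit_square[where \<sigma>=\<sigma> and H="(s, q)", OF g \<sigma>]] by (cases "s < t") fastforce+
    qed
    then have "feasible_history g (T, q)"
      using ac T by (simp add: feasible_history_def)
    then show ?thesis using feasible_history_iff[OF g] by blast
  qed
  show "moves g T q"
    using all[of "max 0 T"] by (rule moves_subset) auto
qed

text \<open>Forward Euler scheme. Each stage is a path for all dates, and stage k + 1 alters stage k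
  only after the k-th node, where it freezes the speeds prescribed at the history reached. So a node
  history is final once reached.\<close>

primrec euler :: "real \<Rightarrow> profile \<Rightarrow> real \<Rightarrow> path \<Rightarrow> real \<Rightarrow> nat \<Rightarrow> path" where
  "euler g \<sigma> t h \<delta> 0 = extend g (t, h)"
| "euler g \<sigma> t h \<delta> (Suc k) = (\<lambda>s. if s \<le> t + k * \<delta> then euler g \<sigma> t h \<delta> k s
     else euler g \<sigma> t h \<delta> k (t + k * \<delta>) + (s - (t + k * \<delta>)) *\<^sub>R
       (fst (speeds g \<sigma> (t + k * \<delta>, euler g \<sigma> t h \<delta> k)),
        snd (speeds g \<sigma> (t + k * \<delta>, euler g \<sigma> t h \<delta> k)), g))"

lemma euler_stable: "k \<le> m \<Longrightarrow> 0 \<le> \<delta> \<Longrightarrow> s \<le> t + k * \<delta> \<Longrightarrow> euler g \<sigma> t h \<delta> m s = euler g \<sigma> t h \<delta> k s"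
proof (induction m rule: dec_induct)
  case (step m)
  have "real k * \<delta> \<le> real m * \<delta>" using step by (intro mult_right_mono) auto
  then show ?case using step by simp
qed simp

lemma moves_euler:
  assumes g: "0 \<le> g" "g \<le> 1" and \<sigma>: "\<And>i. \<sigma> i \<in> strategies g" and H: "0 \<le> t" "moves g t h" and d: "0 \<le> \<delta>"
  shows "moves g T (euler g \<sigma> t h \<delta> k)"
proof (induction k arbitrary: T)
  case 0
  then show ?case using moves_extend H by simp
next
  case (Suc k)
  let ?\<kappa> = "t + k * \<delta>" and ?e = "euler g \<sigma> t h \<delta> k"
  have k: "0 \<le> ?\<kappa>" using H d by simp
  have "feasible_history g (?\<kappa>, ?e)" using Suc k by (simp add: feasible_history_iff[OF g])
  from speeds_mem[where \<sigma>=\<sigma>, OF g \<sigma> this]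
  have v: "fst (speeds g \<sigma> (?\<kappa>, ?e)) \<in> {0..1}" "snd (speeds g \<sigma> (?\<kappa>, ?e)) \<in> {0..1}"
    by (auto simp: mem_Times_iff)
  show ?case
  proof (rule moves_join[OF _ k])
    show "moves g ?\<kappa> (euler g \<sigma> t h \<delta> (Suc k))"
      using Suc[of ?\<kappa>] by (subst moves_cong[of _ _ ?e]) auto
  next
    fix u w assume uw: "?\<kappa> \<le> u" "u \<le> w" "w \<le> T"
    have e: "euler g \<sigma> t h \<delta> (Suc k) s = ?e ?\<kappa> + (s - ?\<kappa>) *\<^sub>R (fst (speeds g \<sigma> (?\<kappa>, ?e)), snd (speeds g \<sigma> (?\<kappa>, ?e)), g)"
      if "?\<kappa> \<le> s" for s using that by (cases "s = ?\<kappa>") (auto simp: zero_prod_def)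
    have "c * (w - u) \<in> {0..w - u}" if "c \<in> {0..1}" for c
      using that uw by (auto intro: mult_left_le_one_le)
    from this[OF v(1)] this[OF v(2)]
    show "fst (euler g \<sigma> t h \<delta> (Suc k) w) - fst (euler g \<sigma> t h \<delta> (Suc k) u) \<in> {0..w - u} \<and>
       fst (snd (euler g \<sigma> t h \<delta> (Suc k) w)) - fst (snd (euler g \<sigma> t h \<delta> (Suc k) u)) \<in> {0..w - u} \<and>
       snd (snd (euler g \<sigma> t h \<delta> (Suc k) w)) - snd (snd (euler g \<sigma> t h \<delta> (Suc k) u)) = g * (w - u)"
      unfolding e[OF uw(1)] e[OF order_trans[OF uw(1,2)]] by (simp add: algebra_simps)
  qed
qed

lemma euler_path:
  assumes g: "0 \<le> g" "g \<le> 1" and \<sigma>: "\<And>i. \<sigma> i \<in> strategies g" and H: "0 \<le> t" "moves g t h" and d: "0 < \<delta>"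
  obtains Q where "\<And>s. s \<le> t \<Longrightarrow> Q s = h s" "\<And>T. moves g T Q"
    "\<And>k s. s \<in> {t + real k * \<delta><..<t + real k * \<delta> + \<delta>} \<Longrightarrow> (Q has_vector_derivative
       (fst (speeds g \<sigma> (t + k * \<delta>, Q)), snd (speeds g \<sigma> (t + k * \<delta>, Q)), g)) (at s)"
proof -
  define e where "e = euler g \<sigma> t h \<delta>"
  \<comment> \<open>The first stage that is already final at \<open>s\<close>; \<open>nat\<close>
    sends dates before \<open>t\<close> to stage 0.\<close>
  define Q where "Q s = e (nat \<lceil>(s - t) / \<delta>\<rceil>) s" for s
  have Q: "Q s = e k s" if s: "s \<le> t + real k * \<delta>" for s k
  proof -
    have "(s - t) / \<delta> \<le> real k" using s d by (simp add: pos_divide_le_eq)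
    then have 1: "nat \<lceil>(s - t) / \<delta>\<rceil> \<le> k" by (simp add: ceiling_le_iff nat_le_iff)
    have "(s - t) / \<delta> \<le> real (nat \<lceil>(s - t) / \<delta>\<rceil>)" by (rule real_nat_ceiling_ge)
    then have 2: "s \<le> t + real (nat \<lceil>(s - t) / \<delta>\<rceil>) * \<delta>" using d by (simp add: pos_divide_le_eq)
    show ?thesis unfolding Q_def e_def using euler_stable[OF 1 _ 2] d by simp
  qed
  show thesis
  proof (rule that[of Q])
    show "Q s = h s" if "s \<le> t" for s
      using Q[of s 0] that by (simp add: e_def extend_def)
    show "moves g T Q" for T
    proof -
      obtain k :: nat where "(T - t) / \<delta> \<le> real k" using real_arch_simple by blast
      then have "T \<le> t + real k * \<delta>" using d by (simp add: pos_divide_le_eq)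
      then have "moves g T Q \<longleftrightarrow> moves g T (e k)" using Q by (intro moves_cong) auto
      then show ?thesis using moves_euler[where \<sigma>=\<sigma>, OF g \<sigma> H] d by (simp add: e_def)
    qed
    fix k s assume s: "s \<in> {t + real k * \<delta><..<t + real k * \<delta> + \<delta>}"
    let ?\<kappa> = "t + real k * \<delta>"
    define v where "v = (fst (speeds g \<sigma> (?\<kappa>, Q)), snd (speeds g \<sigma> (?\<kappa>, Q)), g)"
    have "speeds g \<sigma> (?\<kappa>, Q) = speeds g \<sigma> (?\<kappa>, e k)" using Q by (intro speeds_cong)
    then have line: "Q y = Q ?\<kappa> + (y - ?\<kappa>) *\<^sub>R v" if "y \<in> {?\<kappa><..<?\<kappa> + \<delta>}" for y
      using Q[of y "Suc k"] Q[of ?\<kappa> k] that by (simp add: e_def v_def algebra_simps)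
    have "((\<lambda>y. Q ?\<kappa> + (y - ?\<kappa>) *\<^sub>R v) has_vector_derivative v) (at s)"
      by (auto intro!: derivative_eq_intros)
    then have "(Q has_vector_derivative v) (at s)"
      by (rule has_vector_derivative_transform_within_open[OF _ _ s]) (simp_all add: line)
    then show "(Q has_vector_derivative (fst (speeds g \<sigma> (?\<kappa>, Q)), snd (speeds g \<sigma> (?\<kappa>, Q)), g)) (at s)"
      by (simp add: v_def)
  qed
qed

subsection \<open>Existence of admissible paths\<close>

text \<open>A common starting point and a common Lipschitz constant give compactness on each bounded
  interval; a diagonal subsequence serves all of them, and the closed conditions of
  \<open>moves\<close> pass to the limit.\<close>

lemma moves_subsequence:
  assumes g: "0 \<le> g" "g \<le> 1" and Q: "\<And>n T. moves g T (Q n)" and z: "\<And>n. Q n 0 = z"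
  obtains r q where "strict_mono (r :: nat \<Rightarrow> nat)" "\<And>T. moves g T q"
    "\<And>T e. 0 < e \<Longrightarrow> \<exists>N. \<forall>n\<ge>N. \<forall>s\<in>{0..T}. norm (Q (r n) s - q s) < e"
proof -
  define P where "P i R \<longleftrightarrow> (\<exists>l. \<forall>e>0. \<exists>N. \<forall>n\<ge>N. \<forall>s\<in>{0..real i}. norm (R n s - l s) < e)"
    for i :: nat and R :: "nat \<Rightarrow> path"
  have sub: "\<exists>k::nat \<Rightarrow> nat. strict_mono k \<and> P i ((Q \<circ> r) \<circ> k)" for i and r :: "nat \<Rightarrow> nat"
  proof -
    obtain l k where "strict_mono (k :: nat \<Rightarrow> nat)"
      "\<And>e. 0 < e \<Longrightarrow> \<exists>N. \<forall>n x. n \<ge> N \<and> x \<in> {0..real i} \<longrightarrow> norm (Q (r (k n)) x - l x) < e"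
    proof (rule Arzela_Ascoli[of "{0..real i}" "\<lambda>n. Q (r n)" "norm z + 3 * real i"])
      fix n x assume x: "x \<in> {0..real i}"
      then have "norm (Q (r n) x - z) \<le> 3 * x"
        using moves_norm_le[OF Q[where n="r n" and T="real i"] g, of 0 x] z by auto
      then show "norm (Q (r n) x) \<le> norm z + 3 * real i"
        using norm_triangle_ineq[of "Q (r n) x - z" z] x by simp
    next
      fix x e :: real assume xe: "x \<in> {0..real i}" "0 < e"
      show "\<exists>d>0. \<forall>n y. y \<in> {0..real i} \<and> norm (x - y) < d \<longrightarrow> norm (Q (r n) x - Q (r n) y) < e"
      proof (intro exI[of _ "e / 3"] conjI allI impI)
        fix n y assume y: "y \<in> {0..real i} \<and> norm (x - y) < e / 3"
        show "norm (Q (r n) x - Q (r n) y) < e"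
          using moves_norm_le[OF Q[where n="r n" and T="real i"] g, of x y] moves_norm_le[OF Q[where n="r n" and T="real i"] g, of y x] xe y
          by (cases "x \<le> y") (auto simp: norm_minus_commute)
      qed (use xe in auto)
    qed (auto intro: that)
    then show ?thesis unfolding P_def by (intro exI[of _ k] conjI exI[of _ l]) fastforce+
  qed
  obtain r :: "nat \<Rightarrow> nat" where r: "strict_mono r" and P: "\<And>i. P i (Q \<circ> r)"
  proof (rule subsequence_diagonalization_lemma[of "\<lambda>i r. P i (Q \<circ> r)" id])
    show "\<exists>k::nat \<Rightarrow> nat. strict_mono k \<and> P i (Q \<circ> (r \<circ> k))" for i r
      using sub[of i r] by (simp add: comp_assoc)
    \<comment> \<open>Diagonalization needs convergence to survive replacing a sequence by one whose
      tail is drawn from it.\<close>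
    show "P i (Q \<circ> (r \<circ> k2))" if P: "P i (Q \<circ> (r \<circ> k1))" and k: "\<And>j. N \<le> j \<Longrightarrow> \<exists>j'. j \<le> j' \<and> k2 j = k1 j'"
      for i N and r k1 k2 :: "nat \<Rightarrow> nat"
    proof -
      obtain l where l: "\<And>e. e > 0 \<Longrightarrow> \<exists>N. \<forall>n\<ge>N. \<forall>s\<in>{0..real i}. norm ((Q \<circ> (r \<circ> k1)) n s - l s) < e"
        using P unfolding P_def by blast
      show ?thesis unfolding P_def
      proof (intro exI[of _ l] allI impI)
        fix e :: real assume "0 < e"
        then obtain M where M: "\<forall>n\<ge>M. \<forall>s\<in>{0..real i}. norm ((Q \<circ> (r \<circ> k1)) n s - l s) < e" using l by blast
        show "\<exists>N. \<forall>n\<ge>N. \<forall>s\<in>{0..real i}. norm ((Q \<circ> (r \<circ> k2)) n s - l s) < e"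
        proof (intro exI[of _ "max M N"] allI impI)
          fix n assume "max M N \<le> n"
          then obtain j' where "n \<le> j'" "k2 n = k1 j'" "M \<le> j'" using k[of n] by auto
          then show "\<forall>s\<in>{0..real i}. norm ((Q \<circ> (r \<circ> k2)) n s - l s) < e" using M by simp
        qed
      qed
    qed
  qed auto
  obtain l where l: "\<And>i e. e > 0 \<Longrightarrow> \<exists>N. \<forall>n\<ge>N. \<forall>s\<in>{0..real i}. norm (Q (r n) s - l i s) < e"
    using P unfolding P_def by (simp add: o_def) metis
  \<comment> \<open>The limits \<open>l i\<close> on different intervals agree where both apply, so
    one pointwise limit replaces them all.\<close>
  define q where "q s = lim (\<lambda>n. Q (r n) s)" for s
  have q: "q s = l i s" if "s \<in> {0..real i}" for s i
  proof -
    have "(\<lambda>n. Q (r n) s) \<longlonglongrightarrow> l i s"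
      unfolding LIMSEQ_iff using l[of _ i] that by meson
    then show ?thesis unfolding q_def by (rule limI)
  qed
  have conv: "\<exists>N. \<forall>n\<ge>N. \<forall>s\<in>{0..T}. norm (Q (r n) s - q s) < e" if e: "0 < e" for T e
  proof -
    obtain i :: nat where i: "T \<le> real i" using real_arch_simple by blast
    obtain N where "\<forall>n\<ge>N. \<forall>s\<in>{0..real i}. norm (Q (r n) s - l i s) < e" using l[OF e] by blast
    then show ?thesis using q[of _ i] i by (intro exI[of _ N]) auto
  qed
  have lim: "(\<lambda>n. Q (r n) s) \<longlonglongrightarrow> q s" if "0 \<le> s" for s
    unfolding LIMSEQ_iff using conv[of _ s] that by (meson atLeastAtMost_iff order_refl)
  show thesis
  proof (rule that[OF r _ conv])
    show "moves g T q" for T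
      unfolding moves_def
    proof (intro allI impI)
      fix u v assume uv: "0 \<le> u" "u \<le> v" "v \<le> T"
      note lu = lim[OF uv(1)] and lv = lim[OF order_trans[OF uv(1,2)]]
      have m: "fst (Q (r n) v) - fst (Q (r n) u) \<in> {0..v - u}"
        "fst (snd (Q (r n) v)) - fst (snd (Q (r n) u)) \<in> {0..v - u}"
        "snd (snd (Q (r n) v)) - snd (snd (Q (r n) u)) \<in> {g * (v - u)}" for n
        using movesD[OF Q uv] by auto
      have "fst (q v) - fst (q u) \<in> {0..v - u}"
        by (rule closed_sequentially[where f="\<lambda>n. fst (Q (r n) v) - fst (Q (r n) u)", OF closed_atLeastAtMost m(1)]) (intro tendsto_intros lu lv)
      moreover have "fst (snd (q v)) - fst (snd (q u)) \<in> {0..v - u}"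
        by (rule closed_sequentially[where f="\<lambda>n. fst (snd (Q (r n) v)) - fst (snd (Q (r n) u))", OF closed_atLeastAtMost m(2)]) (intro tendsto_intros lu lv)
      moreover have "snd (snd (q v)) - snd (snd (q u)) \<in> {g * (v - u)}"
        by (rule closed_sequentially[where f="\<lambda>n. snd (snd (Q (r n) v)) - snd (snd (Q (r n) u))", OF closed_singleton m(3)]) (intro tendsto_intros lu lv)
      ultimately show "fst (q v) - fst (q u) \<in> {0..v - u} \<and> fst (snd (q v)) - fst (snd (q u)) \<in> {0..v - u} \<and>
         snd (snd (q v)) - snd (snd (q u)) = g * (v - u)" by simp
    qed
  qed auto
qed

text \<open>A velocity of the limit of Euler polygons that is missing from a closed convex set can be
  separated from it; the polygons move in that set, so integrating the separating functional along
  them contradicts the separation.\<close>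

lemma limit_velocity_mem:
  assumes g: "0 \<le> g" "g \<le> 1" and Q: "\<And>n T. moves g T (Q n)"
    and lim: "\<And>u. 0 \<le> u \<Longrightarrow> (\<lambda>n. Q n u) \<longlonglongrightarrow> q u"
    and C: "closed C" "convex C" and s: "0 < s" and \<eta>: "0 < \<eta>"
    and der: "\<And>n. n \<ge> N \<Longrightarrow> AE u in lborel. u \<in> {s - \<eta><..<s + \<eta>} \<longrightarrow>
       (\<exists>v\<in>C. (Q n has_vector_derivative (fst v, snd v, g)) (at u))"
    and D: "(q has_vector_derivative (fst v, snd v, g)) (at s)"
  shows "v \<in> C"
proof (rule ccontr)
  assume "v \<notin> C"
  then obtain a b where ab: "a \<bullet> v < b" "\<And>x. x \<in> C \<Longrightarrow> a \<bullet> x > b"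
    using separating_hyperplane_closed_point[OF C(2,1)] by blast
  \<comment> \<open>The zero in the last place removes the common speed \<open>g\<close> of the
    frontier from the functional.\<close>
  define w where "w = (fst a, snd a, 0 :: real)"
  have w: "w \<bullet> (fst x, snd x, g) = a \<bullet> x" for x
    by (simp add: w_def inner_prod_def)
  define \<theta> where "\<theta> = min \<eta> s"
  have \<theta>: "0 < \<theta>" "\<theta> \<le> \<eta>" "\<theta> \<le> s" using \<eta> s by (auto simp: \<theta>_def)
  have incr: "b * (y - s) \<le> w \<bullet> (q y - q s)" if y: "s < y" "y < s + \<theta>" for y
  proof -
    have "b * (y - s) \<le> w \<bullet> (Q n y - Q n s)" if n: "n \<ge> N" for n
    proof (rule abs_continuous_on_increment_ge[OF abs_continuous_on_subset[OF moves_abs_continuous_on[OF Q g, of y n]]])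
      show "AE u in lborel. u \<in> {s<..<y} \<longrightarrow> (\<exists>D. (Q n has_vector_derivative D) (at u) \<and> b \<le> w \<bullet> D)"
        using der[OF n]
      proof eventually_elim
        case (elim u)
        show ?case
        proof
          assume "u \<in> {s<..<y}"
          then obtain v where v: "v \<in> C" "(Q n has_vector_derivative (fst v, snd v, g)) (at u)"
            using elim y \<theta> by auto
          then show "\<exists>D. (Q n has_vector_derivative D) (at u) \<and> b \<le> w \<bullet> D"
            using ab(2)[OF v(1)] w[of v] by (intro exI[of _ "(fst v, snd v, g)"]) auto
        qed
      qed
    qed (use s y in auto)
    moreover have "(\<lambda>n. w \<bullet> (Q n y - Q n s)) \<longlonglongrightarrow> w \<bullet> (q y - q s)"
      using s y by (intro tendsto_intros lim) auto
    ultimately show ?thesis by (intro LIMSEQ_le_const) blast+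
  qed
  have "((\<lambda>y. w \<bullet> q y) has_vector_derivative (a \<bullet> v)) (at s)"
    using bounded_linear.has_vector_derivative[OF bounded_linear_inner_right D, of w] w[of v] by simp
  then have "((\<lambda>y. (w \<bullet> q y - w \<bullet> q s) / (y - s)) \<longlongrightarrow> a \<bullet> v) (at s)"
    unfolding has_real_derivative_iff_has_vector_derivative[symmetric] has_field_derivative_iff .
  then have "((\<lambda>y. (w \<bullet> q y - w \<bullet> q s) / (y - s)) \<longlongrightarrow> a \<bullet> v) (at_right s)"
    by (rule tendsto_within_subset) simp
  moreover have "\<forall>\<^sub>F y in at_right s. b \<le> (w \<bullet> q y - w \<bullet> q s) / (y - s)"
    unfolding eventually_at_right[OF less_add_one]
  proof (intro exI[of _ "s + \<theta>"] conjI allI impI)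
    fix y assume "s < y" "y < s + \<theta>"
    then show "b \<le> (w \<bullet> q y - w \<bullet> q s) / (y - s)"
      using incr[of y] by (simp add: inner_diff_right pos_le_divide_eq)
  qed (use \<theta> in auto)
  ultimately have "b \<le> a \<bullet> v"
    by (rule tendsto_lowerbound) simp
  then show False using ab(1) by simp
qed

lemma moves_norm_le_abs:
  assumes "moves g T h" "0 \<le> g" "g \<le> 1" "u \<in> {0..T}" "v \<in> {0..T}"
  shows "norm (h v - h u) \<le> 3 * \<bar>v - u\<bar>"
  using moves_norm_le[OF assms(1-3), of u v] moves_norm_le[OF assms(1-3), of v u] assms(4,5)
  by (cases "u \<le> v") (auto simp: norm_minus_commute)

text \<open>Prescribed speeds may jump with the history, so the speeds of the polygons need not
  converge. Their node histories do approach the limit history, so the speeds eventually lie in the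
  closed hull over each neighbourhood, a closed convex set that also contains the velocity of the
  limit.\<close>

lemma admissible_nonempty:
  assumes g: "0 \<le> g" "g \<le> 1" and \<sigma>: "\<And>i. \<sigma> i \<in> strategies g" and H: "feasible_history g (t, h)"
  shows "admissible g \<sigma> (t, h) \<noteq> {}"
proof -
  have t: "0 \<le> t" "moves g t h" using H feasible_history_iff[OF g] by auto
  define \<delta> where "\<delta> n = 1 / real (Suc n)" for n
  have \<delta>: "0 < \<delta> n" for n by (simp add: \<delta>_def)
  have "\<exists>Q. (\<forall>s\<le>t. Q s = h s) \<and> (\<forall>T. moves g T Q) \<and>
    (\<forall>k s. s \<in> {t + real k * \<delta> n<..<t + real k * \<delta> n + \<delta> n} \<longrightarrow> (Q has_vector_derivative
       (fst (speeds g \<sigma> (t + k * \<delta> n, Q)), snd (speeds g \<sigma> (t + k * \<delta> n, Q)), g)) (at s))" for n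
    by (rule euler_path[where \<sigma>=\<sigma>, OF g \<sigma> t \<delta>[of n]]) blast
  then obtain Q where Q1: "\<And>n s. s \<le> t \<Longrightarrow> Q n s = h s" and Q2: "\<And>n T. moves g T (Q n)" and
    Q3: "\<And>n k s. s \<in> {t + real k * \<delta> n<..<t + real k * \<delta> n + \<delta> n} \<Longrightarrow> (Q n has_vector_derivative
       (fst (speeds g \<sigma> (t + k * \<delta> n, Q n)), snd (speeds g \<sigma> (t + k * \<delta> n, Q n)), g)) (at s)"
    by metis
  have Q0: "Q n 0 = h 0" for n using Q1 t by simp
  obtain r q where r: "strict_mono (r :: nat \<Rightarrow> nat)" and q: "\<And>T. moves g T q" and
    conv: "\<And>T e. 0 < e \<Longrightarrow> \<exists>N. \<forall>n\<ge>N. \<forall>s\<in>{0..T}. norm (Q (r n) s - q s) < e"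
    by (rule moves_subsequence[of g Q "h 0", OF g Q2 Q0]) blast
  have lim: "(\<lambda>n. Q (r n) s) \<longlonglongrightarrow> q s" if "0 \<le> s" for s
    unfolding LIMSEQ_iff using conv[of _ s] that by (meson atLeastAtMost_iff order_refl)
  have "(\<lambda>n. \<delta> (r n)) \<longlonglongrightarrow> 0"
    using LIMSEQ_subseq_LIMSEQ[OF LIMSEQ_inverse_real_of_nat r]
    by (simp add: \<delta>_def o_def inverse_eq_divide)
  then have \<delta>_small: "\<exists>N. \<forall>n\<ge>N. \<delta> (r n) < e" if "0 < e" for e
    using that \<delta> by (auto simp: LIMSEQ_iff abs_of_pos)
  have vel: "v \<in> K g \<sigma> (s, q)" if s: "t < s" and D: "(q has_vector_derivative (fst v, snd v, g)) (at s)" for s v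
    unfolding K_def
  proof
    fix e :: real assume "e \<in> {0<..}"
    then have e: "0 < e" by simp
    define C where "C = closure (convex hull speeds g \<sigma> ` {H'. feasible_history g H' \<and> hist_dist (s, q) H' < e})"
    \<comment> \<open>Error budget: \<eta> plus the mesh moves the date by less than e/8, which
      moves the path by at most 3e/8; uniform convergence adds e/4. The distance stays below
      3e/4.\<close>
    define \<eta> where "\<eta> = min (s - t) (e / 16)"
    have \<eta>: "0 < \<eta>" "\<eta> \<le> s - t" using s e by (simp_all add: \<eta>_def)
    have \<eta>': "\<eta> \<le> e / 16" unfolding \<eta>_def by (rule min.cobounded2)
    obtain N1 where N1: "\<And>n. n \<ge> N1 \<Longrightarrow> \<delta> (r n) < e / 16" using \<delta>_small[of "e / 16"] e by auto
    obtain N2 where N2: "\<And>n u. n \<ge> N2 \<Longrightarrow> u \<in> {0..s} \<Longrightarrow> norm (Q (r n) u - q u) < e / 4"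
      using conv[of "e / 4" s] e by (metis divide_pos_pos zero_less_numeral)
    have "v \<in> C"
    proof (rule limit_velocity_mem[where Q="\<lambda>n. Q (r n)" and N="max N1 N2", OF g Q2 lim])
      show "closed C" "convex C" by (auto simp: C_def convex_closure)
      fix n assume n: "max N1 N2 \<le> n"
      let ?\<kappa> = "\<lambda>k. t + real k * \<delta> (r n)"
      \<comment> \<open>At the nodes a polygon may have kinks; there are only countably
        many.\<close>
      have "countable (range ?\<kappa>)" by simp
      then have "AE u in lborel. u \<notin> range ?\<kappa>"
        by (intro AE_not_in countable_imp_null_set_lborel)
      then show "AE u in lborel. u \<in> {s - \<eta><..<s + \<eta>} \<longrightarrow>
          (\<exists>v\<in>C. (Q (r n) has_vector_derivative (fst v, snd v, g)) (at u))"
      proof eventually_elim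
        case (elim u)
        show ?case
        proof
          assume u: "u \<in> {s - \<eta><..<s + \<eta>}"
          define k where "k = nat \<lfloor>(u - t) / \<delta> (r n)\<rfloor>"
          have "0 < (u - t) / \<delta> (r n)" using u \<eta> \<delta> by simp
          then have "real k \<le> (u - t) / \<delta> (r n)" "(u - t) / \<delta> (r n) < real k + 1"
            unfolding k_def by linarith+
          then have "?\<kappa> k \<le> u" "u < ?\<kappa> k + \<delta> (r n)"
            using \<delta>[of "r n"] by (simp_all add: pos_le_divide_eq pos_divide_less_eq algebra_simps)
          moreover have "u \<noteq> ?\<kappa> k" using elim by auto
          ultimately have uk: "u \<in> {?\<kappa> k<..<?\<kappa> k + \<delta> (r n)}" by auto
          have k0: "0 \<le> ?\<kappa> k" using t \<delta>[of "r n"] by simp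
          have sk: "\<bar>s - ?\<kappa> k\<bar> < e / 8" 
          proof -
            have "?\<kappa> k < u" "u < ?\<kappa> k + \<delta> (r n)" "s - \<eta> < u" "u < s + \<eta>" "\<delta> (r n) < e / 16"
              using uk u N1[of n] n by auto
            then show ?thesis using \<eta>' by linarith
          qed
          have feas: "feasible_history g (?\<kappa> k, Q (r n))" using Q2 k0 by (simp add: feasible_history_iff[OF g])
          have "hist_dist (s, q) (?\<kappa> k, Q (r n)) \<le> \<bar>s - ?\<kappa> k\<bar> + (e / 4 + 3 * (e / 8))"
          proof (rule hist_dist_leI)
            fix x :: real assume x: "0 \<le> x"
            have "norm (Q (r n) (min x s) - q (min x s)) < e / 4"
              using N2[of n "min x s"] n x s t by auto
            moreover have "norm (Q (r n) (min x s) - Q (r n) (min x (?\<kappa> k))) \<le> 3 * \<bar>min x s - min x (?\<kappa> k)\<bar>"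
              using x s t k0 by (intro moves_norm_le_abs[OF Q2[where T=x] g]) auto
            moreover have "\<bar>min x s - min x (?\<kappa> k)\<bar> \<le> \<bar>s - ?\<kappa> k\<bar>" by (auto simp: min_def)
            moreover have "norm (q (min x s) - Q (r n) (min x (?\<kappa> k))) \<le>
                norm (Q (r n) (min x s) - q (min x s)) + norm (Q (r n) (min x s) - Q (r n) (min x (?\<kappa> k)))"
              using norm_triangle_ineq[of "q (min x s) - Q (r n) (min x s)" "Q (r n) (min x s) - Q (r n) (min x (?\<kappa> k))"]
              by (simp add: norm_minus_commute)
            ultimately show "norm (q (min x s) - Q (r n) (min x (?\<kappa> k))) \<le> e / 4 + 3 * (e / 8)"
              using sk by linarith
          qed
          then have "hist_dist (s, q) (?\<kappa> k, Q (r n)) < e" using sk e by linarith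
          then have "speeds g \<sigma> (?\<kappa> k, Q (r n)) \<in> C"
            unfolding C_def using feas by (intro subsetD[OF closure_subset] subsetD[OF hull_subset]) auto
          then show "\<exists>v\<in>C. (Q (r n) has_vector_derivative (fst v, snd v, g)) (at u)"
            using Q3[OF uk] by blast
        qed
      qed
    qed (use D s t \<eta> in auto)
    then show "v \<in> closure (convex hull speeds g \<sigma> ` {H'. feasible_history g H' \<and> hist_dist (s, q) H' < e})"
      by (simp add: C_def)
  qed
  have "q \<in> admissible g \<sigma> (t, h)"
    unfolding admissible_def case_prod_conv mem_Collect_eq
  proof (intro conjI ballI allI impI)
    show "q s = h s" if "s \<in> {0..t}" for s
      using lim[of s] Q1[of s] that by (auto intro: LIMSEQ_unique)
    show "abs_continuous_on 0 T q" for T using moves_abs_continuous_on[OF q g] .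
    \<comment> \<open>The exceptional null set depends on the horizon; countably many horizons reach
      every date.\<close>
    have "AE s in lborel. \<forall>n::nat. s \<in> {0<..<real n} \<longrightarrow>
      (\<exists>v1\<in>{0..1}. \<exists>v2\<in>{0..1}. (q has_vector_derivative (v1, v2, g)) (at s))"
      using moves_AE_derivative[OF q] by (subst AE_all_countable) blast
    then show "AE s in lborel. t < s \<longrightarrow>
        (\<exists>v1 v2. (q has_vector_derivative (v1, v2, g)) (at s) \<and> (v1, v2) \<in> K g \<sigma> (s, q))"
    proof eventually_elim
      case (elim s)
      show ?case
      proof
        assume s: "t < s"
        obtain n :: nat where "s < real n" using reals_Archimedean2 by blast
        then obtain v1 v2 where "(q has_vector_derivative (v1, v2, g)) (at s)"
          using elim s t by (meson greaterThanLessThan_iff le_less_trans)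
        then show "\<exists>v1 v2. (q has_vector_derivative (v1, v2, g)) (at s) \<and> (v1, v2) \<in> K g \<sigma> (s, q)"
          using vel[OF s, of "(v1, v2)"] by auto
      qed
    qed
  qed
  then show ?thesis by blast
qed

subsection \<open>Payoffs and the comparison with the race\<close>

lemma cap_eq: "cap i S = (case i of Firm1 \<Rightarrow> fst S | Firm2 \<Rightarrow> fst (snd S))"
  by (cases S; cases i) auto

lemma gap_eq: "gap S = max (cap i S) (cap (rival i) S) - snd (snd S)"
  by (cases S; cases i) (auto simp: max.commute)

lemma rival_rival [simp]: "rival (rival i) = i"
  by (cases i) auto

lemma moves_cap:
  assumes "moves g T q" "0 \<le> u" "u \<le> v" "v \<le> T"
  shows "0 \<le> cap i (q v) - cap i (q u)" "cap i (q v) - cap i (q u) \<le> v - u"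
  using movesD[OF assms] by (auto simp: cap_eq split: firm.split)

lemma moves_continuous_on_atLeast:
  assumes "\<And>T. moves g T q" "0 \<le> g" "g \<le> 1"
  shows "continuous_on {0..} q"
proof (rule lipschitz_on_continuous_on[where L=3], rule lipschitz_onI)
  show "dist (q u) (q v) \<le> 3 * dist u v" if "u \<in> {0..}" "v \<in> {0..}" for u v
    using moves_norm_le[OF assms(1)[of v] assms(2,3), of u v] moves_norm_le[OF assms(1)[of u] assms(2,3), of v u] that
    by (cases "u \<le> v") (auto simp: dist_norm norm_minus_commute)
qed simp

lemma continuous_on_gap: "continuous_on A q \<Longrightarrow> continuous_on A (\<lambda>u. gap (q u))"
  unfolding gap_eq[of _ Firm1] by (simp add: cap_eq) (intro continuous_intros)

lemma continuous_on_cap: "continuous_on A q \<Longrightarrow> continuous_on A (\<lambda>u. cap i (q u))"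
  by (cases i) (simp_all add: cap_eq, (intro continuous_intros; assumption)+)

lemma nn_integral_atLeast_shift:
  fixes f :: "real \<Rightarrow> ennreal"
  assumes "(\<lambda>s. f s * indicator {\<tau>..} s) \<in> borel_measurable borel"
  shows "(\<integral>\<^sup>+s\<in>{\<tau>..}. f s \<partial>lborel) = (\<integral>\<^sup>+s\<in>{0..}. f (\<tau> + s) \<partial>lborel)"
  by (subst nn_integral_real_affine[OF assms, of 1 \<tau>]) (auto simp: indicator_def intro!: nn_integral_cong)

lemma set_lebesgue_integral_shift:
  fixes f :: "real \<Rightarrow> real"
  shows "(LINT u:{a + c..b + c}|lborel. f u) = (LINT u:{a..b}|lborel. f (u + c))"
  unfolding set_lebesgue_integral_def
  by (subst lborel_integral_real_affine[of 1 _ c]) (auto simp: indicator_def ac_simps intro!: Bochner_Integration.integral_cong)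

locale development_race =
  fixes g r \<alpha> :: real and lam :: "real \<Rightarrow> real" and \<pi> :: profit
  assumes g: "0 < g" "g < 1"
    and lam_nonneg: "0 \<le> lam D"
    and lam_nonpos: "D \<le> 0 \<Longrightarrow> lam D = 0"
    and lam_mono: "mono lam"
    and lam_le: "lam D \<le> (1 - g) * \<alpha>"
    and \<pi>_pos: "0 < \<pi> i a b"
    and \<pi>_cont: "continuous_on UNIV (\<lambda>z. \<pi> i (fst z) (snd z))"
    and \<pi>_own: "a \<le> a' \<Longrightarrow> exp (\<alpha> * (a' - a)) * \<pi> i a b \<le> \<pi> i a' b"
    and \<pi>_rival: "b \<le> b' \<Longrightarrow> \<pi> i a b' \<le> \<pi> i a b"
begin

lemma g': "0 \<le> g" "g \<le> 1" using g by auto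

lemma \<alpha>_nonneg: "0 \<le> \<alpha>"
  using order_trans[OF lam_nonneg lam_le] g by (simp add: zero_le_mult_iff)

text \<open>The hazard may jump at gap zero, so measurability rests on its monotonicity and not on
  continuity.\<close>

lemma hazard_integrable:
  fixes a b :: real
  assumes "continuous_on {a..b} D"
  shows "set_integrable lborel {a..b} (\<lambda>u. lam (D u))"
  unfolding set_integrable_def
proof (rule Bochner_Integration.integrable_bound)
  show "integrable lborel (\<lambda>u. indicator {a..b} u * ((1 - g) * \<alpha>))"
    by (intro integrable_mult_left) (simp add: integrable_indicator_iff emeasure_lborel_Icc_eq)
  have "lam \<in> borel_measurable borel" using lam_mono by (rule borel_measurable_mono)
  then have "(\<lambda>u. lam (D u)) \<in> borel_measurable (restrict_space borel {a..b})"
    using borel_measurable_continuous_on_restrict[OF assms] by (rule measurable_compose_rev)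
  then show "(\<lambda>u. indicat_real {a..b} u *\<^sub>R lam (D u)) \<in> borel_measurable lborel"
    by (subst (asm) borel_measurable_restrict_space_iff) auto
  show "AE u in lborel. norm (indicat_real {a..b} u *\<^sub>R lam (D u)) \<le> norm (indicat_real {a..b} u * ((1 - g) * \<alpha>))"
    using lam_nonneg lam_le g \<alpha>_nonneg by (auto simp: abs_mult indicator_def)
qed

text \<open>Shifting the gap path down by \<open>\<beta>\<close> is the same as shifting time back by \<open>\<beta> / (1 - g)\<close>, which
  exchanges the hazard of two end pieces of that length.\<close>

lemma hazard_shift_le:
  assumes \<beta>: "0 \<le> \<beta>" and s: "0 \<le> s"
  shows "(LINT u:{0..s}|lborel. lam (d + (1 - g) * u)) - (LINT u:{0..s}|lborel. lam (d + (1 - g) * u - \<beta>)) \<le> \<alpha> * \<beta>"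
proof -
  define w where "w = \<beta> / (1 - g)"
  have w: "0 \<le> w" "(1 - g) * w = \<beta>" using g \<beta> by (auto simp: w_def)
  define f where "f u = lam (d + (1 - g) * u)" for u
  have int: "set_integrable lborel {a..b} f" for a b
    unfolding f_def by (intro hazard_integrable continuous_intros)
  have I: "(LINT u:{a..b}|lborel. f u) = integral {a..b} f" and fi: "f integrable_on {a..b}" for a b
    using set_borel_integral_eq_integral[OF int] by auto
  have "(LINT u:{0..s}|lborel. lam (d + (1 - g) * u - \<beta>)) = (LINT u:{0..s}|lborel. f (u + - w))"
    unfolding w(2)[symmetric] by (simp add: f_def algebra_simps)
  also have "\<dots> = (LINT u:{0 + - w..s + - w}|lborel. f u)"
    by (rule set_lebesgue_integral_shift[symmetric])
  finally have shifted: "(LINT u:{0..s}|lborel. lam (d + (1 - g) * u - \<beta>)) = integral {- w..s - w} f"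
    by (simp add: I)
  \<comment> \<open>Splitting the one interval from -w to s at 0 and at s - w avoids distinguishing
    whether the delay exceeds the horizon.\<close>
  have "integral {- w..0} f + integral {0..s} f = integral {- w..s} f"
    using w s by (intro Henstock_Kurzweil_Integration.integral_combine fi) auto
  moreover have "integral {- w..s - w} f + integral {s - w..s} f = integral {- w..s} f"
    using w s by (intro Henstock_Kurzweil_Integration.integral_combine fi) auto
  moreover have "0 \<le> integral {- w..0} f"
    by (intro integral_nonneg fi) (simp add: f_def lam_nonneg)
  moreover have "integral {s - w..s} f \<le> integral {s - w..s} (\<lambda>_. (1 - g) * \<alpha>)"
    by (intro integral_le fi) (auto simp: f_def lam_le)
  moreover have "integral {s - w..s} (\<lambda>_. (1 - g) * \<alpha>) = \<alpha> * \<beta>"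
  proof -
    have "integral {s - w..s} (\<lambda>_. (1 - g) * \<alpha>) = ((1 - g) * w) * \<alpha>" using w(1) by (simp add: mult.commute)
    then show ?thesis unfolding w(2) by simp
  qed
  ultimately show ?thesis
    unfolding shifted f_def[symmetric] I by linarith
qed

text \<open>Undiscounted and not divided by the profit at \<open>S\<close>: the discount factor
  depends on the date alone and cancels from each pointwise comparison, and the normalisation is
  restored in \<open>race_payoff\<close>.\<close>

definition race_flow :: "firm \<Rightarrow> state \<Rightarrow> real \<Rightarrow> real" where
  "race_flow i S s = exp (- (LINT u:{0..s}|lborel. lam (gap S + (1 - g) * u)))
     * \<pi> i (cap i S + s) (cap (rival i) S + s)"

definition flow :: "firm \<Rightarrow> real \<Rightarrow> path \<Rightarrow> real \<Rightarrow> real" where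
  "flow i t q s = exp (- r * (s - t) - (LINT u:{t..s}|lborel. lam (gap (q u))))
     * \<pi> i (cap i (q s)) (cap (rival i) (q s))"

lemma path_payoff_eq: "path_payoff r lam \<pi> i t q = (\<integral>\<^sup>+s\<in>{t..}. ennreal (flow i t q s) \<partial>lborel)"
  by (simp add: path_payoff_def flow_def)

text \<open>\<beta> is the lag of the firm behind its racing schedule at date \<open>s\<close>. A
  lag never shrinks at speeds up to 1, so the gap is within \<beta> of the racing gap at every date
  before \<open>s\<close>. The hazard saved is at most \<alpha>\<beta>, and catching up by \<beta>
  multiplies profit by at least exp(\<alpha>\<beta>).\<close>

lemma race_flow_ge:
  assumes q: "\<And>T. moves g T q" and \<tau>: "0 \<le> \<tau>" "\<tau> \<le> s"
    and rv: "\<And>s. \<tau> \<le> s \<Longrightarrow> cap (rival i) (q s) = cap (rival i) (q \<tau>) + (s - \<tau>)"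
  shows "exp (- (LINT u:{\<tau>..s}|lborel. lam (gap (q u)))) * \<pi> i (cap i (q s)) (cap (rival i) (q s))
    \<le> race_flow i (q \<tau>) (s - \<tau>)"
proof -
  let ?S = "q \<tau>"
  define \<beta> where "\<beta> = cap i ?S + (s - \<tau>) - cap i (q s)"
  have \<beta>: "0 \<le> \<beta>" using moves_cap(2)[OF q \<tau> order_refl, of i] by (simp add: \<beta>_def)
  have X: "snd (snd (q u)) = snd (snd ?S) + g * (u - \<tau>)" if "\<tau> \<le> u" for u
    using movesD(5)[OF q \<tau>(1) that order_refl] by simp
  have D: "gap ?S + (1 - g) * (u - \<tau>) - \<beta> \<le> gap (q u)" if u: "\<tau> \<le> u" "u \<le> s" for u
  proof -
    \<comment> \<open>The lag at \<open>u\<close> is at most the final lag. The rival has lag zero,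
      so the maximum of the two capabilities loses at most \<beta>.\<close>
    have "cap i (q s) - cap i (q u) \<le> s - u" using moves_cap(2)[OF q _ u(2) order_refl, of i] \<tau> u by simp
    then have "cap i ?S + (u - \<tau>) - \<beta> \<le> cap i (q u)" by (simp add: \<beta>_def)
    moreover have "cap (rival i) ?S + (u - \<tau>) - \<beta> \<le> cap (rival i) (q u)" using rv[OF u(1)] \<beta> by simp
    ultimately show ?thesis unfolding gap_eq[of _ i] X[OF u(1)] by (simp add: algebra_simps max_def)
  qed
  have contq: "continuous_on {\<tau>..s} q"
    by (rule continuous_on_subset[OF moves_continuous_on_atLeast[OF q g']]) (use \<tau> in auto)
  have "(LINT u:{0..s - \<tau>}|lborel. lam (gap ?S + (1 - g) * u - \<beta>))
    = (LINT u:{0..s - \<tau>}|lborel. (\<lambda>v. lam (gap ?S + (1 - g) * (v - \<tau>) - \<beta>)) (u + \<tau>))"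
    by simp
  also have "\<dots> = (LINT u:{0 + \<tau>..s - \<tau> + \<tau>}|lborel. lam (gap ?S + (1 - g) * (u - \<tau>) - \<beta>))"
    by (rule set_lebesgue_integral_shift[symmetric])
  also have "\<dots> = (LINT u:{\<tau>..s}|lborel. lam (gap ?S + (1 - g) * (u - \<tau>) - \<beta>))" by simp
  also have "\<dots> \<le> (LINT u:{\<tau>..s}|lborel. lam (gap (q u)))"
    using D by (intro set_integral_mono hazard_integrable continuous_intros continuous_on_gap contq monoD[OF lam_mono]) auto
  finally have "(LINT u:{0..s - \<tau>}|lborel. lam (gap ?S + (1 - g) * u)) - (LINT u:{\<tau>..s}|lborel. lam (gap (q u))) \<le> \<alpha> * \<beta>"
    using hazard_shift_le[OF \<beta>, of "s - \<tau>" "gap ?S"] \<tau> by simp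
  then have "exp (- (LINT u:{\<tau>..s}|lborel. lam (gap (q u))))
    \<le> exp (- (LINT u:{0..s - \<tau>}|lborel. lam (gap ?S + (1 - g) * u)) + \<alpha> * \<beta>)"
    by simp
  then have "exp (- (LINT u:{\<tau>..s}|lborel. lam (gap (q u)))) * \<pi> i (cap i (q s)) (cap (rival i) (q s))
    \<le> exp (- (LINT u:{0..s - \<tau>}|lborel. lam (gap ?S + (1 - g) * u)) + \<alpha> * \<beta>) * \<pi> i (cap i (q s)) (cap (rival i) (q s))"
    using \<pi>_pos by (intro mult_right_mono) (auto intro: less_imp_le)
  also have "\<dots> = exp (- (LINT u:{0..s - \<tau>}|lborel. lam (gap ?S + (1 - g) * u))) *
      (exp (\<alpha> * \<beta>) * \<pi> i (cap i (q s)) (cap (rival i) (q s)))"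
    by (simp only: exp_add mult.assoc)
  also have "\<dots> \<le> exp (- (LINT u:{0..s - \<tau>}|lborel. lam (gap ?S + (1 - g) * u))) *
      \<pi> i (cap i ?S + (s - \<tau>)) (cap (rival i) (q s))"
    using \<pi>_own[of "cap i (q s)" "cap i ?S + (s - \<tau>)" i] \<beta> by (intro mult_left_mono) (auto simp: \<beta>_def)
  also have "\<dots> = race_flow i ?S (s - \<tau>)" using rv[OF \<tau>(2)] by (simp add: race_flow_def)
  finally show ?thesis .
qed

text \<open>The hazard vanishes at gap zero, so the cumulated hazard starts only at \<tau>.\<close>

lemma flow_eq_tail:
  assumes "t \<le> \<tau>" "\<tau> \<le> s" and "\<And>u. t \<le> u \<Longrightarrow> u < \<tau> \<Longrightarrow> gap (q u) = 0"
  shows "flow i t q s = exp (- r * (s - t)) *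
    (exp (- (LINT u:{\<tau>..s}|lborel. lam (gap (q u)))) * \<pi> i (cap i (q s)) (cap (rival i) (q s)))"
proof -
  have "(LINT u:{t..s}|lborel. lam (gap (q u))) = (LINT u:{\<tau>..s}|lborel. lam (gap (q u)))"
    unfolding set_lebesgue_integral_def
    using assms lam_nonpos by (intro Bochner_Integration.integral_cong) (auto simp: indicator_def)
  then show ?thesis
    unfolding flow_def by (simp only: diff_conv_add_uminus[of "- r * _"] exp_add mult.assoc)
qed

lemma race_flow_measurable: "race_flow i S \<in> borel_measurable borel"
proof -
  have "mono (\<lambda>s. LINT u:{0..s}|lborel. lam (gap S + (1 - g) * u))"
    unfolding set_lebesgue_integral_def
    by (intro monoI integral_mono hazard_integrable[unfolded set_integrable_def] continuous_intros)
      (auto simp: indicator_def lam_nonneg)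
  then have [measurable]: "(\<lambda>s. LINT u:{0..s}|lborel. lam (gap S + (1 - g) * u)) \<in> borel_measurable borel"
    by (rule borel_measurable_mono)
  have "continuous_on UNIV (\<lambda>s. (\<lambda>z. \<pi> i (fst z) (snd z)) (cap i S + s, cap (rival i) S + s))"
    by (rule continuous_on_compose2[OF \<pi>_cont]) (auto intro!: continuous_intros)
  then have [measurable]: "(\<lambda>s. \<pi> i (cap i S + s) (cap (rival i) S + s)) \<in> borel_measurable borel"
    by (simp add: borel_measurable_continuous_onI)
  show ?thesis unfolding race_flow_def by measurable
qed

lemma flow_measurable:
  assumes q: "\<And>T. moves g T q" and t: "0 \<le> t"
  shows "(\<lambda>s. ennreal (flow i t q s) * indicator {t..} s) \<in> borel_measurable borel"
proof -
  have cq: "continuous_on {0..} q" by (rule moves_continuous_on_atLeast[OF q g'])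
  have c: "continuous_on {t..s} (\<lambda>u. gap (q u))" for s
    using t by (intro continuous_on_gap continuous_on_subset[OF cq]) auto
  have "mono (\<lambda>s. LINT u:{t..s}|lborel. lam (gap (q u)))"
    unfolding set_lebesgue_integral_def
    by (intro monoI integral_mono hazard_integrable[unfolded set_integrable_def] c)
      (auto simp: indicator_def lam_nonneg)
  then have [measurable]: "(\<lambda>s. LINT u:{t..s}|lborel. lam (gap (q u))) \<in> borel_measurable borel"
    by (rule borel_measurable_mono)
  \<comment> \<open>Nothing is known of the path at negative dates; freezing it before
    \<open>t\<close> gives a function continuous on the whole line.\<close>
  have "continuous_on UNIV (\<lambda>s. q (max t s))"
    by (rule continuous_on_compose2[OF cq]) (use t in \<open>auto intro!: continuous_intros\<close>)
  then have "continuous_on UNIV (\<lambda>s. (\<lambda>z. \<pi> i (fst z) (snd z)) (cap i (q (max t s)), cap (rival i) (q (max t s))))"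
    by (intro continuous_on_compose2[OF \<pi>_cont] continuous_intros continuous_on_cap) auto
  then have [measurable]: "(\<lambda>s. \<pi> i (cap i (q (max t s))) (cap (rival i) (q (max t s)))) \<in> borel_measurable borel"
    by (simp add: borel_measurable_continuous_onI)
  have "(\<lambda>s. ennreal (flow i t q s) * indicator {t..} s) =
    (\<lambda>s. ennreal (exp (- r * (s - t) - (LINT u:{t..s}|lborel. lam (gap (q u))))
     * \<pi> i (cap i (q (max t s))) (cap (rival i) (q (max t s)))) * indicator {t..} s)"
    by (auto simp: flow_def indicator_def fun_eq_iff max_def)
  also have "\<dots> \<in> borel_measurable borel" by measurable
  finally show ?thesis .
qed

end

lemma gap_pacing [simp]: "gap (pacing g A0 s) = 0"
  by (simp add: pacing_def)

lemma cap_pacing [simp]: "cap i (pacing g A0 s) = A0 + g * s"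
  by (cases i) (simp_all add: pacing_def)

lemma moves_pacing: "0 \<le> g \<Longrightarrow> g \<le> 1 \<Longrightarrow> moves g T (pacing g A0)"
  by (auto simp: moves_def pacing_def right_diff_distrib[symmetric] mult_left_le_one_le)

context development_race
begin

lemma flow_cong: "(\<And>u. t \<le> u \<Longrightarrow> u \<le> s \<Longrightarrow> q u = q' u) \<Longrightarrow> t \<le> s \<Longrightarrow> flow i t q s = flow i t q' s"
proof -
  assume eq: "\<And>u. t \<le> u \<Longrightarrow> u \<le> s \<Longrightarrow> q u = q' u" and t: "t \<le> s"
  have "(LINT u:{t..s}|lborel. lam (gap (q u))) = (LINT u:{t..s}|lborel. lam (gap (q' u)))"
    unfolding set_lebesgue_integral_def
    using eq by (intro Bochner_Integration.integral_cong refl) (simp add: indicator_def)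
  then show ?thesis using eq[of s] t by (simp add: flow_def)
qed

lemma flow_eq_discounted:
  assumes "t \<le> \<tau>" "\<tau> \<le> s" and "\<And>u. t \<le> u \<Longrightarrow> u < \<tau> \<Longrightarrow> gap (q u) = 0"
  shows "flow i t q s = exp (- r * (\<tau> - t)) * flow i \<tau> q s"
proof -
  have "exp (- r * (s - t)) = exp (- r * (\<tau> - t)) * exp (- r * (s - \<tau>))"
    by (simp add: exp_add[symmetric] algebra_simps)
  then show ?thesis
    using flow_eq_tail[OF assms] flow_eq_tail[of \<tau> \<tau> s q i] assms(2) by simp
qed

lemma flow_nonneg: "0 \<le> flow i t q s"
  using \<pi>_pos[THEN less_imp_le] by (simp add: flow_def)

text \<open>With no hazard before \<tau>, the continuation is weighted by pure discounting, whatever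
  happens after \<tau>. This makes paths comparable by their continuation payoffs alone once they
  share a start with zero gap.\<close>

lemma path_payoff_split:
  assumes q: "\<And>T. moves g T q" and t: "0 \<le> t" "t \<le> \<tau>"
    and gap: "\<And>u. t \<le> u \<Longrightarrow> u < \<tau> \<Longrightarrow> gap (q u) = 0"
  shows "path_payoff r lam \<pi> i t q = (\<integral>\<^sup>+s\<in>{t..<\<tau>}. ennreal (flow i t q s) \<partial>lborel)
    + ennreal (exp (- r * (\<tau> - t))) * path_payoff r lam \<pi> i \<tau> q"
proof -
  let ?c = "ennreal (exp (- r * (\<tau> - t)))"
  note m = flow_measurable[OF q t(1), of i]
  have "0 \<le> \<tau>" using t by simp
  note m' = flow_measurable[OF q this, of i]
  have m1: "(\<lambda>s. ennreal (flow i t q s) * indicator {t..<\<tau>} s) \<in> borel_measurable borel"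
  proof -
    have "(\<lambda>s. ennreal (flow i t q s) * indicator {t..<\<tau>} s)
        = (\<lambda>s. (ennreal (flow i t q s) * indicator {t..} s) * indicator {..<\<tau>} s)"
      by (auto simp: indicator_def)
    also have "\<dots> \<in> borel_measurable borel" using m by measurable
    finally show ?thesis .
  qed
  have "ennreal (flow i t q s) * indicator {t..} s = ennreal (flow i t q s) * indicator {t..<\<tau>} s
      + ?c * (ennreal (flow i \<tau> q s) * indicator {\<tau>..} s)" for s
    using t flow_eq_discounted[where q=q and s=s and i=i, OF t(2) _ gap] flow_nonneg
    by (cases "s < \<tau>") (auto simp: indicator_def ennreal_mult')
  then have "path_payoff r lam \<pi> i t q = (\<integral>\<^sup>+s. ennreal (flow i t q s) * indicator {t..<\<tau>} s
      + ?c * (ennreal (flow i \<tau> q s) * indicator {\<tau>..} s) \<partial>lborel)"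
    by (simp add: path_payoff_eq)
  also have "\<dots> = (\<integral>\<^sup>+s\<in>{t..<\<tau>}. ennreal (flow i t q s) \<partial>lborel)
     + (\<integral>\<^sup>+s. ?c * (ennreal (flow i \<tau> q s) * indicator {\<tau>..} s) \<partial>lborel)"
    using m1 m' by (intro nn_integral_add) (auto intro: borel_measurable_times)
  also have "(\<integral>\<^sup>+s. ?c * (ennreal (flow i \<tau> q s) * indicator {\<tau>..} s) \<partial>lborel) = ?c * path_payoff r lam \<pi> i \<tau> q"
    using m' unfolding path_payoff_eq by (intro nn_integral_cmult) simp
  finally show ?thesis .
qed

lemma path_payoff_split_cong:
  assumes t: "t \<le> \<tau>" and eq: "\<And>u. t \<le> u \<Longrightarrow> u < \<tau> \<Longrightarrow> q u = q' u"
  shows "(\<integral>\<^sup>+s\<in>{t..<\<tau>}. ennreal (flow i t q s) \<partial>lborel) = (\<integral>\<^sup>+s\<in>{t..<\<tau>}. ennreal (flow i t q' s) \<partial>lborel)"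
proof (intro nn_integral_cong)
  fix s
  show "ennreal (flow i t q s) * indicator {t..<\<tau>} s = ennreal (flow i t q' s) * indicator {t..<\<tau>} s"
    using eq flow_cong[of t s q q' i] by (auto simp: indicator_def)
qed

lemma path_payoff_pacing:
  assumes t: "0 \<le> t"
  shows "path_payoff r lam \<pi> i t (pacing g A0) = ennreal (\<pi> i (A0 + g * t) (A0 + g * t)) * P_pace g r \<pi> i (A0 + g * t)"
proof -
  define x where "x = A0 + g * t"
  have "continuous_on UNIV (\<lambda>s. (\<lambda>z. \<pi> i (fst z) (snd z)) (x + g * s, x + g * s))"
    by (rule continuous_on_compose2[OF \<pi>_cont]) (auto intro!: continuous_intros)
  then have [measurable]: "(\<lambda>s. \<pi> i (x + g * s) (x + g * s)) \<in> borel_measurable borel"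
    by (simp add: borel_measurable_continuous_onI)
  have fl: "flow i t (pacing g A0) (t + s) = \<pi> i x x * (exp (- r * s) * (\<pi> i (x + g * s) (x + g * s) / \<pi> i x x))" for s
    using \<pi>_pos[of i x x] lam_nonpos[of 0] by (simp add: flow_def x_def algebra_simps)
  have "path_payoff r lam \<pi> i t (pacing g A0)
      = (\<integral>\<^sup>+s. ennreal (\<pi> i x x) * (ennreal (exp (- r * s) * (\<pi> i (x + g * s) (x + g * s) / \<pi> i x x)) * indicator {0..} s) \<partial>lborel)"
    unfolding path_payoff_eq nn_integral_atLeast_shift[OF flow_measurable[OF moves_pacing[OF g'] t]]
    by (simp only: fl ennreal_mult'[OF less_imp_le[OF \<pi>_pos]] mult.assoc)
  also have "\<dots> = ennreal (\<pi> i x x) * P_pace g r \<pi> i x"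
    unfolding P_pace_def by (intro nn_integral_cmult) measurable
  finally show ?thesis by (simp add: x_def)
qed

lemma race_payoff:
  "(\<integral>\<^sup>+s\<in>{\<tau>..}. ennreal (exp (- r * (s - \<tau>)) * race_flow i S (s - \<tau>)) \<partial>lborel)
    = ennreal (\<pi> i (cap i S) (cap (rival i) S)) * R_race g r lam \<pi> i S"
proof -
  let ?p = "\<pi> i (cap i S) (cap (rival i) S)"
  have [measurable]: "race_flow i S \<in> borel_measurable borel" by (rule race_flow_measurable)
  have "(\<integral>\<^sup>+s\<in>{\<tau>..}. ennreal (exp (- r * (s - \<tau>)) * race_flow i S (s - \<tau>)) \<partial>lborel)
    = (\<integral>\<^sup>+s\<in>{0..}. ennreal (exp (- r * s) * race_flow i S s) \<partial>lborel)"
    by (subst nn_integral_atLeast_shift) simp_all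
  also have "\<dots> = (\<integral>\<^sup>+s. ennreal ?p * (ennreal (exp (- r * s) * (race_flow i S s / ?p)) * indicator {0..} s) \<partial>lborel)"
    using \<pi>_pos[of i "cap i S" "cap (rival i) S"]
    by (intro nn_integral_cong) (simp add: ennreal_mult'[symmetric] mult.assoc[symmetric])
  also have "\<dots> = ennreal ?p * (\<integral>\<^sup>+s. ennreal (exp (- r * s) * (race_flow i S s / ?p)) * indicator {0..} s \<partial>lborel)"
    by (intro nn_integral_cmult) measurable
  also have "(\<integral>\<^sup>+s. ennreal (exp (- r * s) * (race_flow i S s / ?p)) * indicator {0..} s \<partial>lborel) = R_race g r lam \<pi> i S"
    unfolding R_race_def race_flow_def
    by (intro nn_integral_cong) (simp add: exp_diff exp_minus divide_inverse mult.assoc)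
  finally show ?thesis .
qed

lemma flow_start: "flow i \<tau> q s = exp (- r * (s - \<tau>)) *
    (exp (- (LINT u:{\<tau>..s}|lborel. lam (gap (q u)))) * \<pi> i (cap i (q s)) (cap (rival i) (q s)))"
  unfolding flow_def by (simp only: diff_conv_add_uminus[of "- r * _"] exp_add mult.assoc)

lemma path_payoff_le_race:
  assumes q: "\<And>T. moves g T q" and \<tau>: "0 \<le> \<tau>"
    and rv: "\<And>s. \<tau> \<le> s \<Longrightarrow> cap (rival i) (q s) = cap (rival i) (q \<tau>) + (s - \<tau>)"
  shows "path_payoff r lam \<pi> i \<tau> q \<le> ennreal (\<pi> i (cap i (q \<tau>)) (cap (rival i) (q \<tau>))) * R_race g r lam \<pi> i (q \<tau>)"
  unfolding race_payoff[of \<tau>, symmetric] path_payoff_eq flow_start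
  using race_flow_ge[OF q \<tau> _ rv]
  by (intro nn_integral_mono) (auto simp: indicator_def intro!: ennreal_leI mult_left_mono)

text \<open>The own capability is fixed by racing, and the rival is at most where a joint race would
  put it. The gap, hence the hazard, is then at most the racing one, while the flow profit is at
  least the racing one.\<close>

lemma path_payoff_ge_race:
  assumes q: "\<And>T. moves g T q" and \<tau>: "0 \<le> \<tau>"
    and own: "\<And>s. \<tau> \<le> s \<Longrightarrow> cap i (q s) = cap i (q \<tau>) + (s - \<tau>)"
  shows "ennreal (\<pi> i (cap i (q \<tau>)) (cap (rival i) (q \<tau>))) * R_race g r lam \<pi> i (q \<tau>) \<le> path_payoff r lam \<pi> i \<tau> q"
  unfolding race_payoff[of \<tau>, symmetric] path_payoff_eq
proof (intro nn_integral_mono)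
  let ?S = "q \<tau>"
  fix s
  have "exp (- r * (s - \<tau>)) * race_flow i ?S (s - \<tau>) \<le> flow i \<tau> q s" if s: "\<tau> \<le> s"
  proof -
    have rv: "cap (rival i) (q u) \<le> cap (rival i) ?S + (u - \<tau>)" if "\<tau> \<le> u" for u
      using moves_cap(2)[OF q \<tau> that order_refl, of "rival i"] by simp
    have D: "gap (q u) \<le> gap ?S + (1 - g) * (u - \<tau>)" if u: "\<tau> \<le> u" for u
      using rv[OF u] own[OF u] movesD(5)[OF q \<tau> u order_refl]
      unfolding gap_eq[of _ i] by (simp add: algebra_simps max_def)
    have contq: "continuous_on {\<tau>..s} q"
      by (rule continuous_on_subset[OF moves_continuous_on_atLeast[OF q g']]) (use \<tau> in auto)
    have "(LINT u:{\<tau>..s}|lborel. lam (gap (q u))) \<le> (LINT u:{\<tau>..s}|lborel. lam (gap ?S + (1 - g) * (u - \<tau>)))"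
      using D by (intro set_integral_mono hazard_integrable continuous_intros continuous_on_gap contq monoD[OF lam_mono]) auto
    also have "\<dots> = (LINT u:{0 + \<tau>..(s - \<tau>) + \<tau>}|lborel. lam (gap ?S + (1 - g) * (u - \<tau>)))" by simp
    also have "\<dots> = (LINT u:{0..s - \<tau>}|lborel. lam (gap ?S + (1 - g) * (u + \<tau> - \<tau>)))"
      by (rule set_lebesgue_integral_shift)
    finally have "(LINT u:{\<tau>..s}|lborel. lam (gap (q u))) \<le> (LINT u:{0..s - \<tau>}|lborel. lam (gap ?S + (1 - g) * u))"
      by simp
    then have "race_flow i ?S (s - \<tau>) \<le> exp (- (LINT u:{\<tau>..s}|lborel. lam (gap (q u)))) * \<pi> i (cap i (q s)) (cap (rival i) (q s))"
      unfolding race_flow_def own[OF s] using \<pi>_rival[OF rv[OF s]] \<pi>_pos[THEN less_imp_le]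
      by (intro mult_mono) auto
    then show ?thesis unfolding flow_start by (intro mult_left_mono) auto
  qed
  then show "ennreal (exp (- r * (s - \<tau>)) * race_flow i ?S (s - \<tau>)) * indicator {\<tau>..} s
     \<le> ennreal (flow i \<tau> q s) * indicator {\<tau>..} s"
    by (auto simp: indicator_def intro!: ennreal_leI)
qed

end

subsection \<open>The grim trigger\<close>

definition speed_of :: "firm \<Rightarrow> real \<times> real \<Rightarrow> real" where
  "speed_of i v = (case i of Firm1 \<Rightarrow> fst v | Firm2 \<Rightarrow> snd v)"

lemma speed_of_speeds [simp]: "speed_of i (speeds g \<sigma> H) = prescribed g (\<sigma> i) H"
  by (cases i) (simp_all add: speed_of_def speeds_def)

text \<open>Unit speed of one firm is a hyperplane in the square of speeds, closed and convex, so
  neither hull nor closure leaves it. The other firm's speed stays unrestricted.\<close>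

lemma K_unit_speed:
  assumes "0 < e" "\<And>H'. feasible_history g H' \<Longrightarrow> hist_dist H H' < e \<Longrightarrow> prescribed g (\<sigma> i) H' = 1"
    and v: "v \<in> K g \<sigma> H"
  shows "speed_of i v = 1"
proof -
  define w :: "real \<times> real" where "w = (case i of Firm1 \<Rightarrow> (1, 0) | Firm2 \<Rightarrow> (0, 1))"
  have w: "speed_of i x = w \<bullet> x" for x
    by (cases i) (simp_all add: speed_of_def w_def inner_prod_def)
  have "K g \<sigma> H \<subseteq> {x. w \<bullet> x = 1}"
  proof (rule K_subset[OF assms(1) closed_hyperplane convex_hyperplane])
    fix H' assume "feasible_history g H'" "hist_dist H H' < e"
    then show "speeds g \<sigma> H' \<in> {x. w \<bullet> x = 1}" using assms(2) by (simp add: w[symmetric])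
  qed
  then show ?thesis using v w by auto
qed

lemma unit_speed_cap:
  assumes g: "0 \<le> g" "g \<le> 1" and q: "\<And>T. moves g T q" and \<tau>: "0 \<le> \<tau>" "\<tau> \<le> s"
    and der: "AE u in lborel. u > \<tau> \<longrightarrow> (\<exists>v1 v2. (q has_vector_derivative (v1, v2, g)) (at u) \<and> speed_of i (v1, v2) = 1)"
  shows "cap i (q s) = cap i (q \<tau>) + (s - \<tau>)"
proof (rule antisym)
  show "cap i (q s) \<le> cap i (q \<tau>) + (s - \<tau>)"
    using moves_cap(2)[OF q \<tau> order_refl, of i] by simp
  define w :: state where "w = (case i of Firm1 \<Rightarrow> (1, 0, 0) | Firm2 \<Rightarrow> (0, 1, 0))"
  have w: "cap i x = w \<bullet> x" for x
    by (cases i) (simp_all add: cap_eq w_def inner_prod_def)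
  have "1 * (s - \<tau>) \<le> w \<bullet> (q s - q \<tau>)"
  proof (rule abs_continuous_on_increment_ge[OF abs_continuous_on_subset[OF moves_abs_continuous_on[OF q[of s] g]]])
    show "AE u in lborel. u \<in> {\<tau><..<s} \<longrightarrow> (\<exists>D. (q has_vector_derivative D) (at u) \<and> 1 \<le> w \<bullet> D)"
      using der
    proof eventually_elim
      case (elim u)
      show ?case
      proof
        assume "u \<in> {\<tau><..<s}"
        then obtain v1 v2 where "(q has_vector_derivative (v1, v2, g)) (at u)" "speed_of i (v1, v2) = 1"
          using elim by auto
        then show "\<exists>D. (q has_vector_derivative D) (at u) \<and> 1 \<le> w \<bullet> D"
          by (intro exI[of _ "(v1, v2, g)"]) (cases i; simp add: speed_of_def w[symmetric])
      qed
    qed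
  qed (use \<tau> in auto)
  then show "cap i (q \<tau>) + (s - \<tau>) \<le> cap i (q s)"
    by (simp add: w inner_diff_right)
qed

text \<open>Serves twice: agreement at rational dates decides agreement on an interval, and a path
  still agrees with pacing at its exit date.\<close>

lemma moves_eq_left:
  assumes h: "moves g u h" "moves g u h'" and g: "0 \<le> g" "g \<le> 1"
    and ex: "\<And>d. 0 < d \<Longrightarrow> \<exists>v. 0 \<le> v \<and> v \<le> u \<and> u - v < d \<and> h v = h' v"
  shows "h u = h' u"
proof (rule ccontr)
  assume "h u \<noteq> h' u"
  then have "0 < norm (h u - h' u)" by simp
  then obtain v where v: "0 \<le> v" "v \<le> u" "u - v < norm (h u - h' u) / 6" "h v = h' v"
    using ex[of "norm (h u - h' u) / 6"] by auto
  have "norm (h u - h' u) \<le> norm (h u - h v) + norm (h' u - h' v)"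
    using norm_triangle_ineq4[of "h u - h v" "h' u - h' v"] v(4) by simp
  also have "\<dots> \<le> 3 * (u - v) + 3 * (u - v)"
    using moves_norm_le[OF h(1) g v(1,2) order_refl] moves_norm_le[OF h(2) g v(1,2) order_refl] by (rule add_mono)
  finally show False using v(3) by simp
qed

lemma prescribed_grim_trigger:
  "prescribed g (grim_trigger g A0 i) (t, h) = (if \<forall>s\<in>{0..t}. h s = pacing g A0 s then g else 1)"
  by (auto simp: prescribed_def grim_trigger_def extend_def)

text \<open>A departure of size 4e is still visible in every history within distance e, even one
  that ends before \<open>u\<close>: one e pays for the states and three for cutting the pacing
  path, whose speed is at most 3.\<close>

lemma off_path_unit_speed:
  assumes g: "0 \<le> g" "g \<le> 1" and \<sigma>: "\<sigma> i = grim_trigger g A0 i" and q: "moves g s q" "0 \<le> s"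
    and u: "u \<in> {0..s}" "q u \<noteq> pacing g A0 u" and v: "v \<in> K g \<sigma> (s, q)"
  shows "speed_of i v = 1"
proof (rule K_unit_speed[OF _ _ v])
  let ?p = "pacing g A0"
  define e where "e = norm (q u - ?p u) / 4"
  show e: "0 < e" using u by (simp add: e_def)
  fix H' assume H': "feasible_history g H'" "hist_dist (s, q) H' < e"
  obtain t' h' where th: "H' = (t', h')" by (cases H')
  have t': "0 \<le> t'" "moves g t' h'" using H' feasible_history_iff[OF g] by (auto simp: th)
  have d: "\<bar>s - t'\<bar> < e" "norm (q (min u s) - h' (min u t')) < e"
    using hist_dist_lessD(1)[OF q(1) t'(2) q(2) t'(1) g H'(2)[unfolded th]]
      hist_dist_lessD(2)[OF q(1) t'(2) q(2) t'(1) g H'(2)[unfolded th], of u] u by auto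
  have "h' (min u t') \<noteq> ?p (min u t')"
  proof
    assume eq: "h' (min u t') = ?p (min u t')"
    have "norm (?p u - ?p (min u t')) \<le> 3 * (u - min u t')"
      using u t' by (intro moves_norm_le[OF moves_pacing[OF g] g]) auto
    moreover have "u - min u t' \<le> \<bar>s - t'\<bar>" using u by auto
    moreover have "norm (q u - ?p u) \<le> norm (q u - h' (min u t')) + norm (?p u - ?p (min u t'))"
      using norm_triangle_ineq4[of "q u - h' (min u t')" "?p u - ?p (min u t')"] eq by simp
    ultimately show False using d u by (simp add: e_def min_absorb1)
  qed
  then have "\<not> (\<forall>s\<in>{0..t'}. h' s = ?p s)" using u t' by (auto intro!: bexI[of _ "min u t'"])
  then show "prescribed g (\<sigma> i) H' = 1" unfolding \<sigma> th prescribed_grim_trigger by (rule if_not_P)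
qed

section \<open>Measurability of the grim trigger\<close>

lemma space_Filt [simp]: "space (Filt g T) = Omega g"
  by (simp add: Filt_def space_measure_of_conv)

lemma const_strategy: "c \<in> {0..1} \<Longrightarrow> (\<lambda>_ _. c) \<in> strategies g"
  by (auto simp: strategies_def progressively_measurable_def case_prod_unfold)

lemma Filt_evaluation:
  assumes "u \<in> {0..T}"
  shows "{\<omega> \<in> Omega g. fst \<omega> u = x} \<in> sets (Filt g T)"
proof -
  have "{\<omega> \<in> Omega g. fst \<omega> u \<in> {x}} \<in> sets (Filt g T)"
    unfolding Filt_def using assms by (intro in_measure_of) (auto intro!: exI[of _ u] exI[of _ "{x}"])
  then show ?thesis by simp
qed

text \<open>Having followed the path is an intersection over uncountably many dates; since feasible
  paths are continuous, the rational dates decide it.\<close>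

lemma grim_trigger_strategy:
  assumes g: "0 \<le> g" "g \<le> 1"
  shows "grim_trigger g A0 i \<in> strategies g"
  unfolding strategies_def mem_Collect_eq
proof (intro conjI ballI allI impI)
  show "grim_trigger g A0 i t \<omega> \<in> {0..1}" for t \<omega>
    using g by (simp add: grim_trigger_def)
  show "progressively_measurable g (grim_trigger g A0 i)"
    unfolding progressively_measurable_def
  proof (intro allI impI)
    fix T :: real assume T: "0 \<le> T"
    let ?p = "pacing g A0"
    define M where "M = restrict_space borel {0..T} \<Otimes>\<^sub>M Filt g T"
    have space: "space M = {0..T} \<times> Omega g"
      by (simp add: M_def space_pair_measure space_restrict_space)
    \<comment> \<open>The requirement at \<open>u\<close> is void while the current date is before
      \<open>u\<close>. This turns a condition with a moving horizon into a countable intersection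
      of product-measurable sets.\<close>
    define E where "E u = {z \<in> space M. fst z < u} \<union> {z \<in> space M. fst (snd z) u = ?p u}" for u
    define A where "A = space M \<inter> (\<Inter>u\<in>\<rat> \<inter> {0..T}. E u)"
    have fst_m: "fst \<in> M \<rightarrow>\<^sub>M borel"
      unfolding M_def by (rule measurable_compose[OF measurable_fst]) (simp add: measurable_restrict_space1)
    have E: "E u \<in> sets M" if u: "u \<in> {0..T}" for u
    proof -
      have "{z \<in> space M. fst z < u} \<in> sets M" using fst_m by measurable
      moreover have "snd -` {\<omega> \<in> Omega g. fst \<omega> u = ?p u} \<inter> space M \<in> sets M"
        unfolding M_def by (rule measurable_sets[OF measurable_snd Filt_evaluation[OF u]])
      moreover have "snd -` {\<omega> \<in> Omega g. fst \<omega> u = ?p u} \<inter> space M = {z \<in> space M. fst (snd z) u = ?p u}"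
        by (auto simp: space)
      ultimately show ?thesis by (simp add: E_def sets.Un)
    qed
    have "countable (\<rat> \<inter> {0..T})" by (intro countable_Int1 countable_rat)
    moreover have "0 \<in> \<rat> \<inter> {0..T}" using T by simp
    ultimately have "(\<Inter>u\<in>\<rat> \<inter> {0..T}. E u) \<in> sets M"
      using E by (intro sets.countable_INT') auto
    then have A: "A \<in> sets M" by (auto simp: A_def)
    have iff: "(\<forall>u\<in>{0..s}. fst \<omega> u = ?p u) \<longleftrightarrow> (s, \<omega>) \<in> A" if z: "(s, \<omega>) \<in> space M" for s \<omega>
    proof
      assume "\<forall>u\<in>{0..s}. fst \<omega> u = ?p u"
      then show "(s, \<omega>) \<in> A" using z by (auto simp: A_def E_def)
    next
      assume "(s, \<omega>) \<in> A"
      then have rat: "fst \<omega> u = ?p u" if "u \<in> \<rat>" "0 \<le> u" "u \<le> s" for u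
      proof -
        have "u \<in> \<rat> \<inter> {0..T}" using that z by (simp add: space)
        then have "(s, \<omega>) \<in> E u" using \<open>(s, \<omega>) \<in> A\<close> unfolding A_def by blast
        then show ?thesis using that by (simp add: E_def)
      qed
      have m: "moves g S (fst \<omega>)" if "0 \<le> S" for S
        using z that by (auto simp: space Omega_def feasible_path_def feasible_history_iff[OF g])
      show "\<forall>u\<in>{0..s}. fst \<omega> u = ?p u"
      proof
        fix u assume u: "u \<in> {0..s}"
        show "fst \<omega> u = ?p u"
        proof (cases "u = 0")
          case True
          then show ?thesis using rat[of 0] u by simp
        next
          case False
          show ?thesis
          proof (rule moves_eq_left[OF m moves_pacing[OF g] g])
            fix d :: real assume d: "0 < d"
            obtain v where "v \<in> \<rat>" "max 0 (u - d) < v" "v < u"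
              using Rats_dense_in_real[of "max 0 (u - d)" u] False u d by auto
            then show "\<exists>v\<ge>0. v \<le> u \<and> u - v < d \<and> fst \<omega> v = ?p v"
              using rat[of v] u by (intro exI[of _ v]) auto
          qed (use u in auto)
        qed
      qed
    qed
    have "(\<lambda>z. if z \<in> A then g else 1) \<in> borel_measurable M"
      using A by (intro measurable_If_set) (auto simp: A_def)
    moreover have "(\<lambda>z. if z \<in> A then g else 1) \<in> borel_measurable M \<longleftrightarrow>
        (\<lambda>(s, \<omega>). grim_trigger g A0 i s \<omega>) \<in> borel_measurable M"
      using iff by (intro measurable_cong) (auto simp: grim_trigger_def)
    ultimately show "(\<lambda>(s, \<omega>). grim_trigger g A0 i s \<omega>) \<in> borel_measurable (restrict_space borel {0..T} \<Otimes>\<^sub>M Filt g T)"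
      by (simp add: M_def)
  qed
qed

subsection \<open>Pacing as an equilibrium outcome\<close>

lemma cap_diagonal: "cap i (x, x, x) = x"
  by (cases i) simp_all

lemma pacing_has_vector_derivative: "(pacing g A0 has_vector_derivative (g, g, g)) (at s)"
proof -
  have "((\<lambda>t. (A0 + g * t, A0 + g * t, A0 + g * t)) has_vector_derivative (g, g, g)) (at s)"
    by (auto intro!: derivative_eq_intros has_vector_derivative_Pair)
  then show ?thesis by (simp add: pacing_def[abs_def])
qed

text \<open>Concatenation: at dates before \<open>t\<close> the correspondence sees only the common
  prefix, where pacing already satisfies the inclusion. It lets the equilibrium value at the initial
  history bound continuations that start later.\<close>

lemma admissible_from_initial:
  assumes p: "pacing g A0 \<in> admissible g \<sigma> (initial A0)" and q: "q \<in> admissible g \<sigma> (t, pacing g A0)" and t: "0 \<le> t"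
  shows "q \<in> admissible g \<sigma> (initial A0)"
proof -
  let ?p = "pacing g A0"
  have eq: "q s = ?p s" if "0 \<le> s" "s \<le> t" for s
    using q that by (auto simp: admissible_def)
  have p': "AE s in lborel. s > 0 \<longrightarrow>
      (\<exists>v1 v2. (?p has_vector_derivative (v1, v2, g)) (at s) \<and> (v1, v2) \<in> K g \<sigma> (s, ?p))"
    using p by (simp add: admissible_def initial_def)
  have q': "AE s in lborel. s > t \<longrightarrow>
      (\<exists>v1 v2. (q has_vector_derivative (v1, v2, g)) (at s) \<and> (v1, v2) \<in> K g \<sigma> (s, q))"
    using q by (simp add: admissible_def)
  have "AE s in lborel. s > 0 \<longrightarrow>
      (\<exists>v1 v2. (q has_vector_derivative (v1, v2, g)) (at s) \<and> (v1, v2) \<in> K g \<sigma> (s, q))"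
    using p' q' AE_lborel_singleton[of t]
  proof eventually_elim
    case (elim s)
    show ?case
    proof
      assume s: "0 < s"
      show "\<exists>v1 v2. (q has_vector_derivative (v1, v2, g)) (at s) \<and> (v1, v2) \<in> K g \<sigma> (s, q)"
      proof (cases "t < s")
        case True
        then show ?thesis using elim by blast
      next
        case False
        then have st: "s \<in> {0<..<t}" using elim s by auto
        obtain v1 v2 where v: "(?p has_vector_derivative (v1, v2, g)) (at s)" "(v1, v2) \<in> K g \<sigma> (s, ?p)"
          using elim s by blast
        have "(q has_vector_derivative (v1, v2, g)) (at s)"
          by (rule has_vector_derivative_transform_within_open[OF v(1) _ st]) (auto simp: eq)
        moreover have "K g \<sigma> (s, q) = K g \<sigma> (s, ?p)" using st eq by (intro K_cong) auto
        ultimately show ?thesis using v(2) by auto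
      qed
    qed
  qed
  moreover have "q 0 = (A0, A0, A0)" using eq[of 0] t by (simp add: pacing_def)
  ultimately show ?thesis using q by (simp add: admissible_def initial_def)
qed

lemma feasible_initial: "0 \<le> g \<Longrightarrow> g \<le> 1 \<Longrightarrow> feasible_history g (initial A0)"
  by (auto simp: initial_def feasible_history_iff moves_def)

text \<open>The prescribed speeds always belong to \<open>K\<close>, so pacing solves the inclusion
  although \<open>K\<close> is larger than one point along it.\<close>

lemma pacing_admissible:
  assumes g: "0 \<le> g" "g \<le> 1" and t: "0 \<le> t" and h: "\<And>s. 0 \<le> s \<Longrightarrow> s \<le> t \<Longrightarrow> h s = pacing g A0 s"
  shows "pacing g A0 \<in> admissible g (grim_trigger g A0) (t, h)"
proof -
  have "(g, g) \<in> K g (grim_trigger g A0) (s, pacing g A0)" if "t < s" for s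
  proof -
    have "feasible_history g (s, pacing g A0)"
      using moves_pacing g t that by (simp add: feasible_history_iff)
    from speeds_in_K[OF this, of "grim_trigger g A0"] show ?thesis
      by (simp add: speeds_def prescribed_grim_trigger)
  qed
  then have "AE s in lborel. t < s \<longrightarrow> (\<exists>v1 v2. (pacing g A0 has_vector_derivative (v1, v2, g)) (at s) \<and>
      (v1, v2) \<in> K g (grim_trigger g A0) (s, pacing g A0))"
    using pacing_has_vector_derivative by (intro AE_I2) blast
  then show ?thesis
    using moves_abs_continuous_on[OF moves_pacing[OF g] g] h by (simp add: admissible_def)
qed

context development_race
begin

text \<open>Only the rival is bound to the trigger, so one bound covers every deviation of firm
  \<open>i\<close>.\<close>

lemma grim_value_le_race:
  assumes \<sigma>: "\<And>i. \<sigma> i \<in> strategies g" "\<sigma> (rival i) = grim_trigger g A0 (rival i)"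
    and H: "feasible_history g (t, h)" and u: "u \<in> {0..t}" "h u \<noteq> pacing g A0 u"
  shows "V g r lam \<pi> i \<sigma> (t, h) \<le> ennreal (\<pi> i (cap i (h t)) (cap (rival i) (h t))) * R_race g r lam \<pi> i (h t)"
  unfolding V_def
proof (rule SUP_least)
  fix q assume q: "q \<in> admissible g \<sigma> (t, h)"
  note adm = admissibleD[where \<sigma>=\<sigma>, OF g' \<sigma>(1) H q]
  have t: "0 \<le> t" using u by simp
  have "AE s in lborel. s > t \<longrightarrow> (\<exists>v1 v2. (q has_vector_derivative (v1, v2, g)) (at s) \<and> speed_of (rival i) (v1, v2) = 1)"
    using adm(3)
  proof eventually_elim
    case (elim s)
    show ?case
    proof
      assume s: "t < s"
      then obtain v1 v2 where v: "(q has_vector_derivative (v1, v2, g)) (at s)" "(v1, v2) \<in> K g \<sigma> (s, q)"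
        using elim by blast
      have "speed_of (rival i) (v1, v2) = 1"
        by (rule off_path_unit_speed[where \<sigma>=\<sigma>, OF g' \<sigma>(2) adm(1) _ _ _ v(2), of u]) (use u s adm(2)[of u] in auto)
      then show "\<exists>v1 v2. (q has_vector_derivative (v1, v2, g)) (at s) \<and> speed_of (rival i) (v1, v2) = 1"
        using v(1) by blast
    qed
  qed
  then have "path_payoff r lam \<pi> i t q \<le> ennreal (\<pi> i (cap i (q t)) (cap (rival i) (q t))) * R_race g r lam \<pi> i (q t)"
    using t by (intro path_payoff_le_race adm(1) unit_speed_cap[OF g' adm(1)]) auto
  then show "path_payoff r lam \<pi> i (fst (t, h)) q
      \<le> ennreal (\<pi> i (cap i (h t)) (cap (rival i) (h t))) * R_race g r lam \<pi> i (h t)"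
    using adm(2)[of t] t by simp
qed

text \<open>Any one admissible path bounds the supremum from below. Existence says nothing about its
  shape, so \<open>unit\<close> is asked of every feasible extension of \<open>h\<close>.\<close>

lemma race_le_value:
  assumes \<sigma>: "\<And>i. \<sigma> i \<in> strategies g" and H: "feasible_history g (t, h)"
    and unit: "\<And>q s v. \<lbrakk>\<And>T. moves g T q; \<And>s. 0 \<le> s \<Longrightarrow> s \<le> t \<Longrightarrow> q s = h s; t < s; v \<in> K g \<sigma> (s, q)\<rbrakk> \<Longrightarrow> speed_of i v = 1"
  shows "ennreal (\<pi> i (cap i (h t)) (cap (rival i) (h t))) * R_race g r lam \<pi> i (h t) \<le> V g r lam \<pi> i \<sigma> (t, h)"
proof -
  have t: "0 \<le> t" using H feasible_history_iff[OF g'] by simp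
  obtain q where q: "q \<in> admissible g \<sigma> (t, h)"
    using admissible_nonempty[where \<sigma>=\<sigma>, OF g' \<sigma> H] by blast
  note adm = admissibleD[where \<sigma>=\<sigma>, OF g' \<sigma> H q]
  have "AE s in lborel. s > t \<longrightarrow> (\<exists>v1 v2. (q has_vector_derivative (v1, v2, g)) (at s) \<and> speed_of i (v1, v2) = 1)"
    using adm(3) by eventually_elim (use unit[OF adm(1,2)] in blast)
  then have "ennreal (\<pi> i (cap i (q t)) (cap (rival i) (q t))) * R_race g r lam \<pi> i (q t) \<le> path_payoff r lam \<pi> i t q"
    using t by (intro path_payoff_ge_race adm(1) unit_speed_cap[OF g' adm(1)]) auto
  also have "\<dots> \<le> V g r lam \<pi> i \<sigma> (t, h)"
    unfolding V_def using q by (simp add: SUP_upper)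
  finally show ?thesis using adm(2)[of t] t by simp
qed

text \<open>Until its exit date \<tau> a path earns what pacing earns, and at \<tau> the state is
  still diagonal. From there the rival races, so the rest is worth at most a race, and the assumed
  inequality at \<open>A0 + g * \<tau>\<close> compares it with continued pacing.\<close>

lemma grim_value_le_pacing:
  assumes \<sigma>: "\<And>i. \<sigma> i \<in> strategies g" "\<sigma> (rival i) = grim_trigger g A0 (rival i)"
    and H: "feasible_history g (t, h)" and h: "\<And>s. 0 \<le> s \<Longrightarrow> s \<le> t \<Longrightarrow> h s = pacing g A0 s"
    and PR: "\<And>x. A0 \<le> x \<Longrightarrow> R_race g r lam \<pi> i (x, x, x) \<le> P_pace g r \<pi> i x"
  shows "V g r lam \<pi> i \<sigma> (t, h) \<le> path_payoff r lam \<pi> i t (pacing g A0)"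
  unfolding V_def
proof (rule SUP_least)
  let ?p = "pacing g A0"
  fix q assume q: "q \<in> admissible g \<sigma> (t, h)"
  note adm = admissibleD[where \<sigma>=\<sigma>, OF g' \<sigma>(1) H q]
  have t: "0 \<le> t" using H feasible_history_iff[OF g'] by simp
  have "path_payoff r lam \<pi> i t q \<le> path_payoff r lam \<pi> i t ?p"
  proof (cases "\<forall>s\<ge>t. q s = ?p s")
    case True
    then have "flow i t q s = flow i t ?p s" if "t \<le> s" for s
      using that by (intro flow_cong) auto
    then show ?thesis
      unfolding path_payoff_eq by (intro nn_integral_mono) (auto simp: indicator_def)
  next
    case False
    then obtain s0 where s0: "t \<le> s0" "q s0 \<noteq> ?p s0" by blast
    \<comment> \<open>The dates up to which the path agrees with pacing; the supremum is the exit
      date and may equal \<open>t\<close>.\<close>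
    define Z where "Z = {s. 0 \<le> s \<and> (\<forall>u\<in>{0..s}. q u = ?p u)}"
    have tZ: "t \<in> Z" using t adm(2) h by (auto simp: Z_def)
    have "z \<le> s0" if "z \<in> Z" for z
      using that s0 t by (cases "s0 \<le> z") (auto simp: Z_def)
    then have bdd: "bdd_above Z" by (rule bdd_aboveI)
    define \<tau> where "\<tau> = Sup Z"
    have \<tau>: "t \<le> \<tau>" "0 \<le> \<tau>" using cSup_upper[OF tZ bdd] t by (auto simp: \<tau>_def)
    have below: "q u = ?p u" if u: "0 \<le> u" "u < \<tau>" for u
    proof -
      obtain z where "z \<in> Z" "u < z" using less_cSupD[of Z u] u tZ by (auto simp: \<tau>_def)
      then show ?thesis using u by (simp add: Z_def)
    qed
    have at: "q \<tau> = ?p \<tau>"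
    proof (rule moves_eq_left[OF adm(1) moves_pacing[OF g'] g'])
      fix d :: real assume d: "0 < d"
      obtain z where z: "z \<in> Z" "\<tau> - d < z" using less_cSupD[of Z "\<tau> - d"] d tZ by (auto simp: \<tau>_def)
      then show "\<exists>v\<ge>0. v \<le> \<tau> \<and> \<tau> - v < d \<and> q v = ?p v"
        using cSup_upper[OF z(1) bdd] by (intro exI[of _ z]) (auto simp: Z_def \<tau>_def)
    qed
    \<comment> \<open>There need not be a first departed date, but every date after \<tau> has a
      departure in its past, which suffices for unit speed of the rival.\<close>
    have "AE s in lborel. s > \<tau> \<longrightarrow> (\<exists>v1 v2. (q has_vector_derivative (v1, v2, g)) (at s) \<and> speed_of (rival i) (v1, v2) = 1)"
      using adm(3)
    proof eventually_elim
      case (elim s)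
      show ?case
      proof
        assume s: "\<tau> < s"
        then obtain v1 v2 where v: "(q has_vector_derivative (v1, v2, g)) (at s)" "(v1, v2) \<in> K g \<sigma> (s, q)"
          using elim \<tau> by auto
        have "s \<notin> Z" using s cSup_upper[OF _ bdd, of s] by (auto simp: \<tau>_def)
        then obtain u where "u \<in> {0..s}" "q u \<noteq> ?p u" using s \<tau> by (auto simp: Z_def)
        then have "speed_of (rival i) (v1, v2) = 1"
          using s \<tau> by (intro off_path_unit_speed[where \<sigma>=\<sigma>, OF g' \<sigma>(2) adm(1) _ _ _ v(2)]) auto
        then show "\<exists>v1 v2. (q has_vector_derivative (v1, v2, g)) (at s) \<and> speed_of (rival i) (v1, v2) = 1"
          using v(1) by blast
      qed
    qed
    then have "path_payoff r lam \<pi> i \<tau> q \<le> ennreal (\<pi> i (cap i (q \<tau>)) (cap (rival i) (q \<tau>))) * R_race g r lam \<pi> i (q \<tau>)"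
      using \<tau> by (intro path_payoff_le_race adm(1) unit_speed_cap[OF g' adm(1)]) auto
    also have "\<dots> \<le> path_payoff r lam \<pi> i \<tau> ?p"
      using PR[of "A0 + g * \<tau>"] g \<tau>
      unfolding at cap_pacing path_payoff_pacing[OF \<tau>(2)] by (intro mult_left_mono) (auto simp: pacing_def)
    finally have tail: "path_payoff r lam \<pi> i \<tau> q \<le> path_payoff r lam \<pi> i \<tau> ?p" .
    have "path_payoff r lam \<pi> i t q = (\<integral>\<^sup>+s\<in>{t..<\<tau>}. ennreal (flow i t ?p s) \<partial>lborel)
      + ennreal (exp (- r * (\<tau> - t))) * path_payoff r lam \<pi> i \<tau> q"
      using path_payoff_split[OF adm(1) t \<tau>(1)] path_payoff_split_cong[OF \<tau>(1), of q ?p i] below t by simp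
    also have "\<dots> \<le> (\<integral>\<^sup>+s\<in>{t..<\<tau>}. ennreal (flow i t ?p s) \<partial>lborel)
      + ennreal (exp (- r * (\<tau> - t))) * path_payoff r lam \<pi> i \<tau> ?p"
      using tail by (intro add_left_mono mult_left_mono) auto
    also have "\<dots> = path_payoff r lam \<pi> i t ?p"
      using path_payoff_split[OF moves_pacing[OF g'] t \<tau>(1), of A0 i] by simp
    finally show ?thesis .
  qed
  then show "path_payoff r lam \<pi> i (fst (t, h)) q \<le> path_payoff r lam \<pi> i t ?p" by simp
qed

text \<open>At each history one number separates the two sides: it bounds all deviations from above
  and the trigger from below. It is the pacing payoff on the path and the race payoff off
  it.\<close>

lemma grim_trigger_SPE:
  assumes PR: "\<And>i x. A0 \<le> x \<Longrightarrow> R_race g r lam \<pi> i (x, x, x) \<le> P_pace g r \<pi> i x"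
  shows "SPE g r lam \<pi> (grim_trigger g A0)"
  unfolding SPE_def
proof (intro conjI allI impI ballI)
  let ?\<sigma> = "grim_trigger g A0"
  show strat: "?\<sigma> i \<in> strategies g" for i by (rule grim_trigger_strategy[OF g'])
  fix H i \<sigma>' assume H: "feasible_history g H" and \<sigma>': "\<sigma>' \<in> strategies g"
  obtain t h where th: "H = (t, h)" by (cases H)
  have t: "0 \<le> t" using H feasible_history_iff[OF g'] by (simp add: th)
  have dev: "(?\<sigma>(i := \<sigma>')) k \<in> strategies g" "(?\<sigma>(i := \<sigma>')) (rival i) = ?\<sigma> (rival i)" for k
    using strat \<sigma>' by (auto, cases i) auto
  show "V g r lam \<pi> i (?\<sigma>(i := \<sigma>')) H \<le> V g r lam \<pi> i ?\<sigma> H"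
  proof (cases "\<forall>s\<in>{0..t}. h s = pacing g A0 s")
    case True
    then have "V g r lam \<pi> i (?\<sigma>(i := \<sigma>')) (t, h) \<le> path_payoff r lam \<pi> i t (pacing g A0)"
      using PR H[unfolded th] by (intro grim_value_le_pacing dev) auto
    also have "\<dots> \<le> V g r lam \<pi> i ?\<sigma> (t, h)"
      unfolding V_def using pacing_admissible[OF g' t, of h A0] True by (simp add: SUP_upper)
    finally show ?thesis by (simp add: th)
  next
    case False
    then obtain u where u: "u \<in> {0..t}" "h u \<noteq> pacing g A0 u" by blast
    have "V g r lam \<pi> i (?\<sigma>(i := \<sigma>')) (t, h)
        \<le> ennreal (\<pi> i (cap i (h t)) (cap (rival i) (h t))) * R_race g r lam \<pi> i (h t)"
      by (rule grim_value_le_race[where \<sigma>="?\<sigma>(i := \<sigma>')", OF dev H[unfolded th] u])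
    also have "\<dots> \<le> V g r lam \<pi> i ?\<sigma> (t, h)"
    proof (rule race_le_value[OF strat H[unfolded th]])
      fix q s v assume "\<And>T. moves g T q" "\<And>s. 0 \<le> s \<Longrightarrow> s \<le> t \<Longrightarrow> q s = h s" "t < s" "v \<in> K g ?\<sigma> (s, q)"
      then show "speed_of i v = 1" using u by (intro off_path_unit_speed[OF g', of ?\<sigma> i A0 s q u]) auto
    qed
    finally show ?thesis by (simp add: th)
  qed
qed

lemma grim_trigger_outcome:
  assumes PR: "\<And>i x. A0 \<le> x \<Longrightarrow> R_race g r lam \<pi> i (x, x, x) \<le> P_pace g r \<pi> i x"
  shows "SPE_outcome_under g r lam \<pi> (grim_trigger g A0) (initial A0) (pacing g A0)"
  unfolding SPE_outcome_under_def
proof (intro conjI allI)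
  let ?\<sigma> = "grim_trigger g A0"
  show "SPE g r lam \<pi> ?\<sigma>" by (rule grim_trigger_SPE[OF PR])
  have init: "(A0, A0, A0) = pacing g A0 s" if "0 \<le> s" "s \<le> 0" for s
    using that by (simp add: pacing_def)
  show adm: "pacing g A0 \<in> admissible g ?\<sigma> (initial A0)"
    unfolding initial_def using init by (intro pacing_admissible g') auto
  fix i
  show "path_payoff r lam \<pi> i (fst (initial A0)) (pacing g A0) = V g r lam \<pi> i ?\<sigma> (initial A0)"
  proof (rule antisym)
    show "path_payoff r lam \<pi> i (fst (initial A0)) (pacing g A0) \<le> V g r lam \<pi> i ?\<sigma> (initial A0)"
      unfolding V_def using adm by (rule SUP_upper)
    show "V g r lam \<pi> i ?\<sigma> (initial A0) \<le> path_payoff r lam \<pi> i (fst (initial A0)) (pacing g A0)"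
      using init PR feasible_initial[OF g', of A0] grim_trigger_strategy[OF g']
      unfolding initial_def fst_conv by (intro grim_value_le_pacing) auto
  qed
qed

text \<open>Attainment at the initial history propagates along the path: a better continuation at
  date \<open>t\<close>, preceded by pacing, would beat the value at the start. Hence the
  equilibrium value at \<open>t\<close> is at most the pacing payoff there, and the deviation to
  racing bounds it from below.\<close>

lemma pacing_outcome_necessary:
  assumes out: "SPE_outcome g r lam \<pi> (initial A0) (pacing g A0)" and x: "A0 \<le> x"
    and fin: "P_pace g r \<pi> i A0 < \<infinity>"
  shows "R_race g r lam \<pi> i (x, x, x) \<le> P_pace g r \<pi> i x"
proof -
  let ?p = "pacing g A0"
  obtain \<sigma> where SPE: "SPE g r lam \<pi> \<sigma>" and adm: "?p \<in> admissible g \<sigma> (initial A0)"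
    and val: "\<And>i. path_payoff r lam \<pi> i 0 ?p = V g r lam \<pi> i \<sigma> (initial A0)"
    using out by (auto simp: SPE_outcome_def SPE_outcome_under_def initial_def)
  have \<sigma>: "\<sigma> k \<in> strategies g" for k using SPE by (simp add: SPE_def)
  \<comment> \<open>The date at which pacing reaches capability \<open>x\<close>.\<close>
  define t where "t = (x - A0) / g"
  have t: "0 \<le> t" "A0 + g * t = x" using g x by (auto simp: t_def)
  have H: "feasible_history g (t, ?p)" using t moves_pacing[OF g'] by (simp add: feasible_history_iff[OF g'])
  have one: "(\<lambda>_ _. 1) \<in> strategies g" by (rule const_strategy) simp
  let ?\<sigma>' = "\<sigma>(i := \<lambda>_ _. 1)"
  have "ennreal (\<pi> i (cap i (?p t)) (cap (rival i) (?p t))) * R_race g r lam \<pi> i (?p t) \<le> V g r lam \<pi> i ?\<sigma>' (t, ?p)"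
  proof (rule race_le_value[OF _ H])
    show "?\<sigma>' k \<in> strategies g" for k using \<sigma> one by simp
    show "speed_of i v = 1" if "v \<in> K g ?\<sigma>' (s, q)" for q s v
      \<comment> \<open>The deviation races after every history, so any radius serves; 1 is
        taken.\<close>
      by (rule K_unit_speed[OF zero_less_one _ that]) (simp add: prescribed_def)
  qed
  also have "\<dots> \<le> V g r lam \<pi> i \<sigma> (t, ?p)"
    using SPE H one by (simp add: SPE_def)
  also have "\<dots> \<le> path_payoff r lam \<pi> i t ?p"
    unfolding V_def
  proof (rule SUP_least)
    fix q assume q: "q \<in> admissible g \<sigma> (t, ?p)"
    note admq = admissibleD[where \<sigma>=\<sigma>, OF g' \<sigma> H q]
    let ?A = "\<integral>\<^sup>+s\<in>{0..<t}. ennreal (flow i 0 ?p s) \<partial>lborel"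
    let ?e = "ennreal (exp (- r * (t - 0)))"
    have P: "path_payoff r lam \<pi> i 0 ?p = ?A + ?e * path_payoff r lam \<pi> i t ?p"
      using path_payoff_split[OF moves_pacing[OF g'] order_refl t(1), of A0 i] by simp
    have "path_payoff r lam \<pi> i 0 q = ?A + ?e * path_payoff r lam \<pi> i t q"
      using path_payoff_split[OF admq(1) order_refl t(1)] path_payoff_split_cong[OF t(1), of q ?p i] admq(2) by simp
    moreover have "path_payoff r lam \<pi> i 0 q \<le> V g r lam \<pi> i \<sigma> (initial A0)"
      unfolding V_def using admissible_from_initial[OF adm q t(1)]
      by (intro SUP_upper2[of q]) (auto simp: initial_def)
    ultimately have le: "?A + ?e * path_payoff r lam \<pi> i t q \<le> ?A + ?e * path_payoff r lam \<pi> i t ?p"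
      using P val by simp
    \<comment> \<open>Cancelling the common part \<open>?A\<close> in the extended reals needs it
      finite; it is a part of the pacing payoff from \<open>A0\<close>.\<close>
    have "?A \<le> path_payoff r lam \<pi> i 0 ?p" unfolding P by simp
    also have "\<dots> < \<infinity>"
      using fin by (simp add: path_payoff_pacing ennreal_mult_less_top)
    finally have "?e * path_payoff r lam \<pi> i t q \<le> ?e * path_payoff r lam \<pi> i t ?p"
      using le by (auto simp: ennreal_add_left_cancel_le)
    then show "path_payoff r lam \<pi> i (fst (t, ?p)) q \<le> path_payoff r lam \<pi> i t ?p"
      by (simp add: ennreal_mult_le_mult_iff)
  qed
  also have "\<dots> = ennreal (\<pi> i x x) * P_pace g r \<pi> i x"
    using path_payoff_pacing[OF t(1), of i A0] t(2) by simp
  finally have "ennreal (\<pi> i x x) * R_race g r lam \<pi> i (x, x, x) \<le> ennreal (\<pi> i x x) * P_pace g r \<pi> i x"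
    by (simp add: t(2) pacing_def[of g A0 t] cap_diagonal)
  then show ?thesis using \<pi>_pos[of i x x] by (simp add: ennreal_mult_le_mult_iff)
qed

end

section \<open>Integrating the derivative conditions on profits\<close>

lemma partial_differentiable:
  fixes f :: "real \<Rightarrow> real \<Rightarrow> real"
  assumes "((\<lambda>(a, b). f a b) has_derivative F) (at (a, b))"
  shows "(\<lambda>x. f x b) differentiable (at a)" "(\<lambda>y. f a y) differentiable (at b)"
proof -
  have 1: "((\<lambda>x. (x, b)) has_derivative (\<lambda>h. (h, 0))) (at a)"
    and 2: "((\<lambda>y. (a, y)) has_derivative (\<lambda>h. (0, h))) (at b)"
    by (auto intro!: derivative_eq_intros)
  show "(\<lambda>x. f x b) differentiable (at a)" "(\<lambda>y. f a y) differentiable (at b)"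
    using has_derivative_compose[OF 1, of "\<lambda>(a, b). f a b" F] has_derivative_compose[OF 2, of "\<lambda>(a, b). f a b" F] assms
    by (auto simp: differentiable_def)
qed

theorem proposition3:
  fixes g r \<alpha> lam0 A0 :: real
    and lam \<phi> :: "real \<Rightarrow> real"
    and \<pi> :: profit
  assumes g: "0 < g" "g < 1" and r: "0 < r" and \<alpha>: "0 < \<alpha>"
    and lam_nonneg: "\<And>D. 0 \<le> lam D"
    and lam_nonpos_gap: "\<And>D. D \<le> 0 \<Longrightarrow> lam D = 0"
    and lam_pos_gap: "\<And>D. 0 < D \<Longrightarrow> lam D = lam0 + \<phi> D"
    and lam0: "0 \<le> lam0"
    and \<phi>_zero: "\<phi> 0 = 0"
    and \<phi>_cont: "continuous_on {0..} \<phi>"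
    and \<phi>_mono: "mono_on {0..} \<phi>"
    and \<phi>_concave: "concave_on {0..} \<phi>"
    and \<phi>_C2: "\<phi> differentiable_on {0<..}" "deriv \<phi> differentiable_on {0<..}"
      "continuous_on {0<..} (deriv (deriv \<phi>))"
    and lam_bdd: "bdd_above (lam ` {0<..})"
    and lam_bar: "(SUP D\<in>{0<..}. lam D) \<le> (1 - g) * \<alpha>"
    and \<pi>_pos: "\<And>i a b. 0 < \<pi> i a b"
    and \<pi>_C1: "\<And>i. \<exists>F :: real \<times> real \<Rightarrow> (real \<times> real) \<Rightarrow>\<^sub>L real.
      continuous_on UNIV F \<and>
      (\<forall>z. ((\<lambda>(a, b). \<pi> i a b) has_derivative blinfun_apply (F z)) (at z))"
    and \<pi>_own: "\<And>i a b. \<alpha> \<le> deriv (\<lambda>a'. ln (\<pi> i a' b)) a"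
    and \<pi>_rival: "\<And>i a b. deriv (\<lambda>b'. \<pi> i a b') b \<le> 0"
    and R_finite: "\<And>i S. R_race g r lam \<pi> i S < \<infinity>"
    and P_finite: "\<And>i x. P_pace g r \<pi> i x < \<infinity>"
  shows "(SPE_outcome g r lam \<pi> (initial A0) (pacing g A0) \<longleftrightarrow>
      (\<forall>i. \<forall>x\<ge>A0. P_pace g r \<pi> i x \<ge> R_race g r lam \<pi> i (x, x, x)))
    \<and> ((\<forall>i. \<forall>x\<ge>A0. P_pace g r \<pi> i x \<ge> R_race g r lam \<pi> i (x, x, x)) \<longrightarrow>
      SPE g r lam \<pi> (grim_trigger g A0) \<and>
      SPE_outcome_under g r lam \<pi> (grim_trigger g A0) (initial A0) (pacing g A0))"
proof -
  have \<pi>_diff: "(\<lambda>x. \<pi> i x b) differentiable (at a)" "(\<lambda>y. \<pi> i a y) differentiable (at b)"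
    and \<pi>_cont: "isCont (\<lambda>z. \<pi> i (fst z) (snd z)) (a, b)" for i a b
  proof -
    obtain F :: "real \<times> real \<Rightarrow> (real \<times> real) \<Rightarrow>\<^sub>L real"
      where F: "\<And>z. ((\<lambda>(a, b). \<pi> i a b) has_derivative blinfun_apply (F z)) (at z)"
      using \<pi>_C1[of i] by blast
    show "(\<lambda>x. \<pi> i x b) differentiable (at a)" "(\<lambda>y. \<pi> i a y) differentiable (at b)"
      using partial_differentiable[OF F] by blast+
    show "isCont (\<lambda>z. \<pi> i (fst z) (snd z)) (a, b)"
      using has_derivative_continuous[OF F[of "(a, b)"]] by (simp add: case_prod_unfold)
  qed
  interpret development_race g r \<alpha> lam \<pi>
  proof
    show "0 < g" "g < 1" by fact+
    show "0 \<le> lam D" for D by fact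
    show "lam D = 0" if "D \<le> 0" for D using lam_nonpos_gap that .
    show "mono lam"
    proof (rule monoI)
      fix D D' :: real assume "D \<le> D'"
      moreover have "0 \<le> lam D'" by fact
      moreover have "\<phi> D \<le> \<phi> D'" if "0 < D"
        using \<phi>_mono \<open>D \<le> D'\<close> that by (auto simp: mono_on_def)
      ultimately show "lam D \<le> lam D'"
        using lam_nonpos_gap[of D] lam_pos_gap[of D] lam_pos_gap[of D'] by (cases "D \<le> 0") auto
    qed
    show "lam D \<le> (1 - g) * \<alpha>" for D
    proof (cases "D \<le> 0")
      case True
      then show ?thesis using lam_nonpos_gap g \<alpha> by simp
    next
      case False
      then have "lam D \<le> (SUP D\<in>{0<..}. lam D)" using lam_bdd by (intro cSUP_upper) auto
      then show ?thesis using lam_bar by linarith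
    qed
    show "0 < \<pi> i a b" for i a b by fact
    show "continuous_on UNIV (\<lambda>z. \<pi> i (fst z) (snd z))" for i
      using \<pi>_cont by (auto simp: continuous_on_eq_continuous_at)
    show "exp (\<alpha> * (a' - a)) * \<pi> i a b \<le> \<pi> i a' b" if "a \<le> a'" for a a' i b
    proof -
      \<comment> \<open>Log profit minus \<alpha> times own capability is nondecreasing;
        exponentiating gives the growth factor.\<close>
      have "ln (\<pi> i a b) - \<alpha> * a \<le> ln (\<pi> i a' b) - \<alpha> * a'"
      proof (rule DERIV_nonneg_imp_nondecreasing[OF that])
        fix x
        \<comment> \<open>A bound on \<open>deriv\<close> carries information only where the
          derivative exists; continuous differentiability of the profit supplies this.\<close>
        have "((\<lambda>x. \<pi> i x b) has_real_derivative deriv (\<lambda>x. \<pi> i x b) x) (at x)"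
          using \<pi>_diff(1) DERIV_deriv_iff_real_differentiable by blast
        then have "((\<lambda>x. ln (\<pi> i x b)) has_real_derivative inverse (\<pi> i x b) * deriv (\<lambda>x. \<pi> i x b) x) (at x)"
          using \<pi>_pos by (auto intro!: derivative_eq_intros simp: divide_inverse mult.commute)
        then have D: "((\<lambda>x. ln (\<pi> i x b)) has_real_derivative deriv (\<lambda>x. ln (\<pi> i x b)) x) (at x)"
          by (simp add: DERIV_imp_deriv)
        have "((\<lambda>x. ln (\<pi> i x b) - \<alpha> * x) has_real_derivative deriv (\<lambda>x. ln (\<pi> i x b)) x - \<alpha>) (at x)"
          by (rule DERIV_diff[OF D DERIV_cmult_Id])
        then show "\<exists>y. ((\<lambda>x. ln (\<pi> i x b) - \<alpha> * x) has_real_derivative y) (at x) \<and> 0 \<le> y"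
          using \<pi>_own[of i b x] by auto
      qed
      then have "\<alpha> * (a' - a) + ln (\<pi> i a b) \<le> ln (\<pi> i a' b)" by (simp add: algebra_simps)
      then have "exp (\<alpha> * (a' - a) + ln (\<pi> i a b)) \<le> exp (ln (\<pi> i a' b))" by simp
      then show ?thesis using \<pi>_pos by (simp add: exp_add)
    qed
    show "\<pi> i a b' \<le> \<pi> i a b" if "b \<le> b'" for b b' i a
    proof (rule DERIV_nonpos_imp_nonincreasing[OF that])
      fix y
      have "((\<lambda>y. \<pi> i a y) has_real_derivative deriv (\<lambda>y. \<pi> i a y) y) (at y)"
        using \<pi>_diff(2) DERIV_deriv_iff_real_differentiable by blast
      then show "\<exists>d. ((\<lambda>y. \<pi> i a y) has_real_derivative d) (at y) \<and> d \<le> 0"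
        using \<pi>_rival[of i a y] by auto
    qed
  qed
  let ?C = "\<forall>i. \<forall>x\<ge>A0. P_pace g r \<pi> i x \<ge> R_race g r lam \<pi> i (x, x, x)"
  have grim: "SPE g r lam \<pi> (grim_trigger g A0) \<and>
      SPE_outcome_under g r lam \<pi> (grim_trigger g A0) (initial A0) (pacing g A0)" if ?C
    using that grim_trigger_SPE grim_trigger_outcome by blast
  moreover have ?C if "SPE_outcome g r lam \<pi> (initial A0) (pacing g A0)"
    using pacing_outcome_necessary[OF that] P_finite by blast
  ultimately show ?thesis unfolding SPE_outcome_def by blast
qed

end
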